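(* Let $B\subset S$ be a norming region, $h(x)=\mathbb E^x[\#\mathcal H_B]$, and suppose that $\bar m_x:=\sum_{k\in\mathbb N}(k-1)\,d^{\mathrm{s.b.}}_x(k)$ is finite for all $x\in S$. If $$C:=\sup_{x\in S}\frac1{h(x)}\sum_{y\in B^c}\frac{\bar m_y}{m_y}\,g(x,y)\,h(y)^2<\infty,$$ then every $P_h$-quasi-process $\eta$ is decorable. Moreover, for every $x\in S$, $$\frac{1}{4C+2}\,h(x)\le\mathbb P^x(\mathfrak T_B)\le h(x).$$
   Context: Setting: $S$ countable, $p=(p_{x,y})$ stochastic on $S$, $(d_x)_{x\in S}$ probability distributions on $\mathbb N_0$; $m_x=\sum_mm\,d_x(m)$, $q_{x,y}=m_xp_{x,y}$, $Q=(q_{x,y})$, $g(x,y)=\sum_{n\ge0}(Q^n)_{x,y}$ assumed finite; $d^{\mathrm{s.b.}}_x(n)=n\,d_x(n)/m_x$. Branching Markov chain $\mathbb P^x$: starting from one individual at $x$, each individual at $z$ independently has a $d_z$-distributed number of children at independent $p(z,\cdot)$-locations (individuals carry independent uniform labels and pointers to their parents). $\mathcal H_B$ is the set of individuals located in $B$ with no strict ancestor in $B$; $\mathfrak T_B$ denotes the event that some individual is located in $B$. A norming region is a finite $B\subset S$ with $\sum_{y\in B}g(x,y)>0$ for all $x$. Quasi-processes: $D$ = paths $w\in(S\cup\{\partial\})^{\mathbb Z}$ with $w_n\in S$ iff $t_\partial\le n<t^\partial$ ($t_\partial<t^\partial$ in $\mathbb Z\cup\{\pm\infty\}$) and $w_n\to\partial$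 as $n\to-\infty$; $D^*$ = $D$ modulo time shifts. For finite $B'$: $D^*_{B'}$, $H_{B'}$ (first position in $B'$), $\pi_{B'}$ (path from first entrance on). $P_h$: substochastic matrix $p^h_{x,y}=\mathbf 1_{B^c}(x)q_{x,y}h(y)/h(x)$ with chain laws $P_h^x$. A $P_h$-quasi-process is a measure $\eta$ on $D^*$ with $\eta(D^*_{B'})<\infty$ and $\eta|_{D^*_{B'}}(\pi_{B'}\in\cdot)=P_h^{\bar\mu}$, $\bar\mu=\eta|_{D^*_{B'}}(H_{B'}\in\cdot)$, for all finite $B'$. Decoration $\bar\Gamma^{\mathrm{deco}}([w],\cdot)$: create spine individuals (uniform labels $i_k$) at $w_k$, $k\in\mathbb Z\cap[t_\partial,t^\partial)$, with predecessor $i_{k-1}$ (none if $k=t_\partial$); to each spine individual at $x\notin B$ attach, independently with probability $d^{\mathrm{s.b.}}_x(n)$, $n-1$ further children at independent $p(x,\cdot)$-locations, each the root of an independent branching Markov chain; each spine individual at $x\in B$ is the root of an independent branching Markov chain. A measure $\eta$ on $D^*$ is decorable if $\eta$-almost every decorated result is a transient tree: only finitely many individuals at each location (and the genealogy forms a tree). *)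

theory Defs
  imports "HOL-Probability.Probability"
begin

text \<open>Individuals are encoded by reversed Ulam-Harris words: the root is [],
  the i-th child of ws is i # ws; the strict ancestors of ws are drop k ws, 1 <= k <= length ws.
  The randomness omega assigns to every pair (ws, z) an independent sample
  (N, Y) of d z (x) P z: an individual ws located at z has N_(ws,z) children, and the
  child i # ws of an individual at z is located at Y_(i#ws, z).  This yields exactly the
  branching Markov chain described in the paper.\<close>

primrec bloc :: "'a \<Rightarrow> (nat list \<times> 'a \<Rightarrow> nat \<times> 'a) \<Rightarrow> nat list \<Rightarrow> 'a option" where
  "bloc x \<omega> [] = Some x"
| "bloc x \<omega> (i # ws) = (case bloc x \<omega> ws of None \<Rightarrow> None
      | Some z \<Rightarrow> (if i < fst (\<omega> (ws, z)) then Some (snd (\<omega> (i # ws, z))) else None))"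

definition bmc_rand :: "('a \<Rightarrow> nat pmf) \<Rightarrow> ('a \<Rightarrow> 'a pmf) \<Rightarrow> (nat list \<times> 'a \<Rightarrow> nat \<times> 'a) measure" where
  "bmc_rand d P = PiM UNIV (\<lambda>(ws, z). measure_pmf (pair_pmf (d z) (P z)))"

definition prob_hit :: "('a \<Rightarrow> nat pmf) \<Rightarrow> ('a \<Rightarrow> 'a pmf) \<Rightarrow> 'a set \<Rightarrow> 'a \<Rightarrow> ennreal" where
  "prob_hit d P B x = emeasure (bmc_rand d P)
      {\<omega> \<in> space (bmc_rand d P). \<exists>ws. bloc x \<omega> ws \<in> Some ` B}"

definition first_hit :: "'a set \<Rightarrow> 'a \<Rightarrow> (nat list \<times> 'a \<Rightarrow> nat \<times> 'a) \<Rightarrow> nat list \<Rightarrow> bool" where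
  "first_hit B x \<omega> ws \<longleftrightarrow> bloc x \<omega> ws \<in> Some ` B \<and>
      (\<forall>k\<in>{1..length ws}. bloc x \<omega> (drop k ws) \<notin> Some ` B)"

definition hB :: "('a \<Rightarrow> nat pmf) \<Rightarrow> ('a \<Rightarrow> 'a pmf) \<Rightarrow> 'a set \<Rightarrow> 'a \<Rightarrow> ennreal" where
  "hB d P B x = (\<integral>\<^sup>+ \<omega>. (\<integral>\<^sup>+ ws. indicator {ws. first_hit B x \<omega> ws} ws \<partial>count_space UNIV)
      \<partial>bmc_rand d P)"

definition bmc_count :: "'a \<Rightarrow> (nat list \<times> 'a \<Rightarrow> nat \<times> 'a) \<Rightarrow> 'a \<Rightarrow> ennreal" where
  "bmc_count x \<omega> z = (\<integral>\<^sup>+ ws. indicator {ws. bloc x \<omega> ws = Some z} ws \<partial>count_space UNIV)"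

definition mean :: "('a \<Rightarrow> nat pmf) \<Rightarrow> 'a \<Rightarrow> ennreal" where
  "mean d x = (\<integral>\<^sup>+ n. ennreal (real n) \<partial>measure_pmf (d x))"

definition qmat :: "('a \<Rightarrow> nat pmf) \<Rightarrow> ('a \<Rightarrow> 'a pmf) \<Rightarrow> 'a \<Rightarrow> 'a \<Rightarrow> ennreal" where
  "qmat d P x y = mean d x * ennreal (pmf (P x) y)"

fun Qpow :: "('a \<Rightarrow> nat pmf) \<Rightarrow> ('a \<Rightarrow> 'a pmf) \<Rightarrow> nat \<Rightarrow> 'a \<Rightarrow> 'a \<Rightarrow> ennreal" where
  "Qpow d P 0 x y = (if x = y then 1 else 0)"
| "Qpow d P (Suc n) x y = (\<integral>\<^sup>+ z. qmat d P x z * Qpow d P n z y \<partial>count_space UNIV)"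

definition green :: "('a \<Rightarrow> nat pmf) \<Rightarrow> ('a \<Rightarrow> 'a pmf) \<Rightarrow> 'a \<Rightarrow> 'a \<Rightarrow> ennreal" where
  "green d P x y = (\<Sum>n. Qpow d P n x y)"

text \<open>size-biased law d^{s.b.}_x(n) = n d_x(n) / m_x (convention: delta_1 if m_x is 0 or infinite)\<close>
definition dsb :: "('a \<Rightarrow> nat pmf) \<Rightarrow> 'a \<Rightarrow> nat pmf" where
  "dsb d x = (if 0 < mean d x \<and> mean d x < \<top>
      then embed_pmf (\<lambda>n. real n * pmf (d x) n / enn2real (mean d x))
      else return_pmf 1)"

definition barm :: "('a \<Rightarrow> nat pmf) \<Rightarrow> 'a \<Rightarrow> ennreal" where
  "barm d x = (\<integral>\<^sup>+ k. ennreal (real k - 1) \<partial>measure_pmf (dsb d x))"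

definition norming_region :: "('a \<Rightarrow> nat pmf) \<Rightarrow> ('a \<Rightarrow> 'a pmf) \<Rightarrow> 'a set \<Rightarrow> bool" where
  "norming_region d P B \<longleftrightarrow> finite B \<and> (\<forall>x. (\<Sum>y\<in>B. green d P x y) > 0)"

definition Cconst :: "('a \<Rightarrow> nat pmf) \<Rightarrow> ('a \<Rightarrow> 'a pmf) \<Rightarrow> 'a set \<Rightarrow> ennreal" where
  "Cconst d P B = (SUP x. (\<integral>\<^sup>+ y. indicator (- B) y * (barm d y / mean d y) * green d P x y
        * (hB d P B y)\<^sup>2 \<partial>count_space UNIV) / hB d P B x)"

text \<open>Paths w : int => S + {boundary}, with None playing the role of the cemetery.\<close>
definition inD :: "(int \<Rightarrow> 'a option) \<Rightarrow> bool" where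
  "inD w \<longleftrightarrow> (\<exists>a b :: ereal. a < b \<and>
        (\<forall>n. w n \<noteq> None \<longleftrightarrow> a \<le> ereal (of_int n) \<and> ereal (of_int n) < b))
     \<and> (\<forall>F. finite F \<longrightarrow> (\<forall>\<^sub>F n in at_bot. w n \<notin> Some ` F))"

definition shift_rel :: "((int \<Rightarrow> 'a option) \<times> (int \<Rightarrow> 'a option)) set" where
  "shift_rel = {(w, w'). inD w \<and> inD w' \<and> (\<exists>k::int. \<forall>n. w' n = w (n + k))}"

definition Dstar :: "(int \<Rightarrow> 'a option) set set" where
  "Dstar = {w. inD w} // shift_rel"

text \<open>quotient sigma-algebra on D* induced by the product sigma-algebra on paths\<close>
definition Dstar_sets :: "(int \<Rightarrow> 'a option) set set set" where
  "Dstar_sets = {A. A \<subseteq> Dstar \<and>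
      \<Union>A \<in> sets (PiM UNIV (\<lambda>_::int. count_space (UNIV :: 'a option set)))}"

definition rep :: "(int \<Rightarrow> 'a option) set \<Rightarrow> (int \<Rightarrow> 'a option)" where
  "rep c = (SOME w. w \<in> c)"

definition hits :: "'a set \<Rightarrow> (int \<Rightarrow> 'a option) \<Rightarrow> bool" where
  "hits B' w \<longleftrightarrow> (\<exists>n. w n \<in> Some ` B')"

definition fent :: "'a set \<Rightarrow> (int \<Rightarrow> 'a option) \<Rightarrow> int" where
  "fent B' w = (LEAST n. w n \<in> Some ` B')"

definition Hent :: "'a set \<Rightarrow> (int \<Rightarrow> 'a option) \<Rightarrow> 'a" where
  "Hent B' w = the (w (fent B' w))"

definition piB :: "'a set \<Rightarrow> (int \<Rightarrow> 'a option) \<Rightarrow> nat \<Rightarrow> 'a option" where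
  "piB B' w = (\<lambda>i. w (fent B' w + int i))"

definition ph :: "('a \<Rightarrow> nat pmf) \<Rightarrow> ('a \<Rightarrow> 'a pmf) \<Rightarrow> 'a set \<Rightarrow> 'a \<Rightarrow> 'a \<Rightarrow> ennreal" where
  "ph d P B x y = (if x \<notin> B then qmat d P x y * hB d P B y / hB d P B x else 0)"

fun ph_opt :: "('a \<Rightarrow> nat pmf) \<Rightarrow> ('a \<Rightarrow> 'a pmf) \<Rightarrow> 'a set \<Rightarrow> 'a option \<Rightarrow> 'a option \<Rightarrow> ennreal" where
  "ph_opt d P B (Some x) (Some y) = ph d P B x y"
| "ph_opt d P B (Some x) None = 1 - (\<integral>\<^sup>+ y. ph d P B x y \<partial>count_space UNIV)"
| "ph_opt d P B None (Some y) = 0"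
| "ph_opt d P B None None = 1"

fun pathprob :: "('a \<Rightarrow> nat pmf) \<Rightarrow> ('a \<Rightarrow> 'a pmf) \<Rightarrow> 'a set \<Rightarrow> 'a option list \<Rightarrow> ennreal" where
  "pathprob d P B (y # z # zs) = ph_opt d P B y z * pathprob d P B (z # zs)"
| "pathprob d P B _ = 1"

text \<open>eta is a P_h-quasi-process: a measure on D*, finite on each D*_{B'}, such that the law of
  pi_{B'} under eta restricted to D*_{B'} is the law P_h^{mu} of the P_h-chain (killed to the
  cemetery) with initial measure mu = eta|_{D*_{B'}}(H_{B'} \<in> .); the latter is specified by its
  values on cylinder sets, which determine it.\<close>
definition quasi_process :: "('a \<Rightarrow> nat pmf) \<Rightarrow> ('a \<Rightarrow> 'a pmf) \<Rightarrow> 'a set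
    \<Rightarrow> (int \<Rightarrow> 'a option) set measure \<Rightarrow> bool" where
  "quasi_process d P B \<eta> \<longleftrightarrow> space \<eta> = Dstar \<and> sets \<eta> = Dstar_sets \<and>
     (\<forall>B'. finite B' \<longrightarrow>
        emeasure \<eta> {c \<in> Dstar. hits B' (rep c)} < \<top> \<and>
        (\<forall>ys. ys \<noteq> [] \<longrightarrow>
           emeasure \<eta> {c \<in> Dstar. hits B' (rep c) \<and> (\<forall>i < length ys. piB B' (rep c) i = ys ! i)}
           = (case hd ys of None \<Rightarrow> 0
                | Some x \<Rightarrow> emeasure \<eta> {c \<in> Dstar. hits B' (rep c) \<and> Hent B' (rep c) = x})
             * pathprob d P B ys))"

text \<open>Randomness of the decoration of a path w: (K, Y, R) with
  K k ~ d^{s.b.}_{w_k} (number of children of the spine individual at time k, if w_k not in B),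
  Y (k,j) ~ p(w_k, .) (location of the j-th extra child),
  R (k,j,ws,z) the randomness of the independent branching Markov chains rooted at the extra
  children (k,j), resp. at the spine individual itself (k,0) if w_k \<in> B.\<close>
definition deco_meas :: "('a \<Rightarrow> nat pmf) \<Rightarrow> ('a \<Rightarrow> 'a pmf) \<Rightarrow> 'a set \<Rightarrow> (int \<Rightarrow> 'a option)
    \<Rightarrow> ((int \<Rightarrow> nat) \<times> (int \<times> nat \<Rightarrow> 'a) \<times> (int \<times> nat \<times> nat list \<times> 'a \<Rightarrow> nat \<times> 'a)) measure" where
  "deco_meas d P B w =
     PiM UNIV (\<lambda>k. measure_pmf (case w k of Some z \<Rightarrow> (if z \<notin> B then dsb d z else return_pmf 1)
                                         | None \<Rightarrow> return_pmf 1))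
     \<Otimes>\<^sub>M (PiM UNIV (\<lambda>(k, j). measure_pmf (case w k of Some z \<Rightarrow> P z | None \<Rightarrow> return_pmf undefined))
     \<Otimes>\<^sub>M PiM UNIV (\<lambda>(k, j, ws, z). measure_pmf (pair_pmf (d z) (P z))))"

definition deco_count :: "'a set \<Rightarrow> (int \<Rightarrow> 'a option)
    \<Rightarrow> ((int \<Rightarrow> nat) \<times> (int \<times> nat \<Rightarrow> 'a) \<times> (int \<times> nat \<times> nat list \<times> 'a \<Rightarrow> nat \<times> 'a)) \<Rightarrow> 'a \<Rightarrow> ennreal" where
  "deco_count B w \<omega> z = (case \<omega> of (K, Y, R) \<Rightarrow>
     (\<integral>\<^sup>+ k. indicator {k. w k = Some z} k \<partial>count_space UNIV)
     + (\<integral>\<^sup>+ k. (\<integral>\<^sup>+ j. (case w k of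
            Some v \<Rightarrow> (if v \<notin> B
                        then (if j < K k - 1 then bmc_count (Y (k, j)) (\<lambda>p. R (k, j, p)) z else 0)
                        else (if j = 0 then bmc_count v (\<lambda>p. R (k, 0, p)) z else 0))
          | None \<Rightarrow> 0) \<partial>count_space UNIV) \<partial>count_space UNIV))"

definition decorable :: "('a \<Rightarrow> nat pmf) \<Rightarrow> ('a \<Rightarrow> 'a pmf) \<Rightarrow> 'a set
    \<Rightarrow> (int \<Rightarrow> 'a option) set measure \<Rightarrow> bool" where
  "decorable d P B \<eta> \<longleftrightarrow>
     (AE c in \<eta>. AE \<omega> in deco_meas d P B (rep c). \<forall>z. deco_count B (rep c) \<omega> z < \<top>)"

end

theory Submission
  imports Defs
begin

text \<open>Splitting the branching Markov chain at its root turns the probability s_n(x) of not hitting B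
  within n generations into s_(n+1)(x) = E[(P s_n (x))^N] off B, N being the offspring number.  Off B the
  function h is harmonic for Q.  The Bonferroni bound (1 - a)^k \<le> 1 - k a + k (k - 1) a^2 / 2 and induction
  on n show that \<epsilon> h is at most the hitting probability plus \<epsilon>^2 / 2 times the Green
  potential of (barm / m) h^2 over the complement of B, and that potential is at most C h; taking
  \<epsilon> = 1 / (C + 1) gives the lower bound.  The upper bound is Markov's inequality.

  For decorability, the h-transformed chain visits B exactly once almost surely, so the mass of the paths
  entering any finite set is at most the finite mass of those hitting B.  Letting the finite set grow, the
  expected sum of a weight along a quasi-process is at most this mass times the supremum of the potential
  of the weight under the h-transform.  The expected number of individuals at z attached to a spine
  individual is such a weight, and its potential is bounded by C since g(v, z) is at most a constant
  multiple of h(v).\<close>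

section \<open>Countable products of discrete laws\<close>

text \<open>Two obstacles shape the construction. The slot at index (ws, z) holds the offspring
  number of ws when ws is at z, together with the position of ws when its parent is at z. If child i
  of a root at x stays at x, its position and its offspring number share the slot
  \<open>([i], x)\<close>. Independence of the slots alone is then too coarse for a split at the
  root; one has to separate the two halves of each slot, which is the purpose of
  \<open>rejoin\<close>. Secondly, a quasi-process may come from time minus infinity and has no
  initial law. Expectations are therefore taken from the first entrance into a finite set on, and
  since \<open>rep\<close> is an arbitrary choice of representative, measurability on the quotient
  is obtained through shift-invariant functionals. The lower bound is a second-moment estimate
  carried out generation by generation: a linear gain of order \<epsilon> is set against a loss of
  order \<epsilon>^2 from pairs of hits below distinct siblings. Its inequalities are kept in
  additive form, as subtraction of extended nonnegative reals is truncated.\<close>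

definition pmf_prod :: "('i \<Rightarrow> 'b pmf) \<Rightarrow> ('i \<Rightarrow> 'b) measure" where
  "pmf_prod \<mu> = PiM UNIV (\<lambda>i. measure_pmf (\<mu> i))"

abbreviation discrete_prod :: "('i \<Rightarrow> 'b) measure" where
  "discrete_prod \<equiv> PiM UNIV (\<lambda>_. count_space UNIV)"

text \<open>The sigma-algebra does not depend on the laws, so measurability is proved on
  \<open>discrete_prod\<close> and transferred to whichever product measure is at hand.\<close>

lemma sets_pmf_prod [measurable_cong]: "sets (pmf_prod \<mu>) = sets discrete_prod"
  unfolding pmf_prod_def by (rule sets_PiM_cong) auto

lemma space_pmf_prod [simp]: "space (pmf_prod \<mu>) = UNIV"
  by (simp add: pmf_prod_def space_PiM)

lemma measurable_pmf_prod_iff: "f \<in> measurable (pmf_prod \<mu>) N \<longleftrightarrow> f \<in> measurable discrete_prod N"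
  by (simp cong: measurable_cong_sets add: sets_pmf_prod)

lemma space_discrete_prod [simp]: "space discrete_prod = UNIV"
  by (simp add: space_PiM)

lemma prob_space_pmf_prod: "prob_space (pmf_prod \<mu>)"
  unfolding pmf_prod_def by (rule prob_space_PiM) (rule measure_pmf.prob_space_axioms)

lemma measurable_into_discrete_prod:
  assumes "\<And>i. (\<lambda>x. f x i) \<in> measurable M (count_space UNIV)"
  shows "f \<in> measurable M discrete_prod"
  by (rule measurable_PiM_single') (use assms in \<open>auto\<close>)

lemma measurable_coordinate [measurable]: "(\<lambda>\<omega>. \<omega> i) \<in> measurable discrete_prod (count_space UNIV)"
  by (rule measurable_component_singleton) simp

lemma measurable_fun_coordinate:
  assumes "range g \<subseteq> space N"
  shows "(\<lambda>\<omega>. g (\<omega> i)) \<in> measurable discrete_prod N"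
  using measurable_coordinate by (rule measurable_compose) (use assms in auto)

text \<open>Splitting over the countably many values of \<open>f\<close> secures joint
  measurability: the product of two discrete sigma-algebras need not be discrete when both types are
  uncountable.\<close>

lemma measurable_binop_countable:
  fixes f :: "'m \<Rightarrow> 'b::countable"
  assumes "f \<in> measurable M (count_space UNIV)" "g \<in> measurable M (count_space UNIV)"
  shows "(\<lambda>x. h (f x) (g x)) \<in> measurable M (count_space UNIV)"
  by (rule measurable_compose_countable[of "\<lambda>i x. h i (g x)", OF _ assms(1)])
     (use assms(2) in \<open>rule measurable_compose\<close>, simp)

lemma indep_vars_coordinates:
  "prob_space.indep_vars (pmf_prod \<mu>) (\<lambda>i. measure_pmf (\<mu> i)) (\<lambda>i \<omega>. \<omega> i) UNIV"
proof -
  interpret prob_space "pmf_prod \<mu>" by (rule prob_space_pmf_prod)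
  have comp: "distr (pmf_prod \<mu>) (measure_pmf (\<mu> i)) (\<lambda>\<omega>. \<omega> i) = measure_pmf (\<mu> i)" for i
    unfolding pmf_prod_def
    by (rule distr_PiM_component) (auto intro: measure_pmf.prob_space_axioms)
  show ?thesis
  proof (subst indep_vars_iff_distr_eq_PiM')
    show "distr (pmf_prod \<mu>) (Pi\<^sub>M UNIV (\<lambda>i. measure_pmf (\<mu> i))) (\<lambda>x. \<lambda>i\<in>UNIV. x i) =
      Pi\<^sub>M UNIV (\<lambda>i. distr (pmf_prod \<mu>) (measure_pmf (\<mu> i)) (\<lambda>\<omega>. \<omega> i))"
      unfolding comp by (simp add: pmf_prod_def[symmetric] restrict_UNIV distr_id2)
  qed (auto)
qed

text \<open>By \<open>dep\<close>, each \<open>f l\<close> factors through the restriction to its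
  block \<open>J l\<close>, and restrictions to disjoint blocks are independent. Stating this for
  functions of the whole sample avoids a separate domain for every block.\<close>

lemma indep_vars_disjoint_blocks:
  fixes \<mu> :: "'i \<Rightarrow> 'b pmf"
  assumes disj: "disjoint_family_on J L"
    and meas: "\<And>l. l \<in> L \<Longrightarrow> f l \<in> measurable discrete_prod (N l)"
    and dep: "\<And>l \<omega> \<omega>'. l \<in> L \<Longrightarrow> (\<And>j. j \<in> J l \<Longrightarrow> \<omega> j = \<omega>' j) \<Longrightarrow> f l \<omega> = f l \<omega>'"
  shows "prob_space.indep_vars (pmf_prod \<mu>) N f L"
proof -
  interpret prob_space "pmf_prod \<mu>" by (rule prob_space_pmf_prod)
  have 1: "indep_vars (\<lambda>l. PiM (J l) (\<lambda>i. measure_pmf (\<mu> i))) (\<lambda>l \<omega>. restrict (\<lambda>i. \<omega> i) (J l)) L"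
    by (rule indep_vars_restrict[OF indep_vars_coordinates _ disj]) auto
  have m: "f l \<in> measurable (PiM (J l) (\<lambda>i. measure_pmf (\<mu> i))) (N l)" if "l \<in> L" for l
  proof -
    have "(\<lambda>\<omega>. \<omega>) \<in> measurable (PiM (J l) (\<lambda>i. measure_pmf (\<mu> i))) discrete_prod"
    proof (rule measurable_into_discrete_prod)
      fix i
      show "(\<lambda>\<omega>. \<omega> i) \<in> measurable (PiM (J l) (\<lambda>i. measure_pmf (\<mu> i))) (count_space UNIV)"
      proof (cases "i \<in> J l")
        case True
        then show ?thesis
          using measurable_component_singleton[OF True, of "\<lambda>i. measure_pmf (\<mu> i)"] by simp
      next
        case False
        \<comment> \<open>Points of the product over \<open>J l\<close> are extensional, so a
          coordinate outside the block is the constant \<open>undefined\<close>.\<close>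
        have "(\<lambda>\<omega>. \<omega> i) \<in> measurable (PiM (J l) (\<lambda>i. measure_pmf (\<mu> i))) (count_space UNIV)
          \<longleftrightarrow> (\<lambda>\<omega>. undefined :: 'b) \<in> measurable (PiM (J l) (\<lambda>i. measure_pmf (\<mu> i))) (count_space UNIV)"
          by (rule measurable_cong) (use False in \<open>auto simp: space_PiM PiE_def extensional_def\<close>)
        then show ?thesis by simp
      qed
    qed
    from measurable_compose[OF this meas[OF that]] show ?thesis by simp
  qed
  have "indep_vars N (\<lambda>l \<omega>. f l (restrict (\<lambda>i. \<omega> i) (J l))) L"
    by (rule indep_vars_compose2[OF 1 m])
  moreover have "indep_vars N (\<lambda>l \<omega>. f l (restrict (\<lambda>i. \<omega> i) (J l))) L \<longleftrightarrow> indep_vars N f L"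
    by (rule indep_vars_cong) (auto intro!: ext dep)
  ultimately show ?thesis by simp
qed

lemma nn_integral_prod_disjoint_blocks:
  fixes f :: "'l \<Rightarrow> ('i \<Rightarrow> 'b) \<Rightarrow> ennreal"
  assumes "finite L" and disj: "disjoint_family_on J L"
    and meas: "\<And>l. l \<in> L \<Longrightarrow> f l \<in> borel_measurable discrete_prod"
    and dep: "\<And>l \<omega> \<omega>'. l \<in> L \<Longrightarrow> (\<And>j. j \<in> J l \<Longrightarrow> \<omega> j = \<omega>' j) \<Longrightarrow> f l \<omega> = f l \<omega>'"
  shows "(\<integral>\<^sup>+\<omega>. (\<Prod>l\<in>L. f l \<omega>) \<partial>pmf_prod \<mu>) = (\<Prod>l\<in>L. \<integral>\<^sup>+\<omega>. f l \<omega> \<partial>pmf_prod \<mu>)"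
proof (rule prob_space.indep_vars_nn_integral[OF prob_space_pmf_prod \<open>finite L\<close>])
  show "prob_space.indep_vars (pmf_prod \<mu>) (\<lambda>_. borel) f L"
    by (rule indep_vars_disjoint_blocks[OF disj meas dep])
qed simp

lemma distr_pmf_prod_reindex:
  assumes "inj t" "\<And>i. \<mu> (t i) = \<nu> i"
  shows "distr (pmf_prod \<mu>) discrete_prod (\<lambda>\<omega> i. \<omega> (t i)) = pmf_prod \<nu>"
proof -
  have "distr (pmf_prod \<mu>) (pmf_prod \<nu>) (\<lambda>\<omega>. \<lambda>i\<in>UNIV. \<omega> (t i)) = pmf_prod \<nu>"
    using distr_PiM_reindex[of UNIV "\<lambda>i. measure_pmf (\<mu> i)" t UNIV] assms
    by (simp add: pmf_prod_def measure_pmf.prob_space_axioms)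
  moreover have "distr (pmf_prod \<mu>) discrete_prod (\<lambda>\<omega> i. \<omega> (t i)) =
      distr (pmf_prod \<mu>) (pmf_prod \<nu>) (\<lambda>\<omega>. \<lambda>i\<in>UNIV. \<omega> (t i))"
    by (intro distr_cong) (auto simp: sets_pmf_prod)
  ultimately show ?thesis by simp
qed

lemma nn_integral_pmf_prod_reindex:
  assumes "inj t" "\<And>i. \<mu> (t i) = \<nu> i" and f: "f \<in> borel_measurable discrete_prod"
  shows "(\<integral>\<^sup>+\<omega>. f (\<lambda>i. \<omega> (t i)) \<partial>pmf_prod \<mu>) = (\<integral>\<^sup>+\<omega>. f \<omega> \<partial>pmf_prod \<nu>)"
proof -
  have "(\<lambda>\<omega> i. \<omega> (t i)) \<in> measurable (pmf_prod \<mu>) discrete_prod"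
    by (rule measurable_into_discrete_prod) measurable
  then have "(\<integral>\<^sup>+\<omega>. f \<omega> \<partial>distr (pmf_prod \<mu>) discrete_prod (\<lambda>\<omega> i. \<omega> (t i)))
      = (\<integral>\<^sup>+\<omega>. f (\<lambda>i. \<omega> (t i)) \<partial>pmf_prod \<mu>)"
    using f by (subst nn_integral_distr) auto
  then show ?thesis
    using distr_pmf_prod_reindex[of t \<mu> \<nu>] assms(1,2) by simp
qed

lemma nn_integral_pmf_prod_component:
  "(\<integral>\<^sup>+\<omega>. f (\<omega> i) \<partial>pmf_prod \<mu>) = (\<integral>\<^sup>+x. f x \<partial>measure_pmf (\<mu> i))"
proof -
  have comp: "distr (pmf_prod \<mu>) (measure_pmf (\<mu> i)) (\<lambda>\<omega>. \<omega> i) = measure_pmf (\<mu> i)"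
    unfolding pmf_prod_def
    by (rule distr_PiM_component) (auto intro: measure_pmf.prob_space_axioms)
  have "(\<integral>\<^sup>+x. f x \<partial>distr (pmf_prod \<mu>) (measure_pmf (\<mu> i)) (\<lambda>\<omega>. \<omega> i)) = (\<integral>\<^sup>+\<omega>. f (\<omega> i) \<partial>pmf_prod \<mu>)"
    by (subst nn_integral_distr) auto
  then show ?thesis unfolding comp by simp
qed

text \<open>The offspring number and the position stored at one index of a branching Markov chain
  are independent; this splits them into two separate coordinates.\<close>

definition rejoin :: "('i \<times> bool \<Rightarrow> 'b \<times> 'c) \<Rightarrow> 'i \<Rightarrow> 'b \<times> 'c" where
  "rejoin \<omega> i = (fst (\<omega> (i, False)), snd (\<omega> (i, True)))"

lemma measurable_rejoin_component:
  "(\<lambda>\<omega>. rejoin \<omega> i) \<in> measurable discrete_prod (count_space (UNIV :: ('b::countable \<times> 'c) set))"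
  unfolding rejoin_def by (rule measurable_binop_countable[where h=Pair]; rule measurable_fun_coordinate) simp_all

lemma measurable_rejoin:
  "rejoin \<in> measurable discrete_prod (discrete_prod :: ('i \<Rightarrow> 'b::countable \<times> 'c) measure)"
  by (rule measurable_into_discrete_prod) (rule measurable_rejoin_component)

text \<open>The components of a pair law are independent, so reading them from two different
  coordinates does not change the law. Blocks of distinct \<open>i\<close> are disjoint, and
  countability reduces the law at one \<open>i\<close> to point masses.\<close>

lemma distr_rejoin:
  fixes \<mu> :: "'i \<Rightarrow> 'b::countable pmf" and \<nu> :: "'i \<Rightarrow> 'c::countable pmf"
  shows "distr (pmf_prod (\<lambda>(i, _). pair_pmf (\<mu> i) (\<nu> i))) discrete_prod rejoin
     = pmf_prod (\<lambda>i. pair_pmf (\<mu> i) (\<nu> i))"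
proof -
  let ?M = "pmf_prod (\<lambda>(i, _::bool). pair_pmf (\<mu> i) (\<nu> i))"
  interpret prob_space ?M by (rule prob_space_pmf_prod)
  note m = measurable_rejoin_component
  have m': "(\<lambda>\<omega>. rejoin \<omega> i) \<in> measurable ?M (count_space UNIV)" for i
    unfolding measurable_pmf_prod_iff by (rule m)
  have ind: "indep_vars (\<lambda>i. count_space UNIV) (\<lambda>i \<omega>. rejoin \<omega> i) UNIV"
  proof (rule indep_vars_disjoint_blocks[where J="\<lambda>i. {(i, False), (i, True)}"])
    show "disjoint_family_on (\<lambda>i::'i. {(i, False), (i, True)}) UNIV"
      by (auto simp: disjoint_family_on_def)
    show "rejoin \<omega> i = rejoin \<omega>' i" if "\<And>j. j \<in> {(i, False), (i, True)} \<Longrightarrow> \<omega> j = \<omega>' j"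
      for i and \<omega> \<omega>' :: "'i \<times> bool \<Rightarrow> 'b \<times> 'c"
      using that by (simp add: rejoin_def)
  qed (rule m)
  have one: "distr ?M (count_space UNIV) (\<lambda>\<omega>. rejoin \<omega> i) = measure_pmf (pair_pmf (\<mu> i) (\<nu> i))" for i
  proof (rule measure_eqI_countable[of _ UNIV])
    fix a :: "'b \<times> 'c"
    obtain b c where a: "a = (b, c)" by (cases a)
    \<comment> \<open>The event that \<open>rejoin \<omega> i\<close> equals (b, c), written as a
      product of one factor for each Boolean coordinate, so that the product rule for disjoint
      blocks applies.\<close>
    define f :: "bool \<Rightarrow> ('i \<times> bool \<Rightarrow> 'b \<times> 'c) \<Rightarrow> ennreal" where
      "f j \<omega> = (if j then indicator {c} (snd (\<omega> (i, True))) else indicator {b} (fst (\<omega> (i, False))))" for j \<omega>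
    have "emeasure (distr ?M (count_space UNIV) (\<lambda>\<omega>. rejoin \<omega> i)) {a}
        = emeasure ?M {\<omega>. rejoin \<omega> i = a}"
      by (subst emeasure_distr[OF m']) (auto simp: vimage_def)
    also have "\<dots> = (\<integral>\<^sup>+\<omega>. indicator {\<omega>. rejoin \<omega> i = a} \<omega> \<partial>?M)"
      using measurable_sets[OF m', of "{a}" i]
      by (subst nn_integral_indicator) (auto simp: vimage_def)
    also have "\<dots> = (\<integral>\<^sup>+\<omega>. (\<Prod>j\<in>UNIV. f j \<omega>) \<partial>?M)"
      by (intro nn_integral_cong) (auto simp: a UNIV_bool f_def rejoin_def indicator_def)
    also have "\<dots> = (\<Prod>j\<in>UNIV. \<integral>\<^sup>+\<omega>. f j \<omega> \<partial>?M)"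
    proof (rule nn_integral_prod_disjoint_blocks[where J="\<lambda>j. {(i, j)}"])
      show "f j \<in> borel_measurable discrete_prod" for j
        unfolding f_def
        using measurable_fun_coordinate[of "\<lambda>p. indicator {c} (snd p) :: ennreal" borel "(i, True)"]
          measurable_fun_coordinate[of "\<lambda>p. indicator {b} (fst p) :: ennreal" borel "(i, False)"]
        by (cases j) simp_all
      show "f j \<omega> = f j \<omega>'" if "\<And>k. k \<in> {(i, j)} \<Longrightarrow> \<omega> k = \<omega>' k" for j \<omega> \<omega>'
        using that by (cases j) (simp_all add: f_def)
    qed (simp_all add: disjoint_family_on_def)
    also have "\<dots> = (\<integral>\<^sup>+\<omega>. indicator {b} (fst (\<omega> (i, False))) \<partial>?M) * (\<integral>\<^sup>+\<omega>. indicator {c} (snd (\<omega> (i, True))) \<partial>?M)"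
      by (simp add: UNIV_bool f_def)
    also have "\<dots> = (\<integral>\<^sup>+x. indicator {b} (fst x) \<partial>measure_pmf (pair_pmf (\<mu> i) (\<nu> i))) * (\<integral>\<^sup>+x. indicator {c} (snd x) \<partial>measure_pmf (pair_pmf (\<mu> i) (\<nu> i)))"
      by (subst (1 2) nn_integral_pmf_prod_component) simp
    also have "\<dots> = emeasure (map_pmf fst (pair_pmf (\<mu> i) (\<nu> i))) {b} * emeasure (map_pmf snd (pair_pmf (\<mu> i) (\<nu> i))) {c}"
      by (subst (1 2) nn_integral_indicator[symmetric], simp, simp, unfold nn_integral_map_pmf, rule refl)
    also have "\<dots> = emeasure (measure_pmf (pair_pmf (\<mu> i) (\<nu> i))) {a}"
      unfolding map_fst_pair_pmf map_snd_pair_pmf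
      by (simp add: a emeasure_pmf_single pmf_pair ennreal_mult)
    finally show "emeasure (distr ?M (count_space UNIV) (\<lambda>\<omega>. rejoin \<omega> i)) {a} = emeasure (measure_pmf (pair_pmf (\<mu> i) (\<nu> i))) {a}" .
  qed auto
  have "distr ?M discrete_prod (\<lambda>\<omega>. \<lambda>i\<in>UNIV. rejoin \<omega> i) = PiM UNIV (\<lambda>i. distr ?M (count_space UNIV) (\<lambda>\<omega>. rejoin \<omega> i))"
    using ind by (subst (asm) indep_vars_iff_distr_eq_PiM') (use m' in auto)
  then show ?thesis
    unfolding one restrict_UNIV pmf_prod_def[of "\<lambda>i. pair_pmf (\<mu> i) (\<nu> i)", symmetric] .
qed

section \<open>The branching property\<close>

lemma bmc_rand_eq_pmf_prod: "bmc_rand d P = pmf_prod (\<lambda>(ws, z). pair_pmf (d z) (P z))"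
  by (simp add: bmc_rand_def pmf_prod_def case_prod_unfold)

lemma sets_bmc_rand [measurable_cong]: "sets (bmc_rand d P) = sets discrete_prod"
  by (simp add: bmc_rand_eq_pmf_prod sets_pmf_prod)

lemma space_bmc_rand [simp]: "space (bmc_rand d P) = UNIV"
  by (simp add: bmc_rand_eq_pmf_prod)

lemma measurable_bmc_rand_iff: "f \<in> measurable (bmc_rand d P) N \<longleftrightarrow> f \<in> measurable discrete_prod N"
  by (simp add: bmc_rand_eq_pmf_prod measurable_pmf_prod_iff)

lemma prob_space_bmc_rand: "prob_space (bmc_rand d P)"
  by (simp add: bmc_rand_eq_pmf_prod prob_space_pmf_prod)

section \<open>Decomposition of the tree at its root\<close>

definition subtree :: "nat \<Rightarrow> (nat list \<times> 'a \<Rightarrow> 'c) \<Rightarrow> nat list \<times> 'a \<Rightarrow> 'c" where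
  "subtree i \<omega> = (\<lambda>(ws, z). \<omega> (ws @ [i], z))"

text \<open>\<open>bloc\<close> recurses at the youngest generation, while the branching property
  concerns the oldest; in a reversed word the child of the root is the last letter.\<close>

lemma bloc_snoc:
  "bloc x \<omega> (ws @ [i]) = (if i < fst (\<omega> ([], x)) then bloc (snd (\<omega> ([i], x))) (subtree i \<omega>) ws else None)"
  by (induction ws) (auto simp: subtree_def split: option.split)

lemma measurable_bloc:
  "(\<lambda>\<omega>. bloc (x :: 'a::countable) \<omega> ws) \<in> measurable discrete_prod (count_space UNIV)"
proof (induction ws)
  case Nil
  then show ?case by simp
next
  case (Cons i ws)
  have "(\<lambda>\<omega>. (\<lambda>u \<omega>. case u of None \<Rightarrow> None
      | Some z \<Rightarrow> (if i < fst (\<omega> (ws, z)) then Some (snd (\<omega> (i # ws, z))) else None)) (bloc x \<omega> ws) \<omega>)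
      \<in> measurable discrete_prod (count_space UNIV)"
  proof (rule measurable_compose_countable[OF _ Cons])
    fix u :: "'a option"
    show "(\<lambda>\<omega>. case u of None \<Rightarrow> None
      | Some z \<Rightarrow> (if i < fst (\<omega> (ws, z)) then Some (snd (\<omega> (i # ws, z))) else None))
      \<in> measurable (discrete_prod :: (nat list \<times> 'a \<Rightarrow> nat \<times> 'a) measure) (count_space UNIV)"
    proof (cases u)
      case (Some z)
      have "(\<lambda>\<omega>. (\<lambda>a b. if i < fst a then Some (snd b) else None) (\<omega> (ws, z)) (\<omega> (i # ws, z)))
        \<in> measurable (discrete_prod :: (nat list \<times> 'a \<Rightarrow> nat \<times> 'a) measure) (count_space UNIV)"
        by (rule measurable_binop_countable; rule measurable_coordinate)
      then show ?thesis by (simp add: Some)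
    qed simp
  qed
  then show ?case by simp
qed

text \<open>The root position is prescribed, so the position stored at the index of the root is
  never read. Hence functionals of \<open>bloc\<close> meet the condition that
  \<open>branching_property\<close> imposes on \<open>F\<close>.\<close>

lemma bloc_cong_positions:
  assumes "\<And>p. fst (\<omega> p) = fst (\<omega>' p)" "\<And>ws z. ws \<noteq> [] \<Longrightarrow> snd (\<omega> (ws, z)) = snd (\<omega>' (ws, z))"
  shows "bloc x \<omega> ws = bloc x \<omega>' ws"
  by (induction ws) (auto simp: assms split: option.split)

lemma nn_integral_bmc_rand_rejoin:
  fixes d :: "'a::countable \<Rightarrow> nat pmf" and P :: "'a \<Rightarrow> 'a pmf"
  assumes "f \<in> borel_measurable discrete_prod"
  shows "(\<integral>\<^sup>+\<omega>. f \<omega> \<partial>bmc_rand d P)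
     = (\<integral>\<^sup>+\<omega>. f (rejoin \<omega>) \<partial>pmf_prod (\<lambda>(p, _). pair_pmf (d (snd p)) (P (snd p))))"
proof -
  have "bmc_rand d P = distr (pmf_prod (\<lambda>(p, _). pair_pmf (d (snd p)) (P (snd p)))) discrete_prod rejoin"
    by (subst distr_rejoin) (simp add: bmc_rand_eq_pmf_prod case_prod_unfold)
  then show ?thesis
    using assms by (simp add: nn_integral_distr measurable_pmf_prod_iff measurable_rejoin)
qed

text \<open>Inserts a sum over all possible values \<open>y\<close> of \<open>a\<close>; this is how
  a random quantity is fixed to a deterministic value before independence is applied.\<close>

lemma nn_integral_count_space_delta:
  "(\<integral>\<^sup>+y. f y * indicator {y} a \<partial>count_space UNIV) = (f a :: ennreal)"
proof -
  have "(\<integral>\<^sup>+y. f y * indicator {y} a \<partial>count_space UNIV) = (\<integral>\<^sup>+y. f y * indicator {a} y \<partial>count_space UNIV)"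
    by (intro nn_integral_cong) (auto simp: indicator_def)
  then show ?thesis by (simp add: nn_integral_indicator_singleton')
qed

lemma nn_integral_pmf_indicator_snd:
  "(\<integral>\<^sup>+p. indicator {y} (snd p) \<partial>measure_pmf (pair_pmf \<mu> \<nu>)) = ennreal (pmf \<nu> y)"
proof -
  have "(\<integral>\<^sup>+p. indicator {y} (snd p) \<partial>measure_pmf (pair_pmf \<mu> \<nu>))
      = (\<integral>\<^sup>+p. indicator {y} p \<partial>measure_pmf (map_pmf snd (pair_pmf \<mu> \<nu>)))"
    unfolding nn_integral_map_pmf ..
  then show ?thesis by (simp add: map_snd_pair_pmf emeasure_pmf_single)
qed

lemma nn_integral_pmf_fst:
  "(\<integral>\<^sup>+p. g (fst p) \<partial>measure_pmf (pair_pmf \<mu> \<nu>)) = (\<integral>\<^sup>+n. g n \<partial>measure_pmf \<mu>)"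
proof -
  have "(\<integral>\<^sup>+p. g (fst p) \<partial>measure_pmf (pair_pmf \<mu> \<nu>))
      = (\<integral>\<^sup>+p. g p \<partial>measure_pmf (map_pmf fst (pair_pmf \<mu> \<nu>)))"
    unfolding nn_integral_map_pmf ..
  then show ?thesis by (simp add: map_fst_pair_pmf)
qed

lemma measurable_random_root:
  fixes F :: "'a::countable \<Rightarrow> ('i \<Rightarrow> 'b) \<Rightarrow> ennreal"
  assumes "\<And>y. F y \<in> borel_measurable discrete_prod"
    and "T \<in> measurable M discrete_prod" and "Y \<in> measurable M (count_space UNIV)"
  shows "(\<lambda>\<omega>. F (Y \<omega>) (T \<omega>)) \<in> borel_measurable M"
  by (rule measurable_compose_countable[OF _ assms(3)]) (rule measurable_compose[OF assms(2,1)])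

lemma measurable_subtree: "subtree i \<in> measurable discrete_prod discrete_prod"
  unfolding subtree_def by (rule measurable_into_discrete_prod) (simp add: case_prod_unfold)

lemma nn_integral_bmc_rand_subtree:
  assumes "f \<in> borel_measurable discrete_prod"
  shows "(\<integral>\<^sup>+\<omega>. f (subtree i \<omega>) \<partial>bmc_rand d P) = (\<integral>\<^sup>+\<omega>. f \<omega> \<partial>bmc_rand d P)"
proof -
  have "(\<integral>\<^sup>+\<omega>. f (\<lambda>p. \<omega> ((\<lambda>(ws, z). (ws @ [i], z)) p)) \<partial>bmc_rand d P) = (\<integral>\<^sup>+\<omega>. f \<omega> \<partial>bmc_rand d P)"
    unfolding bmc_rand_eq_pmf_prod
    by (rule nn_integral_pmf_prod_reindex[OF _ _ assms]) (auto simp: inj_on_def)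
  moreover have "(\<lambda>p. \<omega> ((\<lambda>(ws, z). (ws @ [i], z)) p)) = subtree i \<omega>" for \<omega> :: "nat list \<times> 'a \<Rightarrow> nat \<times> 'a"
    by (auto simp: subtree_def)
  ultimately show ?thesis by simp
qed

text \<open>The functional F may not look at the positions stored at the root index, since in the subtree
  of child i that slot holds the position of child i itself.\<close>

lemma branching_property:
  fixes d :: "'a::countable \<Rightarrow> nat pmf" and P :: "'a \<Rightarrow> 'a pmf"
    and F :: "'a \<Rightarrow> (nat list \<times> 'a \<Rightarrow> nat \<times> 'a) \<Rightarrow> ennreal" and g :: "nat \<Rightarrow> ennreal"
  assumes meas: "\<And>y. F y \<in> borel_measurable discrete_prod"
    and dep: "\<And>y \<omega> \<omega>'. (\<And>p. fst (\<omega> p) = fst (\<omega>' p)) \<Longrightarrow>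
        (\<And>ws z. ws \<noteq> [] \<Longrightarrow> snd (\<omega> (ws, z)) = snd (\<omega>' (ws, z))) \<Longrightarrow> F y \<omega> = F y \<omega>'"
    and "finite I"
  shows "(\<integral>\<^sup>+\<omega>. g (fst (\<omega> ([], x))) * (\<Prod>i\<in>I. F (snd (\<omega> ([i], x))) (subtree i \<omega>)) \<partial>bmc_rand d P)
    = (\<integral>\<^sup>+n. g n \<partial>measure_pmf (d x))
      * (\<Prod>i\<in>I. \<integral>\<^sup>+y. (\<integral>\<^sup>+\<omega>. F y \<omega> \<partial>bmc_rand d P) \<partial>measure_pmf (P x))"
proof -
  define M where "M = pmf_prod (\<lambda>(p :: nat list \<times> 'a, _ :: bool). pair_pmf (d (snd p)) (P (snd p)))"
  have meas_sub: "(\<lambda>\<omega>. F y (subtree i (rejoin \<omega>))) \<in> borel_measurable discrete_prod" for y i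
    using measurable_compose[OF measurable_rejoin measurable_compose[OF measurable_subtree meas]]
    by simp
  \<comment> \<open>\<open>None\<close> stands for the offspring number of the root,
    \<open>Some i\<close> for the subtree below child i including the position of that
    child.\<close>
  define f where "f = (\<lambda>u (\<omega> :: (nat list \<times> 'a) \<times> bool \<Rightarrow> nat \<times> 'a). case u of None \<Rightarrow> g (fst (\<omega> (([], x), False)))
     | Some i \<Rightarrow> F (snd (\<omega> (([i], x), True))) (subtree i (rejoin \<omega>)))"
  \<comment> \<open>The split coordinates that the subtree of child i can read: words ending in i,
    except that at the word [i] only the offspring half (\<open>False\<close>) is kept. The half
    left out for a parent at x holds the position of child i and is added separately in
    \<open>J\<close>.\<close>
  define R where "R = (\<lambda>i :: nat. {((ws @ [i], z :: 'a), b) | ws z b. b \<longrightarrow> ws \<noteq> []})"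
  define J where "J = (\<lambda>u. case u of None \<Rightarrow> {(([], x), False)}
     | Some i \<Rightarrow> insert (([i], x), True) (R i))"
  have dep_sub: "F y (subtree i (rejoin \<omega>)) = F y (subtree i (rejoin \<omega>'))"
    if "\<And>j. j \<in> R i \<Longrightarrow> \<omega> j = \<omega>' j" for y i \<omega> \<omega>'
    by (rule dep) (use that in \<open>auto simp: subtree_def rejoin_def R_def\<close>)
  have meas_snd: "(\<lambda>\<omega>. snd (\<omega> j)) \<in> measurable discrete_prod (count_space UNIV)" for j :: "(nat list \<times> 'a) \<times> bool"
    by (rule measurable_fun_coordinate) simp
  have f_meas: "f u \<in> borel_measurable discrete_prod" for u
  proof (cases u)
    case None
    then show ?thesis unfolding f_def
      using measurable_fun_coordinate[of "\<lambda>p. g (fst p)" borel "(([], x), False)"] by simp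
  next
    case (Some i)
    have "(\<lambda>\<omega>. subtree i (rejoin \<omega>))
        \<in> measurable discrete_prod (discrete_prod :: (nat list \<times> 'a \<Rightarrow> nat \<times> 'a) measure)"
      by (rule measurable_compose[OF measurable_rejoin measurable_subtree])
    from measurable_random_root[OF meas this meas_snd] show ?thesis
      by (simp add: f_def Some)
  qed
  have f_dep: "f u \<omega> = f u \<omega>'" if *: "\<And>j. j \<in> J u \<Longrightarrow> \<omega> j = \<omega>' j" for u \<omega> \<omega>'
  proof (cases u)
    case None
    then show ?thesis using that by (simp add: f_def J_def)
  next
    case (Some i)
    have "F y (subtree i (rejoin \<omega>)) = F y (subtree i (rejoin \<omega>'))" for y
      by (rule dep_sub) (use * in \<open>simp add: J_def Some\<close>)
    moreover have "\<omega> (([i], x), True) = \<omega>' (([i], x), True)"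
      using * by (simp add: J_def Some)
    ultimately show ?thesis by (simp add: f_def Some)
  qed
  have root: "(\<integral>\<^sup>+\<omega>. f None \<omega> \<partial>M) = (\<integral>\<^sup>+n. g n \<partial>measure_pmf (d x))"
    unfolding f_def M_def
    using nn_integral_pmf_prod_component[where f="\<lambda>p. g (fst p)" and i="(([], x), False)"
        and \<mu>="\<lambda>(p :: nat list \<times> 'a, _ :: bool). pair_pmf (d (snd p)) (P (snd p))"]
    by (simp add: nn_integral_pmf_fst)
  have child: "(\<integral>\<^sup>+\<omega>. f (Some i) \<omega> \<partial>M) = (\<integral>\<^sup>+y. (\<integral>\<^sup>+\<omega>. F y \<omega> \<partial>bmc_rand d P) \<partial>measure_pmf (P x))" for i
  proof -
    \<comment> \<open>Fixing the random root of the subtree to each y in turn makes its position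
      (\<open>True\<close>) and the subtree started at y (\<open>False\<close>) functions of
      disjoint blocks.\<close>
    define k where "k = (\<lambda>y u (\<omega> :: (nat list \<times> 'a) \<times> bool \<Rightarrow> nat \<times> 'a).
      if u then indicator {y} (snd (\<omega> (([i], x), True))) else F y (subtree i (rejoin \<omega>)))"
    have k_meas: "k y u \<in> borel_measurable discrete_prod" for y u
      using meas_sub[of y i] measurable_fun_coordinate[of "\<lambda>p. indicator {y} (snd p) :: ennreal" borel "(([i], x), True)"]
      by (cases u) (simp_all add: k_def)
    have split: "(\<integral>\<^sup>+\<omega>. (\<Prod>u\<in>UNIV. k y u \<omega>) \<partial>M) = (\<Prod>u\<in>UNIV. \<integral>\<^sup>+\<omega>. k y u \<omega> \<partial>M)" for y
      unfolding M_def
    proof (rule nn_integral_prod_disjoint_blocks[where J="\<lambda>u. if u then {(([i], x), True)} else R i"])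
      show "disjoint_family_on (\<lambda>u. if u then {(([i], x), True)} else R i) UNIV"
        by (auto simp: disjoint_family_on_def R_def)
      show "k y u \<omega> = k y u \<omega>'" if *: "\<And>j. j \<in> (if u then {(([i], x), True)} else R i) \<Longrightarrow> \<omega> j = \<omega>' j" for u \<omega> \<omega>'
      proof (cases u)
        case True
        then show ?thesis using * by (simp add: k_def)
      next
        case False
        then show ?thesis using dep_sub[of i \<omega> \<omega>' y] * by (simp add: k_def)
      qed
    qed (simp_all add: k_meas)
    have pos: "(\<integral>\<^sup>+\<omega>. k y True \<omega> \<partial>M) = ennreal (pmf (P x) y)" for y
      unfolding k_def M_def
      using nn_integral_pmf_prod_component[where f="\<lambda>p. indicator {y} (snd p)" and i="(([i], x), True)"
          and \<mu>="\<lambda>(p :: nat list \<times> 'a, _ :: bool). pair_pmf (d (snd p)) (P (snd p))"]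
      by (simp add: nn_integral_pmf_indicator_snd)
    have sub: "(\<integral>\<^sup>+\<omega>. k y False \<omega> \<partial>M) = (\<integral>\<^sup>+\<omega>. F y \<omega> \<partial>bmc_rand d P)" for y
      unfolding k_def M_def
      using nn_integral_bmc_rand_rejoin[where d=d and P=P, OF measurable_compose[OF measurable_subtree[of i] meas[of y]]]
        nn_integral_bmc_rand_subtree[where d=d and P=P and i=i, OF meas[of y]]
      by simp
    have "(\<integral>\<^sup>+\<omega>. f (Some i) \<omega> \<partial>M) = (\<integral>\<^sup>+\<omega>. (\<integral>\<^sup>+y. (\<Prod>u\<in>UNIV. k y u \<omega>) \<partial>count_space UNIV) \<partial>M)"
      by (intro nn_integral_cong) (simp add: f_def UNIV_bool k_def nn_integral_count_space_delta)
    also have "\<dots> = (\<integral>\<^sup>+y. (\<integral>\<^sup>+\<omega>. (\<Prod>u\<in>UNIV. k y u \<omega>) \<partial>M) \<partial>count_space UNIV)"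
      by (rule nn_integral_count_space_nn_integral)
         (auto simp: M_def measurable_pmf_prod_iff intro!: borel_measurable_prod_ennreal k_meas)
    also have "\<dots> = (\<integral>\<^sup>+y. ennreal (pmf (P x) y) * (\<integral>\<^sup>+\<omega>. F y \<omega> \<partial>bmc_rand d P) \<partial>count_space UNIV)"
      unfolding split by (simp add: UNIV_bool pos sub mult.commute)
    also have "\<dots> = (\<integral>\<^sup>+y. (\<integral>\<^sup>+\<omega>. F y \<omega> \<partial>bmc_rand d P) \<partial>measure_pmf (P x))"
      by (simp add: nn_integral_measure_pmf)
    finally show ?thesis .
  qed
  have whole_meas: "(\<lambda>\<omega>. g (fst (\<omega> ([], x))) * (\<Prod>i\<in>I. F (snd (\<omega> ([i], x))) (subtree i \<omega>)))
      \<in> borel_measurable discrete_prod"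
  proof (intro borel_measurable_times_ennreal borel_measurable_prod_ennreal)
    show "(\<lambda>\<omega>. g (fst (\<omega> ([], x)))) \<in> borel_measurable discrete_prod"
      by (rule measurable_fun_coordinate[of "\<lambda>p. g (fst p)"]) simp
    show "(\<lambda>\<omega>. F (snd (\<omega> ([i], x))) (subtree i \<omega>)) \<in> borel_measurable discrete_prod" for i
      by (rule measurable_random_root[OF meas measurable_subtree]) (rule measurable_fun_coordinate, simp)
  qed
  have "(\<integral>\<^sup>+\<omega>. g (fst (\<omega> ([], x))) * (\<Prod>i\<in>I. F (snd (\<omega> ([i], x))) (subtree i \<omega>)) \<partial>bmc_rand d P)
      = (\<integral>\<^sup>+\<omega>. (\<Prod>u\<in>insert None (Some ` I). f u \<omega>) \<partial>M)"
    unfolding nn_integral_bmc_rand_rejoin[OF whole_meas] M_def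
    using \<open>finite I\<close>
    by (intro nn_integral_cong) (simp add: f_def rejoin_def prod.reindex)
  also have "\<dots> = (\<Prod>u\<in>insert None (Some ` I). \<integral>\<^sup>+\<omega>. f u \<omega> \<partial>M)"
    unfolding M_def
  proof (rule nn_integral_prod_disjoint_blocks[where J=J])
    show "disjoint_family_on J (insert None (Some ` I))"
      unfolding disjoint_family_on_def J_def R_def by (auto split: option.splits)
    show "f u \<omega> = f u \<omega>'" if "\<And>j. j \<in> J u \<Longrightarrow> \<omega> j = \<omega>' j" for u \<omega> \<omega>'
      using that by (rule f_dep)
  qed (use \<open>finite I\<close> in \<open>simp_all add: f_meas\<close>)
  also have "\<dots> = (\<integral>\<^sup>+n. g n \<partial>measure_pmf (d x))
      * (\<Prod>i\<in>I. \<integral>\<^sup>+y. (\<integral>\<^sup>+\<omega>. F y \<omega> \<partial>bmc_rand d P) \<partial>measure_pmf (P x))"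
    using \<open>finite I\<close> by (simp add: prod.reindex root child)
  finally show ?thesis .
qed

section \<open>First moments and survival probabilities\<close>

lemma borel_measurable_nn_integral_count_space:
  fixes f :: "'i::countable \<Rightarrow> 'm \<Rightarrow> ennreal"
  assumes [measurable]: "\<And>i. f i \<in> borel_measurable M"
  shows "(\<lambda>\<omega>. \<integral>\<^sup>+i. f i \<omega> \<partial>count_space UNIV) \<in> borel_measurable M"
proof -
  have "(\<integral>\<^sup>+i. f i \<omega> \<partial>count_space UNIV)
      = (\<Sum>n. f (from_nat n) \<omega> * indicator (range (to_nat :: 'i \<Rightarrow> nat)) n)" for \<omega>
  proof -
    have "bij_betw (to_nat :: 'i \<Rightarrow> nat) UNIV (range (to_nat :: 'i \<Rightarrow> nat))"
      by (simp add: bij_betw_def)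
    then have "(\<integral>\<^sup>+(i :: 'i). f (from_nat (to_nat i)) \<omega> \<partial>count_space UNIV)
        = (\<integral>\<^sup>+n. f (from_nat n) \<omega> \<partial>count_space (range (to_nat :: 'i \<Rightarrow> nat)))"
      by (rule nn_integral_bij_count_space[where f="\<lambda>n. f (from_nat n) \<omega>"])
    also have "\<dots> = (\<integral>\<^sup>+n. f (from_nat n) \<omega> * indicator (range (to_nat :: 'i \<Rightarrow> nat)) n \<partial>count_space UNIV)"
      by (subst nn_integral_count_space_indicator) simp_all
    finally show ?thesis by (simp add: nn_integral_count_space_nat)
  qed
  then show ?thesis by simp
qed

text \<open>Nonempty words are sorted by their last letter, that is by the child of the root from
  which the individual descends.\<close>

lemma nn_integral_lists_snoc:
  fixes f :: "'b::countable list \<Rightarrow> ennreal"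
  assumes "f [] = 0"
  shows "(\<integral>\<^sup>+ws. f ws \<partial>count_space UNIV) = (\<integral>\<^sup>+i. (\<integral>\<^sup>+ws. f (ws @ [i]) \<partial>count_space UNIV) \<partial>count_space UNIV)"
proof -
  have last: "(\<integral>\<^sup>+ws. f (ws @ [i]) \<partial>count_space UNIV) = (\<integral>\<^sup>+ws. f ws * indicator {i} (last ws) \<partial>count_space UNIV)" for i
  proof -
    have "bij_betw (\<lambda>ws. ws @ [i]) UNIV {ws. ws \<noteq> [] \<and> last ws = i}"
      by (intro bij_betw_byWitness[where f'=butlast]) auto
    then have "(\<integral>\<^sup>+ws. f (ws @ [i]) \<partial>count_space UNIV) = (\<integral>\<^sup>+ws. f ws \<partial>count_space {ws. ws \<noteq> [] \<and> last ws = i})"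
      by (rule nn_integral_bij_count_space)
    also have "\<dots> = (\<integral>\<^sup>+ws. f ws * indicator {ws. ws \<noteq> [] \<and> last ws = i} ws \<partial>count_space UNIV)"
      by (subst nn_integral_count_space_indicator) simp_all
    also have "\<dots> = (\<integral>\<^sup>+ws. f ws * indicator {i} (last ws) \<partial>count_space UNIV)"
      by (intro nn_integral_cong) (use assms in \<open>auto simp: indicator_def\<close>)
    finally show ?thesis .
  qed
  have "(\<integral>\<^sup>+i. (\<integral>\<^sup>+ws. f (ws @ [i]) \<partial>count_space UNIV) \<partial>count_space UNIV)
      = (\<integral>\<^sup>+i. (\<integral>\<^sup>+ws. f ws * indicator {i} (last ws) \<partial>count_space UNIV) \<partial>count_space UNIV)"
    by (simp add: last)
  also have "\<dots> = (\<integral>\<^sup>+ws. (\<integral>\<^sup>+i. f ws * indicator {i} (last ws) \<partial>count_space UNIV) \<partial>count_space UNIV)"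
    by (rule nn_integral_count_space_nn_integral[symmetric]) auto
  also have "\<dots> = (\<integral>\<^sup>+ws. f ws \<partial>count_space UNIV)"
    by (intro nn_integral_cong) (rule nn_integral_count_space_delta)
  finally show ?thesis by simp
qed

lemma nn_integral_lists_by_length:
  fixes f :: "'b list \<Rightarrow> ennreal"
  shows "(\<integral>\<^sup>+ws. f ws \<partial>count_space UNIV) = (\<Sum>n. \<integral>\<^sup>+ws. f ws * indicator {n} (length ws) \<partial>count_space UNIV)"
proof -
  have "(\<Sum>n. \<integral>\<^sup>+ws. f ws * indicator {n} (length ws) \<partial>count_space UNIV)
      = (\<integral>\<^sup>+ws. (\<Sum>n. f ws * indicator {n} (length ws)) \<partial>count_space UNIV)"
    by (rule nn_integral_suminf[symmetric]) simp
  also have "\<dots> = (\<integral>\<^sup>+ws. f ws \<partial>count_space UNIV)"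
    by (intro nn_integral_cong, subst nn_integral_count_space_nat[symmetric])
       (rule nn_integral_count_space_delta)
  finally show ?thesis by simp
qed

text \<open>One count for two purposes: \<open>A = {}\<close>, \<open>Z = {z}\<close> gives the
  generation-n part of the Green function, and \<open>A = Z = B\<close> gives the first hits of B in
  generation n.\<close>

definition taboo_count :: "'a set \<Rightarrow> 'a set \<Rightarrow> nat \<Rightarrow> 'a \<Rightarrow> (nat list \<times> 'a \<Rightarrow> nat \<times> 'a) \<Rightarrow> ennreal" where
  "taboo_count A Z n x \<omega> = (\<integral>\<^sup>+ws. indicator {ws. bloc x \<omega> ws \<in> Some ` Z \<and>
      (\<forall>k\<in>{1..length ws}. bloc x \<omega> (drop k ws) \<notin> Some ` A)} ws * indicator {n} (length ws)
      \<partial>count_space UNIV)"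

primrec taboo_mean :: "('a \<Rightarrow> nat pmf) \<Rightarrow> ('a \<Rightarrow> 'a pmf) \<Rightarrow> 'a set \<Rightarrow> 'a set \<Rightarrow> nat \<Rightarrow> 'a \<Rightarrow> ennreal" where
  "taboo_mean d P A Z 0 x = indicator Z x"
| "taboo_mean d P A Z (Suc n) x =
    (if x \<in> A then 0 else \<integral>\<^sup>+y. qmat d P x y * taboo_mean d P A Z n y \<partial>count_space UNIV)"

lemma taboo_count_0: "taboo_count A Z 0 x \<omega> = indicator Z x"
proof -
  have "taboo_count A Z 0 x \<omega> = (\<integral>\<^sup>+(ws :: nat list). indicator Z x * indicator {[]} ws \<partial>count_space UNIV)"
    unfolding taboo_count_def by (intro nn_integral_cong) (auto simp: indicator_def)
  then show ?thesis by (simp add: nn_integral_cmult)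
qed

lemma taboo_count_Suc:
  "taboo_count A Z (Suc n) x \<omega> = (if x \<in> A then 0 else
     \<integral>\<^sup>+i. indicator {i<..} (fst (\<omega> ([], x))) * taboo_count A Z n (snd (\<omega> ([i], x))) (subtree i \<omega>) \<partial>count_space UNIV)"
proof -
  \<comment> \<open>The largest k yields the root; the others yield the strict ancestors of
    \<open>ws\<close> inside the subtree of child i.\<close>
  have range: "(\<forall>k\<in>{1..length (ws @ [i])}. Q (drop k (ws @ [i])))
      \<longleftrightarrow> Q [] \<and> (\<forall>k\<in>{1..length ws}. Q (drop k ws @ [i]))" for ws :: "nat list" and i and Q
  proof -
    have "{1..length (ws @ [i])} = insert (Suc (length ws)) {1..length ws}" by auto
    then show ?thesis by auto
  qed
  have "taboo_count A Z (Suc n) x \<omega> = (\<integral>\<^sup>+i. (\<integral>\<^sup>+ws. indicator {ws. bloc x \<omega> ws \<in> Some ` Z \<and>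
      (\<forall>k\<in>{1..length ws}. bloc x \<omega> (drop k ws) \<notin> Some ` A)} (ws @ [i]) * indicator {Suc n} (length (ws @ [i]))
      \<partial>count_space UNIV) \<partial>count_space UNIV)"
    unfolding taboo_count_def by (rule nn_integral_lists_snoc) simp
  also have "\<dots> = (\<integral>\<^sup>+i. (\<integral>\<^sup>+ws. indicator (- A) x * (indicator {i<..} (fst (\<omega> ([], x))) *
      (indicator {ws. bloc (snd (\<omega> ([i], x))) (subtree i \<omega>) ws \<in> Some ` Z \<and>
      (\<forall>k\<in>{1..length ws}. bloc (snd (\<omega> ([i], x))) (subtree i \<omega>) (drop k ws) \<notin> Some ` A)} ws * indicator {n} (length ws)))
      \<partial>count_space UNIV) \<partial>count_space UNIV)"
    apply (intro nn_integral_cong)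
    subgoal for i ws
      using range[of ws i "\<lambda>v. bloc x \<omega> v \<notin> Some ` A"]
      by (cases "i < fst (\<omega> ([], x))") (auto simp: bloc_snoc indicator_def)
    done
  also have "\<dots> = (if x \<in> A then 0 else
     \<integral>\<^sup>+i. indicator {i<..} (fst (\<omega> ([], x))) * taboo_count A Z n (snd (\<omega> ([i], x))) (subtree i \<omega>) \<partial>count_space UNIV)"
    unfolding taboo_count_def by (simp add: nn_integral_cmult)
  finally show ?thesis .
qed

lemma measurable_bloc_mem: "Measurable.pred discrete_prod (\<lambda>\<omega>. bloc (x :: 'a::countable) \<omega> ws \<in> T)"
  using measurable_compose[OF measurable_bloc[of x ws], of "\<lambda>u. u \<in> T" "count_space UNIV"] by simp

lemma measurable_taboo_count:
  "taboo_count A Z n (x :: 'a::countable) \<in> borel_measurable discrete_prod"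
  unfolding taboo_count_def
proof (rule borel_measurable_nn_integral_count_space)
  fix ws :: "nat list"
  note measurable_bloc_mem [measurable]
  have [measurable]: "Measurable.pred discrete_prod (\<lambda>\<omega>. bloc x \<omega> ws \<in> Some ` Z \<and>
      (\<forall>k\<in>{1..length ws}. bloc x \<omega> (drop k ws) \<notin> Some ` A))"
    by measurable
  have "(\<lambda>\<omega>. (if bloc x \<omega> ws \<in> Some ` Z \<and>
      (\<forall>k\<in>{1..length ws}. bloc x \<omega> (drop k ws) \<notin> Some ` A) then 1 else 0) * indicator {n} (length ws) :: ennreal)
     \<in> borel_measurable discrete_prod"
    by measurable
  then show "(\<lambda>\<omega>. indicator {ws. bloc x \<omega> ws \<in> Some ` Z \<and>
      (\<forall>k\<in>{1..length ws}. bloc x \<omega> (drop k ws) \<notin> Some ` A)} ws * indicator {n} (length ws) :: ennreal)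
     \<in> borel_measurable discrete_prod"
    by (simp add: indicator_def if_distrib cong: if_cong)
qed

lemma taboo_count_cong_positions:
  assumes "\<And>p. fst (\<omega> p) = fst (\<omega>' p)" "\<And>ws z. ws \<noteq> [] \<Longrightarrow> snd (\<omega> (ws, z)) = snd (\<omega>' (ws, z))"
  shows "taboo_count A Z n x \<omega> = taboo_count A Z n x \<omega>'"
proof -
  have "bloc x \<omega> = bloc x \<omega>'" by (rule ext, rule bloc_cong_positions[of \<omega> \<omega>'], rule assms(1), rule assms(2))
  then show ?thesis by (simp add: taboo_count_def)
qed

lemma nn_integral_qmat:
  "(\<integral>\<^sup>+y. qmat d P x y * f y \<partial>count_space UNIV) = mean d x * (\<integral>\<^sup>+y. f y \<partial>measure_pmf (P x))"
  by (simp add: qmat_def mult.assoc nn_integral_cmult nn_integral_measure_pmf)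

text \<open>Tail-sum formula for the mean; in its use, i runs over the possible children and i < n
  says that child i exists.\<close>

lemma nn_integral_greater_sum: "(\<integral>\<^sup>+i. (\<integral>\<^sup>+n. indicator {i<..} n \<partial>measure_pmf \<mu>) \<partial>count_space UNIV)
    = (\<integral>\<^sup>+n. ennreal (real n) \<partial>measure_pmf \<mu>)"
proof -
  have "(\<integral>\<^sup>+i. (\<integral>\<^sup>+n. indicator {i<..} n \<partial>measure_pmf \<mu>) \<partial>count_space UNIV)
      = (\<integral>\<^sup>+n. (\<integral>\<^sup>+i. indicator {i<..} n \<partial>count_space UNIV) \<partial>measure_pmf \<mu>)"
    by (rule nn_integral_count_space_nn_integral[symmetric]) auto
  also have "\<dots> = (\<integral>\<^sup>+n. ennreal (real n) \<partial>measure_pmf \<mu>)"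
  proof (rule nn_integral_cong)
    fix n :: nat
    have "(\<integral>\<^sup>+i. indicator {i<..} n \<partial>count_space UNIV) = (\<integral>\<^sup>+i. indicator {..<n} i \<partial>count_space UNIV)"
      by (intro nn_integral_cong) (auto simp: indicator_def)
    also have "\<dots> = ennreal (real n)"
      by (simp add: ennreal_of_nat_eq_real_of_nat)
    finally show "(\<integral>\<^sup>+i. indicator {i<..} n \<partial>count_space UNIV) = ennreal (real n)" .
  qed
  finally show ?thesis .
qed

text \<open>Many-to-one formula. Children are followed one at a time, so
  \<open>branching_property\<close> is applied to singletons; the probabilities that child i exists
  add up to \<open>mean d x\<close>.\<close>

lemma expectation_taboo_count:
  fixes d :: "'a::countable \<Rightarrow> nat pmf"
  shows "(\<integral>\<^sup>+\<omega>. taboo_count A Z n x \<omega> \<partial>bmc_rand d P) = taboo_mean d P A Z n x"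
proof (induction n arbitrary: x)
  case 0
  interpret prob_space "bmc_rand d P" by (rule prob_space_bmc_rand)
  show ?case by (simp add: taboo_count_0 emeasure_space_1 del: space_bmc_rand)
next
  case (Suc n)
  show ?case
  proof (cases "x \<in> A")
    case True
    then show ?thesis by (simp add: taboo_count_Suc)
  next
    case False
    have meas: "(\<lambda>\<omega>. indicator {i<..} (fst (\<omega> ([], x))) * taboo_count A Z n (snd (\<omega> ([i], x))) (subtree i \<omega>))
      \<in> borel_measurable (bmc_rand d P)" for i
      unfolding measurable_bmc_rand_iff
    proof (rule borel_measurable_times_ennreal)
      show "(\<lambda>\<omega>. indicator {i<..} (fst (\<omega> ([], x))) :: ennreal) \<in> borel_measurable discrete_prod"
        by (rule measurable_fun_coordinate[of "\<lambda>p. indicator {i<..} (fst p)"]) simp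
      show "(\<lambda>\<omega>. taboo_count A Z n (snd (\<omega> ([i], x))) (subtree i \<omega>)) \<in> borel_measurable discrete_prod"
        by (rule measurable_random_root[OF measurable_taboo_count measurable_subtree])
           (rule measurable_fun_coordinate, simp)
    qed
    have "(\<integral>\<^sup>+\<omega>. taboo_count A Z (Suc n) x \<omega> \<partial>bmc_rand d P)
      = (\<integral>\<^sup>+i. (\<integral>\<^sup>+\<omega>. indicator {i<..} (fst (\<omega> ([], x))) *
          taboo_count A Z n (snd (\<omega> ([i], x))) (subtree i \<omega>) \<partial>bmc_rand d P) \<partial>count_space UNIV)"
      unfolding taboo_count_Suc using False
      by (simp add: nn_integral_count_space_nn_integral[OF _ meas])
    also have "\<dots> = (\<integral>\<^sup>+i. (\<integral>\<^sup>+n. indicator {i<..} n \<partial>measure_pmf (d x)) *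
        (\<integral>\<^sup>+y. taboo_mean d P A Z n y \<partial>measure_pmf (P x)) \<partial>count_space UNIV)"
    proof (rule nn_integral_cong)
      fix i
      have "(\<integral>\<^sup>+\<omega>. indicator {i<..} (fst (\<omega> ([], x))) *
          (\<Prod>i\<in>{i}. taboo_count A Z n (snd (\<omega> ([i], x))) (subtree i \<omega>)) \<partial>bmc_rand d P)
        = (\<integral>\<^sup>+n. indicator {i<..} n \<partial>measure_pmf (d x)) *
          (\<Prod>i\<in>{i}. \<integral>\<^sup>+y. (\<integral>\<^sup>+\<omega>. taboo_count A Z n y \<omega> \<partial>bmc_rand d P) \<partial>measure_pmf (P x))"
      proof (rule branching_property)
        show "taboo_count A Z n y \<omega> = taboo_count A Z n y \<omega>'"
          if "\<And>p. fst (\<omega> p) = fst (\<omega>' p)" "\<And>ws z. ws \<noteq> [] \<Longrightarrow> snd (\<omega> (ws, z)) = snd (\<omega>' (ws, z))" for y \<omega> \<omega>'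
          using that by (rule taboo_count_cong_positions)
      qed (simp_all add: measurable_taboo_count)
      then show "(\<integral>\<^sup>+\<omega>. indicator {i<..} (fst (\<omega> ([], x))) *
          taboo_count A Z n (snd (\<omega> ([i], x))) (subtree i \<omega>) \<partial>bmc_rand d P)
        = (\<integral>\<^sup>+n. indicator {i<..} n \<partial>measure_pmf (d x)) * (\<integral>\<^sup>+y. taboo_mean d P A Z n y \<partial>measure_pmf (P x))"
        by (simp add: Suc)
    qed
    also have "\<dots> = taboo_mean d P A Z (Suc n) x"
      using False by (simp add: nn_integral_multc nn_integral_greater_sum nn_integral_qmat mean_def del: nn_integral_indicator)
    finally show ?thesis .
  qed
qed

lemma Qpow_eq_taboo_mean: "Qpow d P n x z = taboo_mean d P {} {z} n x"
  by (induction n arbitrary: x) (auto simp: indicator_def)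

lemma bmc_count_eq_suminf: "bmc_count x \<omega> z = (\<Sum>n. taboo_count {} {z} n x \<omega>)"
proof -
  have "bmc_count x \<omega> z = (\<Sum>n. \<integral>\<^sup>+ws. indicator {ws. bloc x \<omega> ws = Some z} ws * indicator {n} (length ws) \<partial>count_space UNIV)"
    unfolding bmc_count_def by (rule nn_integral_lists_by_length)
  then show ?thesis by (simp add: taboo_count_def)
qed

lemma measurable_bmc_count: "(\<lambda>\<omega>. bmc_count (x :: 'a::countable) \<omega> z) \<in> borel_measurable discrete_prod"
  unfolding bmc_count_eq_suminf by (intro borel_measurable_suminf_order measurable_taboo_count)

lemma expectation_bmc_count:
  fixes d :: "'a::countable \<Rightarrow> nat pmf"
  shows "(\<integral>\<^sup>+\<omega>. bmc_count x \<omega> z \<partial>bmc_rand d P) = green d P x z"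
  unfolding bmc_count_eq_suminf green_def
  by (simp add: nn_integral_suminf measurable_bmc_rand_iff measurable_taboo_count expectation_taboo_count Qpow_eq_taboo_mean)

lemma hB_eq_suminf:
  fixes d :: "'a::countable \<Rightarrow> nat pmf"
  shows "hB d P B x = (\<Sum>n. taboo_mean d P B B n x)"
proof -
  have "(\<integral>\<^sup>+ws. indicator {ws. first_hit B x \<omega> ws} ws \<partial>count_space UNIV) = (\<Sum>n. taboo_count B B n x \<omega>)" for \<omega>
    unfolding first_hit_def taboo_count_def by (rule nn_integral_lists_by_length)
  then show ?thesis unfolding hB_def
    by (simp add: nn_integral_suminf measurable_bmc_rand_iff measurable_taboo_count expectation_taboo_count)
qed

section \<open>Survival without hitting B\<close>

definition no_hit :: "'a set \<Rightarrow> nat \<Rightarrow> 'a \<Rightarrow> (nat list \<times> 'a \<Rightarrow> nat \<times> 'a) \<Rightarrow> bool" where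
  "no_hit B n x \<omega> \<longleftrightarrow> (\<forall>ws. length ws \<le> n \<longrightarrow> bloc x \<omega> ws \<notin> Some ` B)"

definition survival :: "('a \<Rightarrow> nat pmf) \<Rightarrow> ('a \<Rightarrow> 'a pmf) \<Rightarrow> 'a set \<Rightarrow> nat \<Rightarrow> 'a \<Rightarrow> ennreal" where
  "survival d P B n x = (\<integral>\<^sup>+\<omega>. of_bool (no_hit B n x \<omega>) \<partial>bmc_rand d P)"

lemma no_hit_Suc:
  "no_hit B (Suc n) x \<omega> \<longleftrightarrow>
    x \<notin> B \<and> (\<forall>i < fst (\<omega> ([], x)). no_hit B n (snd (\<omega> ([i], x))) (subtree i \<omega>))"
proof -
  have all: "(\<forall>ws. length ws \<le> Suc n \<longrightarrow> Q ws) \<longleftrightarrow> Q [] \<and> (\<forall>ws i. length ws \<le> n \<longrightarrow> Q (ws @ [i]))"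
    for Q :: "nat list \<Rightarrow> bool"
  proof safe
    fix ws :: "nat list" assume *: "Q []" "\<forall>ws i. length ws \<le> n \<longrightarrow> Q (ws @ [i])" "length ws \<le> Suc n"
    then show "Q ws" by (cases ws rule: rev_cases) auto
  qed auto
  show ?thesis unfolding no_hit_def all by (auto simp: bloc_snoc)
qed

lemma no_hit_cong_positions:
  assumes "\<And>p. fst (\<omega> p) = fst (\<omega>' p)" "\<And>ws z. ws \<noteq> [] \<Longrightarrow> snd (\<omega> (ws, z)) = snd (\<omega>' (ws, z))"
  shows "no_hit B n x \<omega> = no_hit B n x \<omega>'"
proof -
  have "bloc x \<omega> = bloc x \<omega>'" by (rule ext, rule bloc_cong_positions[of \<omega> \<omega>'], rule assms(1), rule assms(2))
  then show ?thesis by (simp add: no_hit_def)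
qed

lemma measurable_no_hit [measurable]:
  "Measurable.pred discrete_prod (no_hit B n (x :: 'a::countable))"
  unfolding no_hit_def
proof (intro pred_intros_countable)
  fix ws
  note measurable_bloc_mem [measurable]
  show "Measurable.pred discrete_prod (\<lambda>\<omega>. length ws \<le> n \<longrightarrow> bloc x \<omega> ws \<notin> Some ` B)"
    by measurable
qed

lemma measurable_of_bool_no_hit:
  "(\<lambda>\<omega>. of_bool (no_hit B n (x :: 'a::countable) \<omega>) :: ennreal) \<in> borel_measurable discrete_prod"
  unfolding of_bool_def by measurable

lemma survival_0: "survival d P B 0 x = indicator (- B) x"
proof -
  interpret prob_space "bmc_rand d P" by (rule prob_space_bmc_rand)
  show ?thesis
    by (auto simp: survival_def no_hit_def emeasure_space_1 indicator_def simp del: space_bmc_rand)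
qed

lemma prod_of_bool:
  "finite I \<Longrightarrow> (\<Prod>i\<in>I. of_bool (Q i)) = (of_bool (\<forall>i\<in>I. Q i) :: ennreal)"
  by (induction I rule: finite_induct) auto

lemma survival_Suc:
  fixes d :: "'a::countable \<Rightarrow> nat pmf"
  shows "survival d P B (Suc n) x = (if x \<in> B then 0
    else \<integral>\<^sup>+k. (\<integral>\<^sup>+y. survival d P B n y \<partial>measure_pmf (P x)) ^ k \<partial>measure_pmf (d x))"
proof (cases "x \<in> B")
  case False
  \<comment> \<open>Fixing the offspring number to k makes the product over the children range over
    a deterministic index set, as \<open>branching_property\<close> requires.\<close>
  define G where "G = (\<lambda>k \<omega>. indicator {k} (fst (\<omega> ([], x)))
      * (\<Prod>i<k. of_bool (no_hit B n (snd (\<omega> ([i], x))) (subtree i \<omega>)) :: ennreal))"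
  have meas: "G k \<in> borel_measurable (bmc_rand d P)" for k
    unfolding measurable_bmc_rand_iff G_def
  proof (intro borel_measurable_times_ennreal borel_measurable_prod_ennreal)
    show "(\<lambda>\<omega>. indicator {k} (fst (\<omega> ([], x))) :: ennreal) \<in> borel_measurable discrete_prod"
      by (rule measurable_fun_coordinate[of "\<lambda>p. indicator {k} (fst p)"]) simp
    show "(\<lambda>\<omega>. of_bool (no_hit B n (snd (\<omega> ([i], x))) (subtree i \<omega>)) :: ennreal) \<in> borel_measurable discrete_prod" for i
      by (rule measurable_random_root[OF measurable_of_bool_no_hit measurable_subtree])
         (rule measurable_fun_coordinate, simp)
  qed
  have int_G: "(\<integral>\<^sup>+\<omega>. G k \<omega> \<partial>bmc_rand d P)
     = ennreal (pmf (d x) k) * (\<integral>\<^sup>+y. survival d P B n y \<partial>measure_pmf (P x)) ^ k" for k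
  proof -
    have dep: "(of_bool (no_hit B n y \<omega>) :: ennreal) = of_bool (no_hit B n y \<omega>')"
      if "\<And>p. fst (\<omega> p) = fst (\<omega>' p)" "\<And>ws z. ws \<noteq> [] \<Longrightarrow> snd (\<omega> (ws, z)) = snd (\<omega>' (ws, z))" for y \<omega> \<omega>'
      using no_hit_cong_positions[of \<omega> \<omega>' B n y] that by simp
    have "(\<integral>\<^sup>+\<omega>. G k \<omega> \<partial>bmc_rand d P) = (\<integral>\<^sup>+n. indicator {k} n \<partial>measure_pmf (d x))
        * (\<Prod>i<k. \<integral>\<^sup>+y. (\<integral>\<^sup>+\<omega>. of_bool (no_hit B n y \<omega>) \<partial>bmc_rand d P) \<partial>measure_pmf (P x))"
      unfolding G_def
    proof (rule branching_property)
      show "(of_bool (no_hit B n y \<omega>) :: ennreal) = of_bool (no_hit B n y \<omega>')"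
        if "\<And>p. fst (\<omega> p) = fst (\<omega>' p)" "\<And>ws z. ws \<noteq> [] \<Longrightarrow> snd (\<omega> (ws, z)) = snd (\<omega>' (ws, z))" for y \<omega> \<omega>'
        using that by (rule dep)
    qed (simp_all add: measurable_of_bool_no_hit)
    then show ?thesis
      by (simp add: survival_def emeasure_pmf_single)
  qed
  have "survival d P B (Suc n) x = (\<integral>\<^sup>+\<omega>. (\<integral>\<^sup>+k. G k \<omega> \<partial>count_space UNIV) \<partial>bmc_rand d P)"
    unfolding survival_def
  proof (rule nn_integral_cong)
    fix \<omega> :: "nat list \<times> 'a \<Rightarrow> nat \<times> 'a"
    have "(\<integral>\<^sup>+k. G k \<omega> \<partial>count_space UNIV)
        = (\<Prod>i<fst (\<omega> ([], x)). of_bool (no_hit B n (snd (\<omega> ([i], x))) (subtree i \<omega>)))"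
      unfolding G_def by (subst mult.commute) (rule nn_integral_count_space_delta)
    also have "\<dots> = of_bool (no_hit B (Suc n) x \<omega>)"
      using False by (auto simp add: no_hit_Suc prod_of_bool)
    finally show "of_bool (no_hit B (Suc n) x \<omega>) = (\<integral>\<^sup>+k. G k \<omega> \<partial>count_space UNIV)" by simp
  qed
  also have "\<dots> = (\<integral>\<^sup>+k. (\<integral>\<^sup>+\<omega>. G k \<omega> \<partial>bmc_rand d P) \<partial>count_space UNIV)"
    by (rule nn_integral_count_space_nn_integral) (auto intro: meas)
  also have "\<dots> = (\<integral>\<^sup>+k. (\<integral>\<^sup>+y. survival d P B n y \<partial>measure_pmf (P x)) ^ k \<partial>measure_pmf (d x))"
    by (simp add: int_G nn_integral_measure_pmf)
  finally show ?thesis using False by simp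
qed (simp add: survival_def no_hit_Suc)

text \<open>A tree that never hits B avoids it in particular for n generations. This inequality at
  fixed n takes the place of a limit of survival probabilities.\<close>

lemma survival_add_prob_hit_ge_1:
  fixes d :: "'a::countable \<Rightarrow> nat pmf"
  shows "1 \<le> survival d P B n x + prob_hit d P B x"
proof -
  interpret prob_space "bmc_rand d P" by (rule prob_space_bmc_rand)
  note measurable_bloc_mem [measurable]
  have "Measurable.pred discrete_prod (\<lambda>\<omega>. \<exists>ws. bloc x \<omega> ws \<in> Some ` B)"
    by (intro pred_intros_countable measurable_bloc_mem)
  then have m: "{\<omega>. \<exists>ws. bloc x \<omega> ws \<in> Some ` B} \<in> sets (bmc_rand d P)"
    by (simp add: pred_def sets_bmc_rand)
  have "1 = (\<integral>\<^sup>+\<omega>. 1 \<partial>bmc_rand d P)" by (simp add: emeasure_space_1 del: space_bmc_rand)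
  also have "\<dots> \<le> (\<integral>\<^sup>+\<omega>. of_bool (no_hit B n x \<omega>) + indicator {\<omega>. \<exists>ws. bloc x \<omega> ws \<in> Some ` B} \<omega> \<partial>bmc_rand d P)"
    by (intro nn_integral_mono) (auto simp: no_hit_def indicator_def)
  also have "\<dots> = survival d P B n x + prob_hit d P B x"
    using m by (simp add: nn_integral_add measurable_bmc_rand_iff measurable_of_bool_no_hit survival_def prob_hit_def)
  finally show ?thesis .
qed

lemma prob_hit_le_hB:
  fixes d :: "'a::countable \<Rightarrow> nat pmf"
  shows "prob_hit d P B x \<le> hB d P B x"
proof -
  have "Measurable.pred discrete_prod (\<lambda>\<omega>. \<exists>ws. bloc x \<omega> ws \<in> Some ` B)"
    by (intro pred_intros_countable measurable_bloc_mem)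
  then have m: "{\<omega>. \<exists>ws. bloc x \<omega> ws \<in> Some ` B} \<in> sets (bmc_rand d P)"
    by (simp add: pred_def sets_bmc_rand)
  have "prob_hit d P B x = (\<integral>\<^sup>+\<omega>. indicator {\<omega>. \<exists>ws. bloc x \<omega> ws \<in> Some ` B} \<omega> \<partial>bmc_rand d P)"
    using m by (simp add: prob_hit_def)
  also have "\<dots> \<le> hB d P B x"
    unfolding hB_def
  proof (rule nn_integral_mono)
    fix \<omega> :: "nat list \<times> 'a \<Rightarrow> nat \<times> 'a"
    show "indicator {\<omega>. \<exists>ws. bloc x \<omega> ws \<in> Some ` B} \<omega>
       \<le> (\<integral>\<^sup>+ ws. indicator {ws. first_hit B x \<omega> ws} ws \<partial>count_space UNIV :: ennreal)"
    proof (cases "\<exists>ws. bloc x \<omega> ws \<in> Some ` B")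
      case True
      \<comment> \<open>A shortest word located in B is a first hit, because its strict ancestors
        are shorter.\<close>
      then obtain ws where ws: "bloc x \<omega> ws \<in> Some ` B"
        "\<And>vs. bloc x \<omega> vs \<in> Some ` B \<Longrightarrow> length ws \<le> length vs"
        using ex_has_least_nat[of "\<lambda>ws. bloc x \<omega> ws \<in> Some ` B" _ length] by blast
      have "bloc x \<omega> (drop k ws) \<notin> Some ` B" if "k \<in> {1..length ws}" for k
        using ws(2)[of "drop k ws"] that by auto
      with ws(1) have "first_hit B x \<omega> ws"
        by (simp add: first_hit_def)
      then have "(\<integral>\<^sup>+ vs. indicator {ws} vs \<partial>count_space UNIV :: ennreal)
          \<le> (\<integral>\<^sup>+ ws. indicator {ws. first_hit B x \<omega> ws} ws \<partial>count_space UNIV)"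
        by (intro nn_integral_mono) (auto simp: indicator_def)
      then show ?thesis using True by simp
    qed simp
  qed
  finally show ?thesis .
qed

section \<open>Green function, hitting expectation and maximum principle\<close>

lemma suminf_ennreal_split_head: "(\<Sum>n. f n) = (f 0 + (\<Sum>n. f (Suc n)) :: ennreal)"
proof -
  have "f sums ((\<Sum>n. f (Suc n)) + f 0)"
    by (rule sums_Suc) (rule summable_sums[OF summableI])
  then show ?thesis by (simp add: sums_iff add.commute)
qed

lemma suminf_ennreal_le: "(\<And>n. (\<Sum>k<n. f k) \<le> c) \<Longrightarrow> (\<Sum>n. f n) \<le> (c :: ennreal)"
  by (rule suminf_le_const[OF summableI])

text \<open>Common source of the one-step equation for g (\<open>A = {}\<close>) and of the
  harmonicity of h off B (\<open>A = Z = B\<close>).\<close>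

lemma suminf_taboo_mean:
  "(\<Sum>n. taboo_mean d P A Z n x) = indicator Z x +
    (if x \<in> A then 0 else \<integral>\<^sup>+y. qmat d P x y * (\<Sum>n. taboo_mean d P A Z n y) \<partial>count_space UNIV)"
  by (subst suminf_ennreal_split_head)
     (simp add: nn_integral_suminf[symmetric] ennreal_suminf_cmult)

lemma green_step:
  "green d P x z = indicator {z} x + (\<integral>\<^sup>+y. qmat d P x y * green d P y z \<partial>count_space UNIV)"
  unfolding green_def Qpow_eq_taboo_mean by (subst suminf_taboo_mean) simp

lemma sum_Qpow_Suc:
  "(\<Sum>k<Suc n. Qpow d P k x z) = indicator {z} x + (\<integral>\<^sup>+y. qmat d P x y * (\<Sum>k<n. Qpow d P k y z) \<partial>count_space UNIV)"
  by (simp add: sum.lessThan_Suc_shift sum_distrib_left nn_integral_sum indicator_def del: sum.lessThan_Suc)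

definition potential :: "('a \<Rightarrow> nat pmf) \<Rightarrow> ('a \<Rightarrow> 'a pmf) \<Rightarrow> ('a \<Rightarrow> ennreal) \<Rightarrow> 'a \<Rightarrow> ennreal" where
  "potential d P f x = (\<integral>\<^sup>+v. green d P x v * f v \<partial>count_space UNIV)"

lemma potential_step:
  fixes d :: "'a::countable \<Rightarrow> nat pmf"
  shows "potential d P f x = f x + (\<integral>\<^sup>+y. qmat d P x y * potential d P f y \<partial>count_space UNIV)"
proof -
  have "(\<integral>\<^sup>+y. qmat d P x y * potential d P f y \<partial>count_space UNIV)
      = (\<integral>\<^sup>+y. (\<integral>\<^sup>+v. qmat d P x y * green d P y v * f v \<partial>count_space UNIV) \<partial>count_space UNIV)"
    unfolding potential_def by (simp add: nn_integral_cmult[symmetric] mult.assoc)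
  also have "\<dots> = (\<integral>\<^sup>+v. (\<integral>\<^sup>+y. qmat d P x y * green d P y v * f v \<partial>count_space UNIV) \<partial>count_space UNIV)"
    by (rule nn_integral_count_space_nn_integral) auto
  also have "\<dots> = (\<integral>\<^sup>+v. (\<integral>\<^sup>+y. qmat d P x y * green d P y v \<partial>count_space UNIV) * f v \<partial>count_space UNIV)"
    by (simp add: nn_integral_multc)
  finally have 1: "(\<integral>\<^sup>+y. qmat d P x y * potential d P f y \<partial>count_space UNIV) = \<dots>" .
  have "f x = (\<integral>\<^sup>+v. f v * indicator {v} x \<partial>count_space UNIV)"
    by (rule nn_integral_count_space_delta[symmetric])
  then have "f x + (\<integral>\<^sup>+y. qmat d P x y * potential d P f y \<partial>count_space UNIV)
      = (\<integral>\<^sup>+v. f v * indicator {v} x + (\<integral>\<^sup>+y. qmat d P x y * green d P y v \<partial>count_space UNIV) * f v \<partial>count_space UNIV)"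
    unfolding 1 by (simp add: nn_integral_add)
  also have "\<dots> = potential d P f x"
    unfolding potential_def
    by (subst (2) green_step) (intro nn_integral_cong, simp add: algebra_simps)
  finally show ?thesis by simp
qed

section \<open>Size-biased moments and the Bonferroni inequality\<close>

lemma pmf_dsb:
  assumes "0 < mean d x" "mean d x < \<top>"
  shows "ennreal (pmf (dsb d x) n) = ennreal (real n) * ennreal (pmf (d x) n) / mean d x"
proof -
  obtain M where M: "mean d x = ennreal M" "M > 0"
    using assms by (cases "mean d x") (auto simp: ennreal_less_zero_iff zero_less_iff_neq_zero)
  have eq: "ennreal (real n * pmf (d x) n / M) = ennreal (real n) * ennreal (pmf (d x) n) / ennreal M" for n
    using M by (simp add: divide_ennreal[symmetric] ennreal_mult)
  have "(\<integral>\<^sup>+n. ennreal (real n * pmf (d x) n / M) \<partial>count_space UNIV)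
      = (\<integral>\<^sup>+n. ennreal (pmf (d x) n) * ennreal (real n) \<partial>count_space UNIV) / ennreal M"
    unfolding eq by (simp add: nn_integral_divide mult.commute)
  also have "\<dots> = mean d x / ennreal M"
    by (simp add: mean_def nn_integral_measure_pmf)
  also have "\<dots> = 1" using M by simp
  finally have "pmf (dsb d x) n = real n * pmf (d x) n / M"
    using assms M by (simp add: dsb_def pmf_embed_pmf)
  then show ?thesis unfolding M(1) eq[symmetric] by simp
qed

text \<open>Weighting by n turns the mean of n - 1 into the mean of n (n - 1), up to the factor m.
  Thus \<open>barm\<close> measures ordered pairs of siblings.\<close>

lemma second_factorial_moment:
  assumes "0 < mean d x" "mean d x < \<top>"
  shows "(\<integral>\<^sup>+n. ennreal (real n * (real n - 1)) \<partial>measure_pmf (d x)) = mean d x * barm d x"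
proof -
  have "mean d x * barm d x = (\<integral>\<^sup>+k. mean d x * (ennreal (pmf (dsb d x) k) * ennreal (real k - 1)) \<partial>count_space UNIV)"
    unfolding barm_def nn_integral_measure_pmf by (simp add: nn_integral_cmult)
  also have "\<dots> = (\<integral>\<^sup>+k. ennreal (pmf (d x) k) * ennreal (real k * (real k - 1)) \<partial>count_space UNIV)"
  proof (rule nn_integral_cong)
    fix k :: nat
    have "mean d x * (ennreal (pmf (dsb d x) k) * ennreal (real k - 1))
        = (mean d x / mean d x) * (ennreal (real k) * ennreal (pmf (d x) k)) * ennreal (real k - 1)"
      unfolding pmf_dsb[OF assms] by (simp add: divide_ennreal_def mult_ac)
    also have "mean d x / mean d x = 1" using assms by simp
    \<comment> \<open>At k = 0 the truncation in \<open>ennreal (real k - 1)\<close> is harmless,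
      since the factor \<open>real k\<close> vanishes.\<close>
    also have "1 * (ennreal (real k) * ennreal (pmf (d x) k)) * ennreal (real k - 1)
        = ennreal (pmf (d x) k) * ennreal (real k * (real k - 1))"
      by (cases "k = 0") (simp_all add: ennreal_mult mult_ac)
    finally show "mean d x * (ennreal (pmf (dsb d x) k) * ennreal (real k - 1)) = \<dots>" .
  qed
  finally show ?thesis by (simp add: nn_integral_measure_pmf)
qed

text \<open>Passing from k to k + 1 leaves the error - k (k - 1) a^3 / 2, which has the favourable
  sign.\<close>

lemma bonferroni_power:
  fixes a :: real
  assumes "0 \<le> a" "a \<le> 1"
  shows "(1 - a) ^ k \<le> 1 - real k * a + real k * (real k - 1) / 2 * a\<^sup>2"
proof (induction k)
  case (Suc k)
  have "(1 - a) ^ Suc k \<le> (1 - a) * (1 - real k * a + real k * (real k - 1) / 2 * a\<^sup>2)"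
    using Suc assms by (simp add: mult_left_mono)
  also have "\<dots> = 1 - real (Suc k) * a + real (Suc k) * (real (Suc k) - 1) / 2 * a\<^sup>2
      - real k * (real k - 1) / 2 * a ^ 3"
    by (simp add: field_simps power2_eq_square power3_eq_cube)
  also have "\<dots> \<le> 1 - real (Suc k) * a + real (Suc k) * (real (Suc k) - 1) / 2 * a\<^sup>2"
    using assms by (cases k) simp_all
  finally show ?case .
qed simp

section \<open>Comparison of h with the Green function\<close>

locale norming_bmc =
  fixes d :: "'a::countable \<Rightarrow> nat pmf" and P :: "'a \<Rightarrow> 'a pmf" and B :: "'a set"
  assumes green_finite: "green d P x y < \<top>"
    and norming: "norming_region d P B"
begin

abbreviation h :: "'a \<Rightarrow> ennreal" where "h \<equiv> hB d P B"

text \<open>A comparison function for h: it is positive by the norming property and finite because g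
  is, whereas positivity and finiteness of h are not visible from its definition.\<close>

definition green_B :: "'a \<Rightarrow> ennreal" where "green_B v = (\<Sum>b\<in>B. green d P v b)"

lemma finite_B: "finite B"
  using norming by (simp add: norming_region_def)

lemma green_B_pos: "0 < green_B v"
  using norming by (simp add: norming_region_def green_B_def)

lemma green_B_finite: "green_B v < \<top>"
  unfolding green_B_def using green_finite by (simp add: finite_B)

text \<open>q(x, y) is a single term of g(x, y), and p(x, y) > 0 for some y.\<close>

lemma mean_finite: "mean d x < \<top>"
proof -
  obtain y where y: "y \<in> set_pmf (P x)"
    using set_pmf_not_empty by fastforce
  have "qmat d P x y = (\<integral>\<^sup>+z. qmat d P x z * indicator {z} y \<partial>count_space UNIV)"
    by (rule nn_integral_count_space_delta[symmetric])
  also have "\<dots> = Qpow d P (Suc 0) x y"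
    by (simp add: indicator_def of_bool_def eq_commute)
  also have "\<dots> \<le> green d P x y"
    unfolding green_def using sum_le_suminf[OF summableI, of "{Suc 0}" "\<lambda>n. Qpow d P n x y"] by simp
  finally have "mean d x * ennreal (pmf (P x) y) < \<top>"
    unfolding qmat_def using green_finite le_less_trans by blast
  then show ?thesis
    using y by (auto simp: ennreal_mult_less_top set_pmf_iff ennreal_eq_0_iff less_top)
qed

lemma h_eq: "h x = (if x \<in> B then 1 else \<integral>\<^sup>+y. qmat d P x y * h y \<partial>count_space UNIV)"
  unfolding hB_eq_suminf by (subst suminf_taboo_mean) simp

text \<open>First hits in generation n are among the visits to B in generation n; in the recursion,
  dropping the taboo can only increase the mean.\<close>

lemma h_le_green_B: "h x \<le> green_B x"
proof -
  have "taboo_mean d P B B n x \<le> (\<Sum>b\<in>B. Qpow d P n x b)" for n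
  proof (induction n arbitrary: x)
    case 0
    then show ?case using finite_B by (simp add: indicator_def)
  next
    case (Suc n)
    have "taboo_mean d P B B (Suc n) x \<le> (\<integral>\<^sup>+y. qmat d P x y * taboo_mean d P B B n y \<partial>count_space UNIV)"
      by simp
    also have "\<dots> \<le> (\<integral>\<^sup>+y. qmat d P x y * (\<Sum>b\<in>B. Qpow d P n y b) \<partial>count_space UNIV)"
      by (intro nn_integral_mono mult_left_mono Suc) simp
    also have "\<dots> = (\<Sum>b\<in>B. Qpow d P (Suc n) x b)"
      by (simp add: sum_distrib_left nn_integral_sum)
    finally show ?case .
  qed
  then have "h x \<le> (\<Sum>n. \<Sum>b\<in>B. Qpow d P n x b)"
    unfolding hB_eq_suminf by (intro suminf_le summableI) auto
  also have "\<dots> = green_B x"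
    unfolding green_B_def green_def by (rule suminf_sum) (rule summableI)
  finally show ?thesis .
qed

lemma h_finite: "h x < \<top>"
  using h_le_green_B green_B_finite le_less_trans by blast

text \<open>Each visit to B is a first hit b or descends from one, and below b the expected number
  of visits is \<open>green_B b\<close>, at most the sum over the finite set B. Induction on
  truncated sums replaces a strong Markov argument.\<close>

lemma green_B_le_h: "green_B v \<le> (\<Sum>b\<in>B. green_B b) * h v"
proof -
  define M where "M = (\<Sum>b\<in>B. green_B b)"
  have "(\<Sum>b\<in>B. \<Sum>k<n. Qpow d P k v b) \<le> M * h v" for n
  proof (induction n arbitrary: v)
    case (Suc n)
    show ?case
    proof (cases "v \<in> B")
      case True
      have "(\<Sum>b\<in>B. \<Sum>k<Suc n. Qpow d P k v b) \<le> green_B v"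
        unfolding green_B_def green_def by (intro sum_mono sum_le_suminf summableI) auto
      also have "\<dots> \<le> M"
        unfolding M_def using True finite_B by (intro member_le_sum) auto
      finally show ?thesis using True by (subst h_eq) simp
    next
      case False
      have "(\<Sum>b\<in>B. \<Sum>k<Suc n. Qpow d P k v b)
          = (\<integral>\<^sup>+y. qmat d P v y * (\<Sum>b\<in>B. \<Sum>k<n. Qpow d P k y b) \<partial>count_space UNIV)"
        unfolding sum_Qpow_Suc using False
        by (auto simp: sum_distrib_left nn_integral_sum indicator_def sum.neutral intro!: sum.cong)
      also have "\<dots> \<le> (\<integral>\<^sup>+y. M * (qmat d P v y * h y) \<partial>count_space UNIV)"
        by (intro nn_integral_mono) (metis Suc mult.left_commute mult_left_mono zero_le)
      also have "\<dots> = M * h v"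
        using False by (subst (2) h_eq) (simp add: nn_integral_cmult)
      finally show ?thesis .
    qed
  qed simp
  then have "(\<Sum>n. \<Sum>b\<in>B. Qpow d P n v b) \<le> M * h v"
    by (intro suminf_ennreal_le) (subst sum.swap, simp)
  moreover have "(\<Sum>n. \<Sum>b\<in>B. Qpow d P n v b) = green_B v"
    unfolding green_B_def green_def by (rule suminf_sum) (rule summableI)
  ultimately show ?thesis by (simp add: M_def)
qed

lemma h_pos: "0 < h x"
proof (rule ccontr)
  assume "\<not> 0 < h x"
  then have "h x = 0" by (simp add: zero_less_iff_neq_zero)
  with green_B_le_h[of x] green_B_pos[of x] show False by simp
qed

text \<open>Maximum principle: the excessive function \<^term>\<open>green_B\<close> dominates the potential of
  a point as soon as it does so at that point.\<close>

lemma green_mult_green_B_le: "green d P v z * green_B z \<le> green d P z z * green_B v"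
proof -
  have excessive: "(\<integral>\<^sup>+y. qmat d P v y * green_B y \<partial>count_space UNIV) \<le> green_B v" for v
  proof -
    have "(\<integral>\<^sup>+y. qmat d P v y * green_B y \<partial>count_space UNIV)
        = (\<Sum>b\<in>B. \<integral>\<^sup>+y. qmat d P v y * green d P y b \<partial>count_space UNIV)"
      by (simp add: green_B_def sum_distrib_left nn_integral_sum)
    also have "\<dots> \<le> green_B v"
      unfolding green_B_def by (intro sum_mono, subst (2) green_step) simp
    finally show ?thesis .
  qed
  \<comment> \<open>Truncation permits induction: off z the truncated Green function has no source
    term and is an average under Q, while at z itself monotonicity suffices.\<close>
  have "(\<Sum>k<n. Qpow d P k v z) * green_B z \<le> green d P z z * green_B v" for n
  proof (induction n arbitrary: v)
    case (Suc n)
    show ?case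
    proof (cases "v = z")
      case True
      have "(\<Sum>k<Suc n. Qpow d P k z z) \<le> green d P z z"
        unfolding green_def by (intro sum_le_suminf summableI) auto
      then show ?thesis using True by (intro mult_mono) auto
    next
      case False
      have "(\<Sum>k<Suc n. Qpow d P k v z) * green_B z
          = (\<integral>\<^sup>+y. qmat d P v y * ((\<Sum>k<n. Qpow d P k y z) * green_B z) \<partial>count_space UNIV)"
        unfolding sum_Qpow_Suc using False by (simp add: nn_integral_multc[symmetric] mult.assoc)
      also have "\<dots> \<le> (\<integral>\<^sup>+y. green d P z z * (qmat d P v y * green_B y) \<partial>count_space UNIV)"
        by (intro nn_integral_mono) (metis Suc mult.left_commute mult_left_mono zero_le)
      also have "\<dots> \<le> green d P z z * green_B v"
        by (simp add: nn_integral_cmult mult_left_mono excessive)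
      finally show ?thesis .
    qed
  qed simp
  then show ?thesis
    unfolding green_def ennreal_suminf_multc[symmetric]
    by (intro suminf_ennreal_le) (simp add: sum_distrib_right green_def)
qed

text \<open>The maximum principle compares g(., z) with \<open>green_B\<close>, which in turn is at
  most a multiple of h.\<close>

lemma green_le_const_h: obtains c where "c < \<top>" "\<And>v. green d P v z \<le> c * h v"
proof
  define M where "M = (\<Sum>b\<in>B. green_B b)"
  have "M < \<top>" using green_B_finite by (simp add: M_def finite_B)
  then show "green d P z z * M / green_B z < \<top>"
    using green_finite green_B_pos[of z] green_B_finite[of z]
    by (auto simp: ennreal_divide_eq_top_iff ennreal_mult_eq_top_iff less_top[symmetric] zero_less_iff_neq_zero)
  fix v
  have "green d P v z = green d P v z * green_B z / green_B z"
    using green_B_pos[of z] green_B_finite[of z]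
    by (simp add: ennreal_mult_divide_eq zero_less_iff_neq_zero less_top[symmetric])
  also have "\<dots> \<le> green d P z z * (M * h v) / green_B z"
    using green_mult_green_B_le[of v z] mult_left_mono[OF green_B_le_h[of v], of "green d P z z"]
    unfolding M_def by (intro divide_right_mono_ennreal) (metis order_trans zero_le)
  also have "\<dots> = green d P z z * M / green_B z * h v"
    by (simp add: divide_ennreal_def mult_ac)
  finally show "green d P v z \<le> \<dots>" .
qed

end

section \<open>The lower bound on the hitting probability\<close>

context norming_bmc
begin

text \<open>Off B one has h = m H, with H the mean of h at the next position, so the weight equals
  E[N (N - 1)] H^2: the expected number of ordered pairs of first hits below two distinct children
  of an individual at y.\<close>

definition pair_weight :: "'a \<Rightarrow> ennreal" where
  "pair_weight y = indicator (- B) y * (barm d y / mean d y) * (h y)\<^sup>2"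

lemma potential_pair_weight_le: "potential d P pair_weight x \<le> Cconst d P B * h x"
proof -
  define N where "N = (\<integral>\<^sup>+ y. indicator (- B) y * (barm d y / mean d y) * green d P x y
        * (h y)\<^sup>2 \<partial>count_space UNIV)"
  have "potential d P pair_weight x = N"
    unfolding N_def potential_def pair_weight_def by (simp add: mult_ac)
  also have "\<dots> = N / h x * h x"
    using h_pos[of x] h_finite[of x]
    by (simp add: ennreal_divide_times ennreal_mult_divide_eq zero_less_iff_neq_zero less_top[symmetric])
  also have "\<dots> \<le> Cconst d P B * h x"
    unfolding Cconst_def N_def by (intro mult_right_mono SUP_upper) auto
  finally show ?thesis .
qed

lemma mean_pos: "x \<notin> B \<Longrightarrow> 0 < mean d x"
  using h_pos[of x] by (subst (asm) h_eq) (auto simp: nn_integral_qmat zero_less_iff_neq_zero)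

lemma h_eq_mean: "x \<notin> B \<Longrightarrow> h x = mean d x * (\<integral>\<^sup>+y. h y \<partial>measure_pmf (P x))"
  by (subst h_eq) (simp add: nn_integral_qmat)

text \<open>A truncation of the potential of \<open>pair_weight\<close> whose recursion runs in step
  with the one for survival probabilities, so that one induction carries both.\<close>

primrec pair_sum :: "nat \<Rightarrow> 'a \<Rightarrow> ennreal" where
  "pair_sum 0 x = 0"
| "pair_sum (Suc n) x = pair_weight x + (\<integral>\<^sup>+y. qmat d P x y * pair_sum n y \<partial>count_space UNIV)"

lemma pair_sum_le_potential: "pair_sum n x \<le> potential d P pair_weight x"
proof (induction n arbitrary: x)
  case (Suc n)
  have "(\<integral>\<^sup>+y. qmat d P x y * pair_sum n y \<partial>count_space UNIV)
      \<le> (\<integral>\<^sup>+y. qmat d P x y * potential d P pair_weight y \<partial>count_space UNIV)"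
    by (intro nn_integral_mono mult_left_mono Suc) simp
  then show ?case by (subst potential_step) (simp add: add_left_mono)
qed simp

lemma partial_h_Suc:
  "(\<Sum>k<Suc (Suc n). taboo_mean d P B B k x) = (if x \<in> B then 1
    else mean d x * (\<integral>\<^sup>+y. (\<Sum>k<Suc n. taboo_mean d P B B k y) \<partial>measure_pmf (P x)))"
proof -
  have "(\<Sum>k<Suc (Suc n). taboo_mean d P B B k x) = taboo_mean d P B B 0 x + (\<Sum>k<Suc n. taboo_mean d P B B (Suc k) x)"
    by (rule sum.lessThan_Suc_shift)
  also have "\<dots> = (if x \<in> B then 1
    else \<integral>\<^sup>+y. qmat d P x y * (\<Sum>k<Suc n. taboo_mean d P B B k y) \<partial>count_space UNIV)"
    by (simp add: sum_distrib_left nn_integral_sum del: sum.lessThan_Suc)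
  finally show ?thesis by (simp add: nn_integral_qmat del: sum.lessThan_Suc)
qed

lemma partial_h_le: "(\<Sum>k<n. taboo_mean d P B B k x) \<le> h x"
  unfolding hB_eq_suminf by (intro sum_le_suminf summableI) auto

lemma survival_le_1: "survival d P B n x \<le> 1"
proof -
  interpret prob_space "bmc_rand d P" by (rule prob_space_bmc_rand)
  have "survival d P B n x \<le> (\<integral>\<^sup>+\<omega>. 1 \<partial>bmc_rand d P)"
    unfolding survival_def by (intro nn_integral_mono) simp
  then show ?thesis by (simp add: emeasure_space_1 del: space_bmc_rand)
qed

text \<open>Here S plays the survival probability at a child's position, averaged over that
  position. Since S \<le> 1 - a, the power S^k is at most (1 - a)^k, and averaging the Bonferroni
  inequality over the offspring law leaves E[N (N - 1)] a^2 / 2.\<close>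

lemma offspring_bonferroni:
  assumes "x \<notin> B" and a: "0 \<le> a" and aS: "ennreal a + S \<le> 1"
  shows "mean d x * ennreal a + (\<integral>\<^sup>+k. S ^ k \<partial>measure_pmf (d x))
     \<le> 1 + mean d x * barm d x * ennreal (a\<^sup>2 / 2)"
proof -
  have "S \<le> ennreal a + S" by simp
  also have "\<dots> < \<top>" using aS by (rule le_less_trans) simp
  finally have "S < \<top>" .
  then obtain s where s: "S = ennreal s" "0 \<le> s" by (cases S) auto
  have as: "a + s \<le> 1" using aS a s by (simp add: ennreal_plus[symmetric] del: ennreal_plus)
  have pw: "ennreal (real k) * ennreal a + S ^ k \<le> 1 + ennreal (real k * (real k - 1)) * ennreal (a\<^sup>2 / 2)" for k
  proof -
    have nn: "0 \<le> real k * (real k - 1)" by (cases k) auto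
    have "s ^ k \<le> (1 - a) ^ k" using as s by (intro power_mono) auto
    also have "\<dots> \<le> 1 - real k * a + real k * (real k - 1) / 2 * a\<^sup>2"
      using a as s by (intro bonferroni_power) auto
    finally have "real k * a + s ^ k \<le> 1 + real k * (real k - 1) * (a\<^sup>2 / 2)" by simp
    then have "ennreal (real k * a + s ^ k) \<le> ennreal (1 + real k * (real k - 1) * (a\<^sup>2 / 2))"
      by (rule ennreal_leI)
    moreover have "ennreal (real k * a + s ^ k) = ennreal (real k) * ennreal a + S ^ k"
      using a s by (simp add: ennreal_mult ennreal_power)
    moreover have "ennreal (1 + real k * (real k - 1) * (a\<^sup>2 / 2)) = 1 + ennreal (real k * (real k - 1)) * ennreal (a\<^sup>2 / 2)"
    proof -
      have "ennreal (1 + real k * (real k - 1) * (a\<^sup>2 / 2)) = ennreal 1 + ennreal (real k * (real k - 1) * (a\<^sup>2 / 2))"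
        by (rule ennreal_plus) (simp, rule mult_nonneg_nonneg[OF nn], simp)
      also have "ennreal (real k * (real k - 1) * (a\<^sup>2 / 2)) = ennreal (real k * (real k - 1)) * ennreal (a\<^sup>2 / 2)"
        by (rule ennreal_mult[OF nn]) simp
      finally show ?thesis by (simp only: ennreal_1)
    qed
    ultimately show ?thesis by simp
  qed
  have "mean d x * ennreal a + (\<integral>\<^sup>+k. S ^ k \<partial>measure_pmf (d x))
      = (\<integral>\<^sup>+k. ennreal (real k) * ennreal a + S ^ k \<partial>measure_pmf (d x))"
    by (simp add: nn_integral_add nn_integral_multc mean_def)
  also have "\<dots> \<le> (\<integral>\<^sup>+k. 1 + ennreal (real k * (real k - 1)) * ennreal (a\<^sup>2 / 2) \<partial>measure_pmf (d x))"
    by (intro nn_integral_mono pw)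
  also have "\<dots> = 1 + mean d x * barm d x * ennreal (a\<^sup>2 / 2)"
    using second_factorial_moment[OF mean_pos[OF \<open>x \<notin> B\<close>] mean_finite]
    by (simp add: nn_integral_add nn_integral_multc measure_pmf.emeasure_space_1[simplified])
  finally show ?thesis .
qed

text \<open>Generations 0 to n enter on the left, but only 0 to n - 1 enter
  \<open>pair_sum n\<close>, since a pair that splits in generation k hits B no earlier than k + 1.
  The condition \<epsilon> \<le> 1 comes from B, where the left side equals \<epsilon>.\<close>

lemma partial_h_survival:
  assumes \<epsilon>: "0 \<le> \<epsilon>" "\<epsilon> \<le> 1"
  shows "ennreal \<epsilon> * (\<Sum>k<Suc n. taboo_mean d P B B k x) + survival d P B n x
    \<le> 1 + ennreal (\<epsilon>\<^sup>2 / 2) * pair_sum n x"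
proof -
  have half_square: "(ennreal e)\<^sup>2 * ennreal (1 / 2) = ennreal (e\<^sup>2 / 2)" if "0 \<le> e" for e
    unfolding ennreal_power[OF that] by (subst ennreal_mult[symmetric]) simp_all
  show ?thesis
  proof (induction n arbitrary: x)
    case 0
    then show ?case using \<epsilon> by (auto simp: survival_0 indicator_def)
  next
    case (Suc n)
    show ?case
    proof (cases "x \<in> B")
      case True
      then show ?thesis using \<epsilon> unfolding partial_h_Suc survival_Suc
        by (simp add: add_increasing2 del: pair_sum.simps)
    next
      case False
      define m where "m = mean d x"
      have m: "0 < m" "m < \<top>" using mean_pos[OF False] mean_finite by (auto simp: m_def)
      define H where "H = (\<integral>\<^sup>+y. h y \<partial>measure_pmf (P x))"
      define A where "A = (\<integral>\<^sup>+y. ennreal \<epsilon> * (\<Sum>k<Suc n. taboo_mean d P B B k y) \<partial>measure_pmf (P x))"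
      define S where "S = (\<integral>\<^sup>+y. survival d P B n y \<partial>measure_pmf (P x))"
      define R where "R = (\<integral>\<^sup>+y. ennreal (\<epsilon>\<^sup>2 / 2) * pair_sum n y \<partial>measure_pmf (P x))"
      have hx: "h x = m * H" using h_eq_mean[OF False] by (simp add: m_def H_def)
      have "A + S \<le> (\<integral>\<^sup>+y. 1 + ennreal (\<epsilon>\<^sup>2 / 2) * pair_sum n y \<partial>measure_pmf (P x))"
        unfolding A_def S_def
        by (subst nn_integral_add[symmetric]) (simp_all add: nn_integral_mono Suc del: sum.lessThan_Suc)
      also have "\<dots> = 1 + R"
        unfolding R_def by (simp add: nn_integral_add measure_pmf.emeasure_space_1[simplified])
      finally have ASR: "A + S \<le> 1 + R" .
      have "S \<le> (\<integral>\<^sup>+y. 1 \<partial>measure_pmf (P x))"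
        unfolding S_def by (intro nn_integral_mono survival_le_1)
      then have S1: "S \<le> 1" by (simp add: measure_pmf.emeasure_space_1[simplified])
      have "A \<le> (\<integral>\<^sup>+y. ennreal \<epsilon> * h y \<partial>measure_pmf (P x))"
        unfolding A_def by (intro nn_integral_mono mult_left_mono partial_h_le) simp
      then have AH: "A \<le> ennreal \<epsilon> * H" by (simp add: nn_integral_cmult H_def)
      obtain a where a: "0 \<le> a" "ennreal a = min A (1 - S)"
      proof -
        have "min A (1 - S) \<noteq> \<top>" by (auto simp: min_def top_unique)
        then show ?thesis using that by (cases "min A (1 - S)") auto
      qed
      have "ennreal a + S \<le> 1 - S + S" unfolding a(2) by (intro add_right_mono) simp
      also have "\<dots> = 1" using S1 by (simp add: diff_add_cancel_ennreal)
      finally have aS: "ennreal a + S \<le> 1" .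
      have Aa: "A \<le> ennreal a + R"
      proof (cases "A \<le> 1 - S")
        case True
        then show ?thesis using a by (simp add: min_def)
      next
        case False
        then have a_eq: "ennreal a = 1 - S" using a by (simp add: min_def)
        have "S + (ennreal a + R) = (1 - S + S) + R" unfolding a_eq by (simp only: add_ac)
        also have "\<dots> = 1 + R" using S1 by (simp add: diff_add_cancel_ennreal)
        finally have "S + A \<le> S + (ennreal a + R)" using ASR by (simp only: add.commute[of S A])
        moreover have "S \<noteq> \<top>" using S1 by (auto simp: top_unique)
        ultimately show ?thesis using ennreal_add_left_cancel_le[of S A "ennreal a + R"] by simp
      qed
      \<comment> \<open>Since a \<le> A \<le> \<epsilon> H and h x = m H, the quadratic loss is
        controlled by the weight at x itself.\<close>
      have "m * barm d x * ennreal (a\<^sup>2 / 2) \<le> ennreal (\<epsilon>\<^sup>2 / 2) * pair_weight x"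
      proof -
        have "ennreal a \<le> ennreal \<epsilon> * H" using a AH by (simp add: min_le_iff_disj order_trans[OF _ AH])
        then have "(ennreal a)\<^sup>2 \<le> (ennreal \<epsilon> * H)\<^sup>2" by (rule power_mono) simp
        then have "m * barm d x * ((ennreal a)\<^sup>2 * ennreal (1 / 2)) \<le> m * barm d x * ((ennreal \<epsilon> * H)\<^sup>2 * ennreal (1 / 2))"
          by (intro mult_left_mono mult_right_mono) auto
        also have "\<dots> = (ennreal \<epsilon>)\<^sup>2 * ennreal (1 / 2) * (barm d x * 1 * m * H\<^sup>2)"
          by (simp add: power_mult_distrib mult_ac)
        also have "\<dots> = ennreal (\<epsilon>\<^sup>2 / 2) * (barm d x * (m / m) * m * H\<^sup>2)"
          unfolding half_square[OF \<epsilon>(1)] using m by simp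
        also have "barm d x * (m / m) * m * H\<^sup>2 = pair_weight x"
          using False unfolding pair_weight_def hx
          by (simp add: m_def[symmetric] divide_ennreal_def power2_eq_square mult_ac)
        finally show ?thesis unfolding half_square[OF a(1)] .
      qed
      then have bonf: "m * ennreal a + (\<integral>\<^sup>+k. S ^ k \<partial>measure_pmf (d x)) \<le> 1 + ennreal (\<epsilon>\<^sup>2 / 2) * pair_weight x"
        using offspring_bonferroni[OF False a(1) aS] by (simp add: m_def add_left_mono order_trans)
      have "ennreal \<epsilon> * (\<Sum>k<Suc (Suc n). taboo_mean d P B B k x) + survival d P B (Suc n) x
          = m * A + (\<integral>\<^sup>+k. S ^ k \<partial>measure_pmf (d x))"
        unfolding partial_h_Suc survival_Suc A_def S_def m_def
        using False by (simp add: nn_integral_cmult mult.left_commute del: sum.lessThan_Suc)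
      also have "\<dots> \<le> m * (ennreal a + R) + (\<integral>\<^sup>+k. S ^ k \<partial>measure_pmf (d x))"
        by (intro add_right_mono mult_left_mono Aa) simp
      also have "\<dots> = (m * ennreal a + (\<integral>\<^sup>+k. S ^ k \<partial>measure_pmf (d x))) + m * R"
        by (simp add: algebra_simps)
      also have "\<dots> \<le> (1 + ennreal (\<epsilon>\<^sup>2 / 2) * pair_weight x) + m * R"
        by (intro add_right_mono bonf)
      also have "\<dots> = 1 + ennreal (\<epsilon>\<^sup>2 / 2) * pair_sum (Suc n) x"
        unfolding R_def m_def
        by (simp add: nn_integral_qmat nn_integral_cmult distrib_left mult.left_commute add.assoc)
      finally show ?thesis .
    qed
qed
qed

lemma prob_hit_lower_bound:
  assumes C: "Cconst d P B < \<top>"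
  shows "h x / (4 * Cconst d P B + 2) \<le> prob_hit d P B x"
proof -
  interpret prob_space "bmc_rand d P" by (rule prob_space_bmc_rand)
  obtain c where c: "Cconst d P B = ennreal c" "0 \<le> c" using C by (cases "Cconst d P B") auto
  obtain t where t: "h x = ennreal t" "0 \<le> t" using h_finite[of x] by (cases "h x") auto
  have "prob_hit d P B x \<noteq> \<top>" by (simp add: prob_hit_def)
  then obtain p where p: "prob_hit d P B x = ennreal p" "0 \<le> p" by (cases "prob_hit d P B x") auto
  \<comment> \<open>For c > 0 the gain \<epsilon> - \<epsilon>^2 c / 2 is largest at \<epsilon> = 1
    / c, which may exceed 1. The choice 1 / (c + 1) is admissible for every c and keeps the gain at
    least 1 / (2 c + 2), hence at least 1 / (4 c + 2).\<close>
  define \<epsilon> where "\<epsilon> = 1 / (c + 1)"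
  have \<epsilon>: "0 \<le> \<epsilon>" "\<epsilon> \<le> 1" using c by (auto simp: \<epsilon>_def field_simps)
  have "(\<Sum>k<n. ennreal \<epsilon> * taboo_mean d P B B k x) \<le> prob_hit d P B x + ennreal (\<epsilon>\<^sup>2 / 2) * (Cconst d P B * h x)" for n
  proof -
    have "(\<Sum>k<n. ennreal \<epsilon> * taboo_mean d P B B k x) + survival d P B n x
        \<le> ennreal \<epsilon> * (\<Sum>k<Suc n. taboo_mean d P B B k x) + survival d P B n x"
      by (simp add: sum_distrib_left[symmetric] distrib_left add_right_mono)
    also have "\<dots> \<le> 1 + ennreal (\<epsilon>\<^sup>2 / 2) * pair_sum n x"
      by (rule partial_h_survival[OF \<epsilon>])
    also have "\<dots> \<le> (survival d P B n x + prob_hit d P B x) + ennreal (\<epsilon>\<^sup>2 / 2) * (Cconst d P B * h x)"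
      by (intro add_mono mult_left_mono survival_add_prob_hit_ge_1
          order_trans[OF pair_sum_le_potential potential_pair_weight_le]) simp
    finally have "(\<Sum>k<n. ennreal \<epsilon> * taboo_mean d P B B k x) + survival d P B n x
        \<le> (prob_hit d P B x + ennreal (\<epsilon>\<^sup>2 / 2) * (Cconst d P B * h x)) + survival d P B n x"
      by (simp add: add_ac)
    moreover have "survival d P B n x \<noteq> \<top>" using survival_le_1[of n x] by (auto simp: top_unique)
    ultimately show ?thesis by simp
  qed
  then have "ennreal \<epsilon> * h x \<le> prob_hit d P B x + ennreal (\<epsilon>\<^sup>2 / 2) * (Cconst d P B * h x)"
    unfolding hB_eq_suminf[of d P B x] ennreal_suminf_cmult[symmetric] by (rule suminf_ennreal_le)
  moreover have "ennreal (\<epsilon> * t) = ennreal \<epsilon> * h x"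
    using t \<epsilon> by (simp add: ennreal_mult)
  moreover have "ennreal (p + \<epsilon>\<^sup>2 / 2 * (c * t)) = prob_hit d P B x + ennreal (\<epsilon>\<^sup>2 / 2) * (Cconst d P B * h x)"
    unfolding c(1) t(1) p(1) using c(2) t(2) p(2)
    by (subst ennreal_plus, simp, simp, subst ennreal_mult, simp, simp, subst ennreal_mult) simp_all
  ultimately have "ennreal (\<epsilon> * t) \<le> ennreal (p + \<epsilon>\<^sup>2 / 2 * (c * t))"
    by simp
  then have "\<epsilon> * t \<le> p + \<epsilon>\<^sup>2 / 2 * (c * t)"
    using c t p \<epsilon> by (subst (asm) ennreal_le_iff) auto
  then have low: "(\<epsilon> - \<epsilon>\<^sup>2 / 2 * c) * t \<le> p" by (simp add: algebra_simps)
  have "\<epsilon> - \<epsilon>\<^sup>2 / 2 * c = (c + 2) / (2 * (c + 1)\<^sup>2)"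
    using c by (simp add: \<epsilon>_def power2_eq_square divide_simps)
  also have "\<dots> \<ge> 1 / (4 * c + 2)"
    using c by (simp add: divide_simps power2_eq_square) (simp add: algebra_simps)
  finally have "1 / (4 * c + 2) * t \<le> (\<epsilon> - \<epsilon>\<^sup>2 / 2 * c) * t"
    using t by (intro mult_right_mono) auto
  with low have "t / (4 * c + 2) \<le> p" by simp
  moreover have "h x / (4 * Cconst d P B + 2) = ennreal (t / (4 * c + 2))"
  proof -
    have E: "4 * Cconst d P B + 2 = ennreal (4 * c + 2)"
      using c by (simp add: ennreal_plus ennreal_mult)
    show ?thesis unfolding E t(1) by (rule divide_ennreal) (use t c in auto)
  qed
  ultimately show ?thesis using p by (simp add: ennreal_leI)
qed

end

section \<open>Occupation sums of quasi-processes\<close>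

lemma rep_class:
  assumes "c \<in> Dstar"
  shows "rep c \<in> c" and "\<And>w. w \<in> c \<Longrightarrow> inD w" and "\<And>w. w \<in> c \<Longrightarrow> \<exists>k. w = (\<lambda>n. rep c (n + k))"
proof -
  obtain w0 where w0: "inD w0" "c = shift_rel `` {w0}"
    using assms by (auto simp: Dstar_def quotient_def)
  have "w0 \<in> c"
    using w0 by (auto simp: shift_rel_def intro: exI[of _ 0])
  then show rep: "rep c \<in> c"
    unfolding rep_def by (rule someI[where P="\<lambda>w. w \<in> c"])
  show "inD w" if "w \<in> c" for w
    using that w0 by (auto simp: shift_rel_def)
  show "\<exists>k. w = (\<lambda>n. rep c (n + k))" if w: "w \<in> c" for w
  proof -
    obtain k where k: "\<And>n. w n = w0 (n + k)" using w w0 by (auto simp: shift_rel_def)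
    obtain k' where k': "\<And>n. rep c n = w0 (n + k')" using rep w0 by (auto simp: shift_rel_def)
    have "w = (\<lambda>n. rep c (n + (k - k')))" by (auto simp: k k')
    then show ?thesis by blast
  qed
qed

lemma inD_rep: "c \<in> Dstar \<Longrightarrow> inD (rep c)"
  using rep_class by blast

lemma Union_Dstar: "\<Union>Dstar = {w :: int \<Rightarrow> 'a option. inD w}"
proof
  show "\<Union>Dstar \<subseteq> {w :: int \<Rightarrow> 'a option. inD w}" using rep_class(2) by blast
  show "{w :: int \<Rightarrow> 'a option. inD w} \<subseteq> \<Union>Dstar"
  proof
    fix w :: "int \<Rightarrow> 'a option" assume "w \<in> {w. inD w}"
    then have "shift_rel `` {w} \<in> Dstar" "w \<in> shift_rel `` {w}"
      by (auto simp: Dstar_def quotient_def shift_rel_def intro: exI[of _ 0])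
    then show "w \<in> \<Union>Dstar" by blast
  qed
qed

text \<open>That the set of paths in D is measurable need not be proved: it is the union of the whole
  space, which is an event.\<close>

lemma measurable_shift_invariant:
  fixes f :: "(int \<Rightarrow> 'a option) \<Rightarrow> 'b"
  assumes \<eta>: "space \<eta> = Dstar" "sets \<eta> = Dstar_sets"
    and f: "f \<in> measurable discrete_prod N"
    and inv: "\<And>w k. inD w \<Longrightarrow> f (\<lambda>n. w (n + k)) = f w"
  shows "(\<lambda>c. f (rep c)) \<in> measurable \<eta> N"
proof (rule measurableI)
  show "f (rep c) \<in> space N" for c
    using measurable_space[OF f] by simp
  fix A assume A: "A \<in> sets N"
  have "(Dstar :: (int \<Rightarrow> 'a option) set set) \<in> Dstar_sets" using sets.top[of \<eta>] \<eta> by simp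
  then have D: "{w. inD w} \<in> sets (discrete_prod :: (int \<Rightarrow> 'a option) measure)"
    by (simp add: Dstar_sets_def Union_Dstar)
  \<comment> \<open>By shift invariance the event does not depend on the representative, so its
    union is the intersection of D with a product event; the choice function itself never has to be
    measurable.\<close>
  have "\<Union>{c \<in> Dstar. f (rep c) \<in> A} = {w. inD w} \<inter> (f -` A \<inter> space discrete_prod)"
  proof (rule set_eqI)
    fix w
    have same: "f w = f (rep c)" if c: "c \<in> Dstar" "w \<in> c" for c
    proof -
      obtain k where "w = (\<lambda>n. rep c (n + k))" using rep_class(3)[OF c] by blast
      with inv[OF inD_rep[OF c(1)]] show ?thesis by simp
    qed
    have "w \<in> \<Union>{c \<in> Dstar. f (rep c) \<in> A} \<longleftrightarrow> (\<exists>c\<in>Dstar. w \<in> c \<and> f (rep c) \<in> A)" by blast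
    also have "\<dots> \<longleftrightarrow> (\<exists>c\<in>Dstar. w \<in> c \<and> f w \<in> A)" using same by auto
    also have "\<dots> \<longleftrightarrow> w \<in> \<Union>Dstar \<and> f w \<in> A" by blast
    finally show "w \<in> \<Union>{c \<in> Dstar. f (rep c) \<in> A} \<longleftrightarrow> w \<in> {w. inD w} \<inter> (f -` A \<inter> space discrete_prod)"
      by (simp add: Union_Dstar)
  qed
  also have "\<dots> \<in> sets discrete_prod"
    using D measurable_sets[OF f A] by blast
  finally show "(\<lambda>c. f (rep c)) -` A \<inter> space \<eta> \<in> sets \<eta>"
    unfolding \<eta> by (simp add: Dstar_sets_def vimage_def Int_def conj_commute)
qed

section \<open>First entrance into a finite set\<close>

definition first_entrance :: "'a set \<Rightarrow> (int \<Rightarrow> 'a option) \<Rightarrow> int \<Rightarrow> bool" where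
  "first_entrance F w n \<longleftrightarrow> w n \<in> Some ` F \<and> (\<forall>m<n. w m \<notin> Some ` F)"

lemma fent_eqI: "first_entrance F w n \<Longrightarrow> fent F w = n"
  unfolding fent_def first_entrance_def by (rule Least_equality) (auto simp: not_less[symmetric])

text \<open>\<open>LEAST\<close> over the integers is meaningful only if a least visit exists. It
  does, since a path of D is outside any given finite set at all sufficiently early times.\<close>

lemma first_entrance_fent:
  assumes "inD w" "finite F" "hits F w"
  shows "first_entrance F w (fent F w)"
proof -
  obtain n where n: "w n \<in> Some ` F" using assms(3) by (auto simp: hits_def)
  have "\<forall>\<^sub>F n in at_bot. w n \<notin> Some ` F" using assms by (auto simp: inD_def)
  then obtain N where N: "\<And>n. n \<le> N \<Longrightarrow> w n \<notin> Some ` F" by (auto simp: eventually_at_bot_linorder)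
  \<comment> \<open>The integers are not well-ordered, so times are measured from N in natural
    numbers; all visits lie strictly after N, and the truncation by \<open>nat\<close> loses
    nothing.\<close>
  obtain n0 where n0: "w n0 \<in> Some ` F" "\<And>m. w m \<in> Some ` F \<Longrightarrow> nat (n0 - N) \<le> nat (m - N)"
    using ex_has_least_nat[of "\<lambda>n. w n \<in> Some ` F" n "\<lambda>n. nat (n - N)"] n by blast
  have "first_entrance F w n0"
    unfolding first_entrance_def
  proof (intro conjI allI impI notI)
    fix m assume m: "m < n0" "w m \<in> Some ` F"
    then have "N < m" using N not_less by blast
    with n0(2)[OF m(2)] m(1) show False by linarith
  qed (rule n0)
  then show ?thesis by (simp add: fent_eqI)
qed

lemma hits_iff_first_entrance:
  "inD w \<Longrightarrow> finite F \<Longrightarrow> hits F w \<longleftrightarrow> (\<exists>n. first_entrance F w n)"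
  using first_entrance_fent by (fastforce simp: hits_def first_entrance_def)

lemma first_entrance_shift: "first_entrance F (\<lambda>n. w (n + k)) n \<longleftrightarrow> first_entrance F w (n + k)"
proof -
  have "(\<forall>m<n. w (m + k) \<notin> Some ` F) \<longleftrightarrow> (\<forall>m<n + k. w m \<notin> Some ` F)"
    by (metis add_less_cancel_right diff_add_cancel)
  then show ?thesis by (simp add: first_entrance_def)
qed

lemma measurable_path_mem: "Measurable.pred discrete_prod (\<lambda>w. w n \<in> T)"
  using measurable_compose[OF measurable_coordinate[of n], of "\<lambda>u. u \<in> T" "count_space UNIV"] by simp

lemma measurable_first_entrance: "Measurable.pred discrete_prod (\<lambda>w. first_entrance F w (n :: int))"
proof -
  note measurable_path_mem [measurable]
  show ?thesis unfolding first_entrance_def by measurable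
qed

definition lift0 :: "('a \<Rightarrow> ennreal) \<Rightarrow> 'a option \<Rightarrow> ennreal" where
  "lift0 \<phi> u = (case u of None \<Rightarrow> 0 | Some x \<Rightarrow> \<phi> x)"

lemma lift0_simps [simp]: "lift0 \<phi> None = 0" "lift0 \<phi> (Some x) = \<phi> x"
  by (simp_all add: lift0_def)

text \<open>\<open>pathprob\<close> peels off the first step, while the Markov property appends a
  state at the end.\<close>

lemma pathprob_snoc:
  "ys \<noteq> [] \<Longrightarrow> pathprob d P B (ys @ [v]) = pathprob d P B ys * ph_opt d P B (last ys) v"
proof (induction ys)
  case (Cons y ys)
  then show ?case by (cases ys) (auto simp: mult.assoc)
qed simp

lemma nn_integral_option:
  assumes "f None = (0 :: ennreal)"
  shows "(\<integral>\<^sup>+u. f u \<partial>count_space UNIV) = (\<integral>\<^sup>+y. f (Some y) \<partial>count_space UNIV)"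
proof -
  have "(\<integral>\<^sup>+y. f (Some y) \<partial>count_space UNIV) = (\<integral>\<^sup>+u. f u \<partial>count_space (range Some))"
    by (rule nn_integral_bij_count_space) (simp add: bij_betw_def)
  also have "\<dots> = (\<integral>\<^sup>+u. f u \<partial>count_space UNIV)"
  proof (rule nn_integral_count_space_eq)
    show "f u = 0" if "u \<in> UNIV - range Some" for u
      using that assms by (cases u) auto
  qed simp
  finally show ?thesis by simp
qed

lemma finite_to_nat_less: "finite {x :: 'a::countable. to_nat x < N}"
proof (rule finite_imageD)
  show "finite (to_nat ` {x :: 'a. to_nat x < N})"
    by (rule finite_subset[of _ "{..<N}"]) auto
qed (simp add: inj_on_def)

section \<open>Moments of the h-transformed chain\<close>

context norming_bmc
begin

primrec chain_mean :: "nat \<Rightarrow> ('a \<Rightarrow> ennreal) \<Rightarrow> 'a \<Rightarrow> ennreal" where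
  "chain_mean 0 \<phi> x = \<phi> x"
| "chain_mean (Suc n) \<phi> x = (\<integral>\<^sup>+y. ph d P B x y * chain_mean n \<phi> y \<partial>count_space UNIV)"

text \<open>The version with cemetery, matching \<open>ph_opt\<close>; weights vanish at the
  cemetery, so killed paths contribute nothing.\<close>

primrec chain_mean_opt :: "nat \<Rightarrow> ('a \<Rightarrow> ennreal) \<Rightarrow> 'a option \<Rightarrow> ennreal" where
  "chain_mean_opt 0 \<phi> u = lift0 \<phi> u"
| "chain_mean_opt (Suc n) \<phi> u = (\<integral>\<^sup>+v. ph_opt d P B u v * chain_mean_opt n \<phi> v \<partial>count_space UNIV)"

lemma chain_mean_opt_eq: "chain_mean_opt n \<phi> u = lift0 (chain_mean n \<phi>) u"
proof (induction n arbitrary: u)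
  case 0
  then show ?case by (cases u) simp_all
next
  case (Suc n)
  have "chain_mean_opt (Suc n) \<phi> u = (\<integral>\<^sup>+y. ph_opt d P B u (Some y) * chain_mean n \<phi> y \<partial>count_space UNIV)"
    by (simp add: Suc nn_integral_option)
  then show ?case by (cases u) (simp_all)
qed

text \<open>The Doob transform in product form: h is positive and finite, so the division by it can
  be undone here and does not return in the estimates.\<close>

lemma ph_mult_h: "ph d P B x y * h x = (if x \<in> B then 0 else qmat d P x y * h y)"
  using h_pos[of x] h_finite[of x]
  by (simp add: ph_def ennreal_divide_times ennreal_mult_divide_eq zero_less_iff_neq_zero less_top[symmetric])

lemma chain_mean_Suc_mult_h:
  "(\<integral>\<^sup>+y. ph d P B x y * f y \<partial>count_space UNIV) * h x =
    (if x \<in> B then 0 else \<integral>\<^sup>+y. qmat d P x y * (f y * h y) \<partial>count_space UNIV)"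
proof -
  have "(\<integral>\<^sup>+y. ph d P B x y * f y \<partial>count_space UNIV) * h x = (\<integral>\<^sup>+y. (ph d P B x y * h x) * f y \<partial>count_space UNIV)"
    by (subst nn_integral_multc[symmetric]) (simp_all add: mult_ac)
  then show ?thesis unfolding ph_mult_h by (auto simp: mult_ac)
qed

text \<open>Multiplication by h turns the transformed chain back into Q killed on B; omitting the
  killing yields the full Green potential.\<close>

lemma sum_chain_mean_le_potential:
  "(\<Sum>n. chain_mean n \<phi> x) * h x \<le> potential d P (\<lambda>v. \<phi> v * h v) x"
proof -
  have "(\<Sum>k<n. chain_mean k \<phi> x) * h x \<le> potential d P (\<lambda>v. \<phi> v * h v) x" for n
  proof (induction n arbitrary: x)
    case (Suc n)
    have "(\<Sum>k<Suc n. chain_mean k \<phi> x) = \<phi> x + (\<integral>\<^sup>+y. ph d P B x y * (\<Sum>k<n. chain_mean k \<phi> y) \<partial>count_space UNIV)"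
      by (simp add: sum.lessThan_Suc_shift sum_distrib_left nn_integral_sum del: sum.lessThan_Suc)
    then have "(\<Sum>k<Suc n. chain_mean k \<phi> x) * h x
        \<le> \<phi> x * h x + (\<integral>\<^sup>+y. qmat d P x y * ((\<Sum>k<n. chain_mean k \<phi> y) * h y) \<partial>count_space UNIV)"
      by (simp add: distrib_right chain_mean_Suc_mult_h add_left_mono)
    also have "\<dots> \<le> \<phi> x * h x + (\<integral>\<^sup>+y. qmat d P x y * potential d P (\<lambda>v. \<phi> v * h v) y \<partial>count_space UNIV)"
      by (intro add_left_mono nn_integral_mono mult_left_mono Suc) simp
    also have "\<dots> = potential d P (\<lambda>v. \<phi> v * h v) x"
      by (rule potential_step[symmetric])
    finally show ?case .
  qed simp
  then show ?thesis
    unfolding ennreal_suminf_multc[symmetric]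
    by (intro suminf_ennreal_le) (simp add: sum_distrib_right)
qed

text \<open>The h-transformed chain hits B with probability one, exactly once.\<close>

lemma sum_chain_mean_B: "(\<Sum>n. chain_mean n (indicator B) x) = 1"
proof -
  have "chain_mean n (indicator B) x * h x = taboo_mean d P B B n x" for n
  proof (induction n arbitrary: x)
    case 0
    then show ?case by (subst h_eq) (auto simp: indicator_def)
  next
    case (Suc n)
    then show ?case by (simp add: chain_mean_Suc_mult_h)
  qed
  then have "(\<Sum>n. chain_mean n (indicator B) x) * h x = h x"
    unfolding ennreal_suminf_multc[symmetric] hB_eq_suminf[of d P B x] by simp
  then have "(\<Sum>n. chain_mean n (indicator B) x) * h x / h x = h x / h x" by simp
  then show ?thesis
    using h_pos[of x] h_finite[of x]
    by (simp add: ennreal_mult_divide_eq zero_less_iff_neq_zero less_top[symmetric])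
qed

end

section \<open>Markov property of a quasi-process\<close>

locale quasi_bmc = norming_bmc +
  fixes \<eta> :: "(int \<Rightarrow> 'a option) set measure"
  assumes quasi: "quasi_process d P B \<eta>"
begin

lemma space_\<eta>: "space \<eta> = Dstar" and sets_\<eta>: "sets \<eta> = Dstar_sets"
  using quasi by (auto simp: quasi_process_def)

definition cyl :: "'a set \<Rightarrow> 'a option list \<Rightarrow> (int \<Rightarrow> 'a option) set set" where
  "cyl F ys = {c \<in> Dstar. hits F (rep c) \<and> (\<forall>i < length ys. piB F (rep c) i = ys ! i)}"

lemma measurable_hits_rep:
  assumes "finite F"
  shows "Measurable.pred \<eta> (\<lambda>c. hits F (rep c))"
proof (rule measurable_shift_invariant[OF space_\<eta> sets_\<eta>])
  show "Measurable.pred discrete_prod (hits F)"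
    unfolding hits_def by (intro pred_intros_countable measurable_path_mem)
  show "hits F (\<lambda>n. w (n + k)) = hits F w" for w k
    unfolding hits_def by (metis diff_add_cancel)
qed

text \<open>The outer option marks paths that miss F, for which \<open>piB\<close> has no meaning.
  The event is a countable union over the entrance time n; the union is shift invariant although its
  single members are not.\<close>

lemma measurable_piB_rep:
  assumes "finite F"
  shows "(\<lambda>c. if hits F (rep c) then Some (piB F (rep c) j) else None) \<in> measurable \<eta> (count_space UNIV)"
proof -
  have "Measurable.pred \<eta> (\<lambda>c. hits F (rep c) \<and> piB F (rep c) j = v)" for v
  proof -
    have "Measurable.pred \<eta> (\<lambda>c. \<exists>n. first_entrance F (rep c) n \<and> rep c (n + int j) = v)"
    proof (rule measurable_shift_invariant[OF space_\<eta> sets_\<eta>, where f="\<lambda>w. \<exists>n. first_entrance F w n \<and> w (n + int j) = v"])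
      show "Measurable.pred discrete_prod (\<lambda>w. \<exists>n. first_entrance F w n \<and> w (n + int j) = v)"
        using measurable_path_mem[of _ "{v}"]
        by (intro pred_intros_countable pred_intros_logic measurable_first_entrance) simp
      show "(\<exists>n. first_entrance F (\<lambda>n. w (n + k)) n \<and> w (n + int j + k) = v)
          = (\<exists>n. first_entrance F w n \<and> w (n + int j) = v)" for w k
      proof -
        have "(\<exists>n. Q (n + k)) \<longleftrightarrow> (\<exists>n. Q n)" for Q :: "int \<Rightarrow> bool"
          by (metis diff_add_cancel)
        from this[of "\<lambda>n. first_entrance F w n \<and> w (n + int j) = v"] show ?thesis
          unfolding first_entrance_shift by (simp add: add_ac)
      qed
    qed
    moreover have "(\<exists>n. first_entrance F (rep c) n \<and> rep c (n + int j) = v) \<longleftrightarrow> hits F (rep c) \<and> piB F (rep c) j = v"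
      if "c \<in> space \<eta>" for c
    proof -
      have D: "inD (rep c)" using that by (simp add: space_\<eta> inD_rep)
      show ?thesis
        using hits_iff_first_entrance[OF D assms] first_entrance_fent[OF D assms]
        by (auto simp: piB_def dest: fent_eqI)
    qed
    ultimately show ?thesis by (simp cong: measurable_cong)
  qed
  note set = this[unfolded pred_def]
  show ?thesis
  proof (subst measurable_count_space_eq_countable)
    show "(\<lambda>c. if hits F (rep c) then Some (piB F (rep c) j) else None) \<in> space \<eta> \<rightarrow> UNIV \<and>
      (\<forall>a\<in>UNIV. (\<lambda>c. if hits F (rep c) then Some (piB F (rep c) j) else None) -` {a} \<inter> space \<eta> \<in> sets \<eta>)"
    proof (intro conjI ballI)
      fix a :: "'a option option"
      show "(\<lambda>c. if hits F (rep c) then Some (piB F (rep c) j) else None) -` {a} \<inter> space \<eta> \<in> sets \<eta>"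
      proof (cases a)
        case None
        have "Measurable.pred \<eta> (\<lambda>c. \<not> hits F (rep c))" using measurable_hits_rep[OF assms] by measurable
        then have "{c \<in> space \<eta>. \<not> hits F (rep c)} \<in> sets \<eta>" by (simp add: pred_def)
        also have "{c \<in> space \<eta>. \<not> hits F (rep c)}
          = (\<lambda>c. if hits F (rep c) then Some (piB F (rep c) j) else None) -` {a} \<inter> space \<eta>"
          using None by auto
        finally show ?thesis .
      next
        case (Some v)
        have "{c \<in> space \<eta>. hits F (rep c) \<and> piB F (rep c) j = v}
          = (\<lambda>c. if hits F (rep c) then Some (piB F (rep c) j) else None) -` {a} \<inter> space \<eta>"
          using Some by (auto split: if_splits)
        then show ?thesis using set[of v] by simp
      qed
    qed simp
  qed simp
qed

lemma cyl_sets: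
  assumes "finite F"
  shows "cyl F ys \<in> sets \<eta>"
proof -
  have p: "Measurable.pred \<eta> (\<lambda>c. (if hits F (rep c) then Some (piB F (rep c) i) else None) = Some (ys ! i))" for i
    using measurable_compose[OF measurable_piB_rep[OF assms, of i], of "\<lambda>u. u = Some (ys ! i)" "count_space UNIV"] by simp
  have "Measurable.pred \<eta> (\<lambda>c. hits F (rep c) \<and> (\<forall>i\<in>{..<length ys}. (if hits F (rep c) then Some (piB F (rep c) i) else None) = Some (ys ! i)))"
    by (intro pred_intros_logic measurable_hits_rep[OF assms] pred_intros_finite p) auto
  then have "{c \<in> space \<eta>. hits F (rep c) \<and> (\<forall>i\<in>{..<length ys}. (if hits F (rep c) then Some (piB F (rep c) i) else None) = Some (ys ! i))} \<in> sets \<eta>"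
    by (simp add: pred_def)
  also have "{c \<in> space \<eta>. hits F (rep c) \<and> (\<forall>i\<in>{..<length ys}. (if hits F (rep c) then Some (piB F (rep c) i) else None) = Some (ys ! i))} = cyl F ys"
    by (auto simp: cyl_def space_\<eta>)
  finally show ?thesis .
qed

lemma borel_measurable_piB:
  assumes "finite F"
  shows "(\<lambda>c. if hits F (rep c) then g (piB F (rep c) j) else (0 :: ennreal)) \<in> borel_measurable \<eta>"
proof -
  have "(\<lambda>c. (\<lambda>u. case u of None \<Rightarrow> 0 | Some v \<Rightarrow> g v) (if hits F (rep c) then Some (piB F (rep c) j) else None)) \<in> borel_measurable \<eta>"
    by (rule measurable_compose[OF measurable_piB_rep[OF assms]]) simp
  also have "(\<lambda>c. (\<lambda>u. case u of None \<Rightarrow> 0 | Some v \<Rightarrow> g v) (if hits F (rep c) then Some (piB F (rep c) j) else None))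
      = (\<lambda>c. if hits F (rep c) then g (piB F (rep c) j) else 0)"
    by auto
  finally show ?thesis .
qed

text \<open>The entrance factor depends only on \<open>hd ys\<close>, which appending does not
  change, so just one transition is added.\<close>

lemma emeasure_cyl_snoc:
  assumes "finite F" "ys \<noteq> []"
  shows "emeasure \<eta> (cyl F (ys @ [v])) = emeasure \<eta> (cyl F ys) * ph_opt d P B (last ys) v"
proof -
  have *: "emeasure \<eta> (cyl F ys) = (case hd ys of None \<Rightarrow> 0
                | Some x \<Rightarrow> emeasure \<eta> {c \<in> Dstar. hits F (rep c) \<and> Hent F (rep c) = x})
             * pathprob d P B ys" if "ys \<noteq> []" for ys
    unfolding cyl_def using quasi assms(1) that by (auto simp: quasi_process_def)
  show ?thesis using assms(2) by (simp add: * pathprob_snoc mult.assoc)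
qed

text \<open>Induction on the number n of further steps, for all cylinders at once: the next state v
  is appended and summed over. The index \<open>length ys - 1\<close> is the time of the last state
  that the cylinder prescribes.\<close>

lemma markov_property:
  assumes "finite F" "ys \<noteq> []"
  shows "(\<integral>\<^sup>+c. indicator (cyl F ys) c * lift0 \<phi> (piB F (rep c) (length ys - 1 + n)) \<partial>\<eta>)
    = emeasure \<eta> (cyl F ys) * chain_mean_opt n \<phi> (last ys)"
  using assms(2)
proof (induction n arbitrary: ys)
  case 0
  have "(\<integral>\<^sup>+c. indicator (cyl F ys) c * lift0 \<phi> (piB F (rep c) (length ys - 1 + 0)) \<partial>\<eta>)
      = (\<integral>\<^sup>+c. lift0 \<phi> (last ys) * indicator (cyl F ys) c \<partial>\<eta>)"
    by (intro nn_integral_cong) (use 0 in \<open>auto simp: indicator_def cyl_def last_conv_nth\<close>)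
  then show ?case using cyl_sets[OF assms(1)] by (simp add: nn_integral_cmult_indicator mult.commute)
next
  case (Suc n)
  let ?X = "\<lambda>c. lift0 \<phi> (piB F (rep c) (length ys + n))"
  have len: "length ys - 1 + Suc n = length ys + n" using Suc.prems by (cases ys) auto
  have meas: "(\<lambda>c. indicator (cyl F (ys @ [v])) c * ?X c) \<in> borel_measurable \<eta>" for v
  proof -
    have "(\<lambda>c. indicator (cyl F (ys @ [v])) c * (if hits F (rep c) then ?X c else 0)) \<in> borel_measurable \<eta>"
      using cyl_sets[OF assms(1)] borel_measurable_piB[OF assms(1)]
      by (intro borel_measurable_times_ennreal) auto
    also have "(\<lambda>c. indicator (cyl F (ys @ [v])) c * (if hits F (rep c) then ?X c else 0)) = (\<lambda>c. indicator (cyl F (ys @ [v])) c * ?X c)"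
      by (auto simp: cyl_def indicator_def)
    finally show ?thesis .
  qed
  have "(\<integral>\<^sup>+c. indicator (cyl F ys) c * lift0 \<phi> (piB F (rep c) (length ys - 1 + Suc n)) \<partial>\<eta>)
      = (\<integral>\<^sup>+c. (\<integral>\<^sup>+v. indicator (cyl F (ys @ [v])) c * ?X c \<partial>count_space UNIV) \<partial>\<eta>)"
  proof (rule nn_integral_cong)
    fix c
    have "indicator (cyl F ys) c * ?X c = (\<integral>\<^sup>+v. indicator (cyl F ys) c * ?X c * indicator {v} (piB F (rep c) (length ys)) \<partial>count_space UNIV)"
      by (rule nn_integral_count_space_delta[symmetric])
    also have "\<dots> = (\<integral>\<^sup>+v. indicator (cyl F (ys @ [v])) c * ?X c \<partial>count_space UNIV)"
      by (intro nn_integral_cong) (auto simp: indicator_def cyl_def nth_append less_Suc_eq)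
    finally show "indicator (cyl F ys) c * lift0 \<phi> (piB F (rep c) (length ys - 1 + Suc n))
      = (\<integral>\<^sup>+v. indicator (cyl F (ys @ [v])) c * ?X c \<partial>count_space UNIV)"
      unfolding len .
  qed
  also have "\<dots> = (\<integral>\<^sup>+v. (\<integral>\<^sup>+c. indicator (cyl F (ys @ [v])) c * ?X c \<partial>\<eta>) \<partial>count_space UNIV)"
    by (rule nn_integral_count_space_nn_integral) (auto intro: meas)
  also have "\<dots> = (\<integral>\<^sup>+v. emeasure \<eta> (cyl F ys) * (ph_opt d P B (last ys) v * chain_mean_opt n \<phi> v) \<partial>count_space UNIV)"
    using Suc.IH[of "ys @ [_]"] by (simp add: emeasure_cyl_snoc[OF assms(1) Suc.prems] mult.assoc)
  also have "\<dots> = emeasure \<eta> (cyl F ys) * chain_mean_opt (Suc n) \<phi> (last ys)"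
    by (simp add: nn_integral_cmult)
  finally show ?case .
qed

lemma hits_piB_0:
  assumes "finite F" "c \<in> Dstar" "hits F (rep c)"
  shows "piB F (rep c) 0 \<in> Some ` F"
  using first_entrance_fent[OF inD_rep[OF assms(2)] assms(1,3)] by (simp add: piB_def first_entrance_def)

definition entrance_sum :: "'a set \<Rightarrow> ('a \<Rightarrow> ennreal) \<Rightarrow> (int \<Rightarrow> 'a option) set \<Rightarrow> ennreal" where
  "entrance_sum F \<phi> c = (\<Sum>n. if hits F (rep c) then lift0 \<phi> (piB F (rep c) n) else 0)"

lemma indicator_hits_eq_sum:
  assumes "finite F" "c \<in> Dstar"
  shows "(\<Sum>x\<in>F. indicator (cyl F [Some x]) c * Z) = (if hits F (rep c) then Z else (0 :: ennreal))"
proof (cases "hits F (rep c)")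
  case True
  then obtain x where x: "x \<in> F" "piB F (rep c) 0 = Some x" using hits_piB_0[OF assms True] by auto
  have "(\<Sum>y\<in>F. indicator (cyl F [Some y]) c * Z) = (\<Sum>y\<in>F. if y = x then Z else 0)"
    by (intro sum.cong) (use x True assms in \<open>auto simp: indicator_def cyl_def\<close>)
  then show ?thesis using x True assms by simp
qed (simp add: cyl_def)

text \<open>Paths are sorted by their entrance state, from which on they follow the transformed
  chain.\<close>

lemma nn_integral_entrance_sum:
  assumes "finite F"
  shows "(\<integral>\<^sup>+c. entrance_sum F \<phi> c \<partial>\<eta>) = (\<Sum>x\<in>F. emeasure \<eta> (cyl F [Some x]) * (\<Sum>n. chain_mean n \<phi> x))"
proof -
  have meas: "(\<lambda>c. indicator (cyl F [Some x]) c * lift0 \<phi> (piB F (rep c) n)) \<in> borel_measurable \<eta>" for x n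
  proof -
    have "(\<lambda>c. indicator (cyl F [Some x]) c * (if hits F (rep c) then lift0 \<phi> (piB F (rep c) n) else 0)) \<in> borel_measurable \<eta>"
      using cyl_sets[OF assms(1)] borel_measurable_piB[OF assms(1)]
      by (intro borel_measurable_times_ennreal) auto
    also have "(\<lambda>c. indicator (cyl F [Some x]) c * (if hits F (rep c) then lift0 \<phi> (piB F (rep c) n) else 0))
        = (\<lambda>c. indicator (cyl F [Some x]) c * lift0 \<phi> (piB F (rep c) n))"
      by (auto simp: cyl_def indicator_def)
    finally show ?thesis .
  qed
  have one: "(\<integral>\<^sup>+c. (if hits F (rep c) then lift0 \<phi> (piB F (rep c) n) else 0) \<partial>\<eta>)
      = (\<Sum>x\<in>F. emeasure \<eta> (cyl F [Some x]) * chain_mean n \<phi> x)" for n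
  proof -
    have "(\<integral>\<^sup>+c. (if hits F (rep c) then lift0 \<phi> (piB F (rep c) n) else 0) \<partial>\<eta>)
        = (\<integral>\<^sup>+c. (\<Sum>x\<in>F. indicator (cyl F [Some x]) c * lift0 \<phi> (piB F (rep c) n)) \<partial>\<eta>)"
      by (intro nn_integral_cong) (simp add: indicator_hits_eq_sum[OF assms] space_\<eta>)
    also have "\<dots> = (\<Sum>x\<in>F. \<integral>\<^sup>+c. indicator (cyl F [Some x]) c * lift0 \<phi> (piB F (rep c) n) \<partial>\<eta>)"
      by (rule nn_integral_sum) (rule meas)
    also have "\<dots> = (\<Sum>x\<in>F. emeasure \<eta> (cyl F [Some x]) * chain_mean n \<phi> x)"
      using markov_property[OF assms, of "[Some _]" \<phi> n] by (simp add: chain_mean_opt_eq)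
    finally show ?thesis .
  qed
  have "(\<integral>\<^sup>+c. entrance_sum F \<phi> c \<partial>\<eta>) = (\<Sum>n. \<integral>\<^sup>+c. (if hits F (rep c) then lift0 \<phi> (piB F (rep c) n) else 0) \<partial>\<eta>)"
    unfolding entrance_sum_def by (rule nn_integral_suminf) (rule borel_measurable_piB[OF assms])
  also have "\<dots> = (\<Sum>x\<in>F. \<Sum>n. emeasure \<eta> (cyl F [Some x]) * chain_mean n \<phi> x)"
    unfolding one by (rule suminf_sum) (rule summableI)
  finally show ?thesis by (simp add: ennreal_suminf_cmult)
qed

lemma sum_cyl_eq_hits:
  assumes "finite F"
  shows "(\<Sum>x\<in>F. emeasure \<eta> (cyl F [Some x])) = emeasure \<eta> {c \<in> Dstar. hits F (rep c)}"
proof -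
  have h: "{c \<in> Dstar. hits F (rep c)} \<in> sets \<eta>"
    using measurable_hits_rep[OF assms] by (simp add: pred_def space_\<eta>)
  have "(\<Sum>x\<in>F. emeasure \<eta> (cyl F [Some x])) = (\<Sum>x\<in>F. \<integral>\<^sup>+c. indicator (cyl F [Some x]) c * 1 \<partial>\<eta>)"
    using cyl_sets[OF assms] by simp
  also have "\<dots> = (\<integral>\<^sup>+c. (\<Sum>x\<in>F. indicator (cyl F [Some x]) c * 1) \<partial>\<eta>)"
    using cyl_sets[OF assms] by (intro nn_integral_sum[symmetric]) simp
  also have "\<dots> = (\<integral>\<^sup>+c. indicator {c \<in> Dstar. hits F (rep c)} c \<partial>\<eta>)"
    by (intro nn_integral_cong, subst indicator_hits_eq_sum[OF assms]) (auto simp: space_\<eta> indicator_def)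
  finally show ?thesis using h by simp
qed

section \<open>Sums along whole paths\<close>

definition path_sum :: "('a \<Rightarrow> ennreal) \<Rightarrow> (int \<Rightarrow> 'a option) \<Rightarrow> ennreal" where
  "path_sum \<phi> w = (\<integral>\<^sup>+k. lift0 \<phi> (w k) \<partial>count_space UNIV)"

text \<open>This form is free of the entrance time: k counts as soon as F has been visited up to
  time k. Monotonicity in F and the limit of growing F can be read off.\<close>

lemma entrance_sum_eq:
  assumes "finite F" "c \<in> Dstar"
  shows "entrance_sum F \<phi> c = (\<integral>\<^sup>+k. (if \<exists>m\<le>k. rep c m \<in> Some ` F then lift0 \<phi> (rep c k) else 0) \<partial>count_space UNIV)"
proof (cases "hits F (rep c)")
  case True
  define t where "t = fent F (rep c)"
  have t: "first_entrance F (rep c) t"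
    unfolding t_def using first_entrance_fent[OF inD_rep] assms True by blast
  then have iff: "(\<exists>m\<le>k. rep c m \<in> Some ` F) \<longleftrightarrow> t \<le> k" for k
    unfolding first_entrance_def by (meson le_less_trans not_le order_trans)
  have "bij_betw (\<lambda>n. t + int n) UNIV {t..}"
    by (rule bij_betw_byWitness[where f'="\<lambda>k. nat (k - t)"]) auto
  then have "(\<integral>\<^sup>+n. lift0 \<phi> (rep c (t + int n)) \<partial>count_space UNIV) = (\<integral>\<^sup>+k. lift0 \<phi> (rep c k) \<partial>count_space {t..})"
    by (rule nn_integral_bij_count_space[where f="\<lambda>k. lift0 \<phi> (rep c k)"])
  also have "\<dots> = (\<integral>\<^sup>+k. lift0 \<phi> (rep c k) * indicator {t..} k \<partial>count_space UNIV)"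
    by (subst nn_integral_count_space_indicator) simp_all
  also have "\<dots> = (\<integral>\<^sup>+k. (if \<exists>m\<le>k. rep c m \<in> Some ` F then lift0 \<phi> (rep c k) else 0) \<partial>count_space UNIV)"
    unfolding iff by (intro nn_integral_cong) auto
  finally show ?thesis using True
    by (simp add: entrance_sum_def nn_integral_count_space_nat piB_def t_def)
next
  case False
  then show ?thesis by (auto simp: entrance_sum_def hits_def)
qed

lemma entrance_sum_mono:
  assumes "F \<subseteq> F'" "finite F'" "c \<in> Dstar"
  shows "entrance_sum F \<phi> c \<le> entrance_sum F' \<phi> c"
proof -
  have "finite F" using assms finite_subset by blast
  show ?thesis
    unfolding entrance_sum_eq[OF \<open>finite F\<close> assms(3)] entrance_sum_eq[OF assms(2,3)]
    by (intro nn_integral_mono) (simp, use assms(1) in blast)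
qed

lemma entrance_sum_le_path_sum:
  assumes "finite F" "c \<in> Dstar"
  shows "entrance_sum F \<phi> c \<le> path_sum \<phi> (rep c)"
  unfolding entrance_sum_eq[OF assms] path_sum_def by (intro nn_integral_mono) simp

text \<open>No visit to B precedes the first entrance into B, so no term is lost.\<close>

lemma path_sum_B_eq_entrance_sum:
  assumes "c \<in> Dstar"
  shows "path_sum (indicator B) (rep c) = entrance_sum B (indicator B) c"
  unfolding entrance_sum_eq[OF finite_B assms] path_sum_def
  by (intro nn_integral_cong) (auto simp: lift0_def indicator_def split: option.splits)

lemma path_sum_eq_SUP:
  assumes "c \<in> Dstar"
  shows "path_sum \<phi> (rep c) = (SUP N::nat. entrance_sum {x. to_nat x < N} \<phi> c)"
proof -
  note fin = finite_to_nat_less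
  let ?g = "\<lambda>(N::nat) k. if \<exists>m\<le>k. rep c m \<in> Some ` {x. to_nat x < N} then lift0 \<phi> (rep c k) else 0"
  have "lift0 \<phi> (rep c k) = (SUP N. ?g N k)" for k
  proof (rule antisym)
    show "(SUP N. ?g N k) \<le> lift0 \<phi> (rep c k)" by (intro SUP_least) simp
    show "lift0 \<phi> (rep c k) \<le> (SUP N. ?g N k)"
    proof (cases "rep c k")
      case (Some y)
      have "\<exists>m\<le>k. rep c m \<in> Some ` {x. to_nat x < Suc (to_nat y)}"
        using Some by (intro exI[of _ k]) auto
      then have "lift0 \<phi> (rep c k) \<le> ?g (Suc (to_nat y)) k" by simp
      then show ?thesis by (rule SUP_upper2[OF UNIV_I])
    qed simp
  qed
  then have "path_sum \<phi> (rep c) = (\<integral>\<^sup>+k. (SUP N. ?g N k) \<partial>count_space UNIV)"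
    by (simp add: path_sum_def)
  also have "\<dots> = (SUP N. \<integral>\<^sup>+k. ?g N k \<partial>count_space UNIV)"
  proof (rule nn_integral_monotone_convergence_SUP)
    show "incseq ?g"
    proof (intro monoI le_funI)
      fix M N :: nat and k assume "M \<le> N"
      then have "Some ` {x :: 'a. to_nat x < M} \<subseteq> Some ` {x. to_nat x < N}" by auto
      then show "?g M k \<le> ?g N k" by (simp, blast)
    qed
  qed simp
  finally show ?thesis by (simp add: entrance_sum_eq[OF fin assms])
qed

text \<open>Both masses are expected numbers of visits to B, since one visit is expected from each
  entrance on. Counting from the entrance into F may miss visits, whereas counting from the entrance
  into B misses none.\<close>

lemma emeasure_hits_le:
  assumes "finite F"
  shows "emeasure \<eta> {c \<in> Dstar. hits F (rep c)} \<le> emeasure \<eta> {c \<in> Dstar. hits B (rep c)}"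
proof -
  have eq: "emeasure \<eta> {c \<in> Dstar. hits F (rep c)} = (\<integral>\<^sup>+c. entrance_sum F (indicator B) c \<partial>\<eta>)" if "finite F" for F
    using that by (simp add: nn_integral_entrance_sum sum_chain_mean_B sum_cyl_eq_hits)
  show ?thesis
    unfolding eq[OF assms] eq[OF finite_B]
    by (intro nn_integral_mono)
       (simp add: space_\<eta> path_sum_B_eq_entrance_sum[symmetric] entrance_sum_le_path_sum[OF assms])
qed

lemma borel_measurable_path_sum: "(\<lambda>c. path_sum \<phi> (rep c)) \<in> borel_measurable \<eta>"
proof (rule measurable_shift_invariant[OF space_\<eta> sets_\<eta>])
  show "path_sum \<phi> \<in> borel_measurable discrete_prod"
    unfolding path_sum_def
    by (rule borel_measurable_nn_integral_count_space) (rule measurable_fun_coordinate, simp)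
  show "path_sum \<phi> (\<lambda>n. w (n + k)) = path_sum \<phi> w" for w k
  proof -
    have "bij_betw (\<lambda>n. n + k) UNIV UNIV"
      by (rule bij_betw_byWitness[where f'="\<lambda>n. n - k"]) auto
    from nn_integral_bij_count_space[OF this, of "\<lambda>n. lift0 \<phi> (w n)"] show ?thesis
      by (simp add: path_sum_def)
  qed
qed

lemma nn_integral_path_sum_le:
  assumes K: "\<And>x. (\<Sum>n. chain_mean n \<phi> x) \<le> K"
  shows "(\<integral>\<^sup>+c. path_sum \<phi> (rep c) \<partial>\<eta>) \<le> K * emeasure \<eta> {c \<in> Dstar. hits B (rep c)}"
proof -
  note fin = finite_to_nat_less
  have le: "(\<integral>\<^sup>+c. entrance_sum F \<phi> c \<partial>\<eta>) \<le> K * emeasure \<eta> {c \<in> Dstar. hits B (rep c)}" if "finite F" for F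
  proof -
    have "(\<integral>\<^sup>+c. entrance_sum F \<phi> c \<partial>\<eta>) \<le> (\<Sum>x\<in>F. emeasure \<eta> (cyl F [Some x]) * K)"
      unfolding nn_integral_entrance_sum[OF that] by (intro sum_mono mult_left_mono K) simp
    also have "\<dots> = K * emeasure \<eta> {c \<in> Dstar. hits F (rep c)}"
      by (subst sum_distrib_right[symmetric]) (simp add: sum_cyl_eq_hits[OF that] mult.commute)
    also have "\<dots> \<le> K * emeasure \<eta> {c \<in> Dstar. hits B (rep c)}"
      by (intro mult_left_mono emeasure_hits_le that) simp
    finally show ?thesis .
  qed
  have "(\<integral>\<^sup>+c. path_sum \<phi> (rep c) \<partial>\<eta>) = (\<integral>\<^sup>+c. (SUP N::nat. entrance_sum {x. to_nat x < N} \<phi> c) \<partial>\<eta>)"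
    by (intro nn_integral_cong) (simp add: space_\<eta> path_sum_eq_SUP)
  \<comment> \<open>Monotonicity in N is known for classes in \<open>Dstar\<close>; the indicator
    extends it to the whole type, as monotone convergence demands.\<close>
  also have "\<dots> = (\<integral>\<^sup>+c. (SUP N::nat. entrance_sum {x. to_nat x < N} \<phi> c * indicator Dstar c) \<partial>\<eta>)"
    by (intro nn_integral_cong) (simp add: space_\<eta>)
  also have "\<dots> = (SUP N::nat. \<integral>\<^sup>+c. entrance_sum {x. to_nat x < N} \<phi> c * indicator Dstar c \<partial>\<eta>)"
  proof (rule nn_integral_monotone_convergence_SUP)
    show "incseq (\<lambda>N c. entrance_sum {x. to_nat x < N} \<phi> c * indicator Dstar c)"
    proof (intro monoI le_funI)
      fix M N :: nat and c assume "M \<le> N"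
      then show "entrance_sum {x. to_nat x < M} \<phi> c * indicator Dstar c
          \<le> entrance_sum {x. to_nat x < N} \<phi> c * indicator Dstar c"
        by (cases "c \<in> Dstar") (auto intro!: entrance_sum_mono[OF _ fin])
    qed
    show "(\<lambda>c. entrance_sum {x. to_nat x < N} \<phi> c * indicator Dstar c) \<in> borel_measurable \<eta>" for N
    proof -
      have "entrance_sum {x. to_nat x < N} \<phi> \<in> borel_measurable \<eta>"
        unfolding entrance_sum_def by (intro borel_measurable_suminf_order borel_measurable_piB fin)
      moreover have "Dstar \<in> sets \<eta>" using sets.top[of \<eta>] by (simp add: space_\<eta>)
      ultimately show ?thesis by (intro borel_measurable_times_ennreal) auto
    qed
  qed
  also have "\<dots> = (SUP N::nat. \<integral>\<^sup>+c. entrance_sum {x. to_nat x < N} \<phi> c \<partial>\<eta>)"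
    by (intro SUP_cong refl nn_integral_cong) (simp add: space_\<eta>)
  also have "\<dots> \<le> K * emeasure \<eta> {c \<in> Dstar. hits B (rep c)}"
    by (intro SUP_least le fin)
  finally show ?thesis .
qed

lemma AE_path_sum_finite:
  assumes K: "\<And>x. (\<Sum>n. chain_mean n \<phi> x) \<le> K" and "K < \<top>"
  shows "AE c in \<eta>. path_sum \<phi> (rep c) < \<top>"
proof -
  have "emeasure \<eta> {c \<in> Dstar. hits B (rep c)} < \<top>"
    using quasi finite_B by (simp add: quasi_process_def)
  with nn_integral_path_sum_le[OF K] \<open>K < \<top>\<close>
  have "(\<integral>\<^sup>+c. path_sum \<phi> (rep c) \<partial>\<eta>) \<noteq> \<top>"
    by (auto simp: top_unique ennreal_mult_eq_top_iff)
  from nn_integral_PInf_AE[OF borel_measurable_path_sum, of \<phi>] this show ?thesis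
    by (simp add: less_top)
qed

end

section \<open>Decorations\<close>

text \<open>\<open>\<phi> z v\<close> is the expected contribution of a spine individual at v to the
  count at z: itself and the trees it carries. An individual in B is also the root of its own tree,
  so it is counted twice at its location; finiteness is unaffected.\<close>

lemma (in norming_bmc) visit_weight_bound:
  assumes C: "Cconst d P B < \<top>"
  defines "\<phi> \<equiv> \<lambda>z v. indicator {z} v + (if v \<in> B then green d P v z
      else barm d v * (\<integral>\<^sup>+y. green d P y z \<partial>measure_pmf (P v)))"
  obtains K where "K < \<top>" "\<And>x. (\<Sum>n. chain_mean n (\<phi> z) x) \<le> K"
proof -
  have "\<exists>c. \<forall>z. c z < \<top> \<and> (\<forall>v. green d P v z \<le> c z * h v)"
    by (rule choice) (metis green_le_const_h)
  then obtain c where c: "\<And>z. c z < \<top>" "\<And>z v. green d P v z \<le> c z * h v" by blast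
  \<comment> \<open>The three terms bound the three parts of the weight: visits of the spine to z,
    trees attached off B, and trees rooted in B.\<close>
  define K where "K = c z * h z + (c z * Cconst d P B + (\<Sum>b\<in>B. c b * green d P b z))"
  show ?thesis
  proof (rule that)
    show "K < \<top>"
      unfolding K_def using c(1) C h_finite green_finite
      by (auto simp: ennreal_mult_less_top finite_B less_top[symmetric] ennreal_mult_eq_top_iff)
    fix x
    have weight: "\<phi> z v * h v \<le> indicator {z} v * h z + (c z * pair_weight v + indicator B v * green d P v z)" for v
    proof (cases "v \<in> B")
      case True
      then have "h v = 1" by (subst h_eq) simp
      then show ?thesis using True
        by (auto simp: \<phi>_def distrib_right indicator_def pair_weight_def)
    next
      case False
      have m: "mean d v \<noteq> 0" "mean d v \<noteq> \<top>"
        using mean_pos[OF False] mean_finite[of v] by auto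
      define I where "I = (\<integral>\<^sup>+y. green d P y z \<partial>measure_pmf (P v))"
      \<comment> \<open>By the one-step equation, m I is at most g(v, z). Dividing by m supplies
        both the denominator and one of the two factors h in \<open>pair_weight\<close>; the other
        factor h comes from undoing the transform.\<close>
      have "mean d v * I \<le> c z * h v"
        using c(2)[of v z] by (subst (asm) green_step) (auto simp: nn_integral_qmat I_def intro: order_trans[rotated])
      then have "mean d v * I / mean d v \<le> c z * h v / mean d v"
        by (rule divide_right_mono_ennreal)
      then have I: "I \<le> c z * h v / mean d v"
        using m by (simp add: mult.commute[of _ I] ennreal_mult_divide_eq)
      have "barm d v * I * h v \<le> barm d v * (c z * h v / mean d v) * h v"
        by (intro mult_right_mono mult_left_mono I) auto
      also have "\<dots> = c z * pair_weight v"
        using False by (simp add: pair_weight_def divide_ennreal_def power2_eq_square mult_ac)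
      finally show ?thesis using False
        by (auto simp: \<phi>_def distrib_right indicator_def I_def[symmetric])
    qed
    have "potential d P (\<lambda>v. \<phi> z v * h v) x
        \<le> (\<integral>\<^sup>+v. green d P x v * (indicator {z} v * h z + (c z * pair_weight v + indicator B v * green d P v z)) \<partial>count_space UNIV)"
      unfolding potential_def by (intro nn_integral_mono mult_left_mono weight) simp
    also have "\<dots> = (\<integral>\<^sup>+v. green d P x v * h z * indicator {z} v + (c z * (green d P x v * pair_weight v)
          + green d P x v * green d P v z * indicator B v) \<partial>count_space UNIV)"
      by (intro nn_integral_cong) (simp add: algebra_simps)
    also have "\<dots> = green d P x z * h z + (c z * potential d P pair_weight x + (\<Sum>b\<in>B. green d P x b * green d P b z))"
      using nn_integral_indicator_finite[OF finite_B, of "count_space UNIV" "\<lambda>v. green d P x v * green d P v z"]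
      by (simp add: nn_integral_add nn_integral_cmult potential_def nn_integral_indicator_singleton')
    also have "\<dots> \<le> c z * h x * h z + (c z * (Cconst d P B * h x) + (\<Sum>b\<in>B. c b * h x * green d P b z))"
      by (intro add_mono mult_right_mono mult_left_mono sum_mono c potential_pair_weight_le) auto
    also have "\<dots> = K * h x"
      by (simp add: K_def distrib_left distrib_right sum_distrib_left sum_distrib_right mult_ac)
    finally have "(\<Sum>n. chain_mean n (\<phi> z) x) * h x \<le> K * h x"
      using sum_chain_mean_le_potential[of "\<phi> z" x] by (rule order_trans[rotated])
    then have "(\<Sum>n. chain_mean n (\<phi> z) x) * h x / h x \<le> K * h x / h x"
      by (rule divide_right_mono_ennreal)
    then show "(\<Sum>n. chain_mean n (\<phi> z) x) \<le> K"
      using h_pos[of x] h_finite[of x]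
      by (simp add: ennreal_mult_divide_eq zero_less_iff_neq_zero less_top[symmetric])
  qed
qed

section \<open>Expected number of individuals in a decoration\<close>

lemma nn_integral_pair_prob_space:
  assumes "prob_space N" "f \<in> borel_measurable (M \<Otimes>\<^sub>M N)"
  shows "(\<integral>\<^sup>+p. f p \<partial>(M \<Otimes>\<^sub>M N)) = (\<integral>\<^sup>+x. \<integral>\<^sup>+y. f (x, y) \<partial>N \<partial>M)"
proof -
  interpret prob_space N by fact
  show ?thesis using nn_integral_fst[OF assms(2)] by simp
qed

lemma deco_meas_eq:
  "deco_meas d P B w =
     pmf_prod (\<lambda>k. case w k of Some z \<Rightarrow> (if z \<notin> B then dsb d z else return_pmf 1) | None \<Rightarrow> return_pmf 1)
     \<Otimes>\<^sub>M (pmf_prod (\<lambda>(k, j). case w k of Some z \<Rightarrow> P z | None \<Rightarrow> return_pmf undefined)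
     \<Otimes>\<^sub>M pmf_prod (\<lambda>(k, j, ws, z). pair_pmf (d z) (P z)))"
  unfolding deco_meas_def pmf_prod_def by (simp add: case_prod_unfold)

text \<open>For fixed k and j, the coordinates (k, j, .) have the law of the randomness of a single
  branching Markov chain.\<close>

lemma expectation_subtree_copy:
  fixes d :: "'a::countable \<Rightarrow> nat pmf"
  shows "(\<integral>\<^sup>+R. bmc_count y (\<lambda>p. R (k, j, p)) z \<partial>pmf_prod (\<lambda>(k :: int, j :: nat, ws, z). pair_pmf (d z) (P z))) = green d P y z"
proof -
  have "(\<integral>\<^sup>+R. bmc_count y (\<lambda>p. R (k, j, p)) z \<partial>pmf_prod (\<lambda>(k :: int, j :: nat, ws, z). pair_pmf (d z) (P z)))
      = (\<integral>\<^sup>+\<omega>. bmc_count y \<omega> z \<partial>pmf_prod (\<lambda>(ws, z). pair_pmf (d z) (P z)))"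
    by (rule nn_integral_pmf_prod_reindex[where t="\<lambda>p. (k, j, p)" and f="\<lambda>\<omega>. bmc_count y \<omega> z"])
       (auto simp: inj_on_def measurable_bmc_count)
  then show ?thesis by (simp add: bmc_rand_eq_pmf_prod[symmetric] expectation_bmc_count)
qed

definition deco_term :: "'a set \<Rightarrow> (int \<Rightarrow> 'a option) \<Rightarrow> 'a \<Rightarrow> int \<Rightarrow> nat
    \<Rightarrow> ((int \<Rightarrow> nat) \<times> (int \<times> nat \<Rightarrow> 'a) \<times> (int \<times> nat \<times> nat list \<times> 'a \<Rightarrow> nat \<times> 'a)) \<Rightarrow> ennreal" where
  "deco_term B w z k j = (\<lambda>(K, Y, R). case w k of
            Some v \<Rightarrow> (if v \<notin> B
                        then (if j < K k - 1 then bmc_count (Y (k, j)) (\<lambda>p. R (k, j, p)) z else 0)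
                        else (if j = 0 then bmc_count v (\<lambda>p. R (k, 0, p)) z else 0))
          | None \<Rightarrow> 0)"

lemma deco_count_eq:
  "deco_count B w \<omega> z = (\<integral>\<^sup>+ k. indicator {k. w k = Some z} k \<partial>count_space UNIV)
     + (\<integral>\<^sup>+ k. (\<integral>\<^sup>+ j. deco_term B w z k j \<omega> \<partial>count_space UNIV) \<partial>count_space UNIV)"
  by (cases \<omega>) (simp add: deco_count_def deco_term_def)

lemma measurable_deco_term:
  fixes w :: "int \<Rightarrow> 'a::countable option"
  shows "deco_term B w z k j \<in> borel_measurable (deco_meas d P B w)"
proof -
  let ?M = "deco_meas d P B w"
  have K: "fst \<in> measurable ?M discrete_prod" and Y: "(\<lambda>\<omega>. fst (snd \<omega>)) \<in> measurable ?M discrete_prod"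
    and R: "(\<lambda>\<omega>. snd (snd \<omega>)) \<in> measurable ?M discrete_prod"
    unfolding deco_meas_eq
    by (simp_all cong: measurable_cong_sets add: sets_pmf_prod[symmetric, of undefined])
  have sub: "(\<lambda>\<omega> p. snd (snd \<omega>) (k, i, p)) \<in> measurable ?M discrete_prod" for i
    by (rule measurable_into_discrete_prod) (rule measurable_compose[OF R measurable_coordinate])
  have pos: "(\<lambda>\<omega>. fst (snd \<omega>) (k, j)) \<in> measurable ?M (count_space UNIV)"
    by (rule measurable_compose[OF Y measurable_coordinate])
  have num: "Measurable.pred ?M (\<lambda>\<omega>. j < fst \<omega> k - 1)"
    by (rule measurable_compose[OF K measurable_fun_coordinate]) simp
  have off: "(\<lambda>\<omega>. bmc_count (fst (snd \<omega>) (k, j)) (\<lambda>p. snd (snd \<omega>) (k, j, p)) z) \<in> borel_measurable ?M"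
    by (rule measurable_random_root[where F="\<lambda>y \<omega>. bmc_count y \<omega> z", OF measurable_bmc_count sub pos])
  have on: "(\<lambda>\<omega>. bmc_count v (\<lambda>p. snd (snd \<omega>) (k, 0, p)) z) \<in> borel_measurable ?M" for v
    by (rule measurable_compose[OF sub measurable_bmc_count])
  show ?thesis
    unfolding deco_term_def case_prod_unfold
    by (cases "w k") (auto intro!: measurable_If off on simp: num[unfolded pred_def, simplified])
qed

text \<open>The tree below extra child j is integrated first and gives g at its root; number and
  location of the extra children are independent. The subtraction \<open>n - 1\<close> leaves out
  the child that continues the spine.\<close>

lemma expectation_deco_term:
  fixes w :: "int \<Rightarrow> 'a::countable option"
  shows "(\<integral>\<^sup>+\<omega>. deco_term B w z k j \<omega> \<partial>deco_meas d P B w) = (case w k of None \<Rightarrow> 0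
    | Some v \<Rightarrow> if v \<in> B then (if j = 0 then green d P v z else 0)
        else (\<integral>\<^sup>+n. indicator {j<..} (n - 1) \<partial>measure_pmf (dsb d v)) * (\<integral>\<^sup>+y. green d P y z \<partial>measure_pmf (P v)))"
proof -
  define \<kappa> where "\<kappa> = (\<lambda>k. case w k of Some z \<Rightarrow> (if z \<notin> B then dsb d z else return_pmf 1) | None \<Rightarrow> return_pmf 1)"
  define \<pi> where "\<pi> = (\<lambda>(k, j :: nat). case w k of Some z \<Rightarrow> P z | None \<Rightarrow> return_pmf undefined)"
  define \<rho> where "\<rho> = (\<lambda>(k :: int, j :: nat, ws :: nat list, z). pair_pmf (d z) (P z))"
  have eq: "deco_meas d P B w = pmf_prod \<kappa> \<Otimes>\<^sub>M (pmf_prod \<pi> \<Otimes>\<^sub>M pmf_prod \<rho>)"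
    unfolding deco_meas_eq \<kappa>_def \<pi>_def \<rho>_def ..
  interpret K: prob_space "pmf_prod \<kappa>" by (rule prob_space_pmf_prod)
  interpret Y: prob_space "pmf_prod \<pi>" by (rule prob_space_pmf_prod)
  interpret R: prob_space "pmf_prod \<rho>" by (rule prob_space_pmf_prod)
  interpret YR: pair_prob_space "pmf_prod \<pi>" "pmf_prod \<rho>" ..
  note copy = expectation_subtree_copy[where d=d and P=P, folded \<rho>_def]
  have m: "deco_term B w z k j \<in> borel_measurable (pmf_prod \<kappa> \<Otimes>\<^sub>M (pmf_prod \<pi> \<Otimes>\<^sub>M pmf_prod \<rho>))"
    using measurable_deco_term[of B w z k j d P] unfolding eq .
  have "(\<integral>\<^sup>+\<omega>. deco_term B w z k j \<omega> \<partial>deco_meas d P B w)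
      = (\<integral>\<^sup>+K. (\<integral>\<^sup>+YR. deco_term B w z k j (K, YR) \<partial>(pmf_prod \<pi> \<Otimes>\<^sub>M pmf_prod \<rho>)) \<partial>pmf_prod \<kappa>)"
    unfolding eq by (rule nn_integral_pair_prob_space[OF YR.prob_space_axioms m])
  also have "\<dots> = (\<integral>\<^sup>+K. (\<integral>\<^sup>+Y. (\<integral>\<^sup>+R. deco_term B w z k j (K, Y, R) \<partial>pmf_prod \<rho>) \<partial>pmf_prod \<pi>) \<partial>pmf_prod \<kappa>)"
    by (intro nn_integral_cong nn_integral_pair_prob_space R.prob_space_axioms measurable_Pair2[OF m]) simp
  finally have fub: "(\<integral>\<^sup>+\<omega>. deco_term B w z k j \<omega> \<partial>deco_meas d P B w) = \<dots>" .
  show ?thesis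
  proof (cases "w k")
    case None
    then show ?thesis unfolding fub by (simp add: deco_term_def)
  next
    case (Some v)
    show ?thesis
    proof (cases "v \<in> B")
      case True
      then show ?thesis
        unfolding fub using Some by (auto simp: deco_term_def copy K.emeasure_space_1[simplified] Y.emeasure_space_1[simplified])
    next
      case False
      have meas_Y: "(\<lambda>Y. green d P (Y (k, j)) z) \<in> borel_measurable (pmf_prod \<pi>)"
        unfolding measurable_pmf_prod_iff
        by (rule measurable_fun_coordinate[of "\<lambda>y. green d P y z"]) simp
      have meas_K: "(\<lambda>K. indicator {j<..} (K k - 1) :: ennreal) \<in> borel_measurable (pmf_prod \<kappa>)"
        unfolding measurable_pmf_prod_iff
        by (rule measurable_fun_coordinate[of "\<lambda>n. indicator {j<..} (n - 1)"]) simp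
      have "(\<integral>\<^sup>+R. deco_term B w z k j (K, Y, R) \<partial>pmf_prod \<rho>)
          = indicator {j<..} (K k - 1) * green d P (Y (k, j)) z" for K Y
        using Some False by (auto simp: deco_term_def copy indicator_def)
      then have "(\<integral>\<^sup>+\<omega>. deco_term B w z k j \<omega> \<partial>deco_meas d P B w)
          = (\<integral>\<^sup>+K. (\<integral>\<^sup>+Y. indicator {j<..} (K k - 1) * green d P (Y (k, j)) z \<partial>pmf_prod \<pi>) \<partial>pmf_prod \<kappa>)"
        by (simp add: fub)
      also have "\<dots> = (\<integral>\<^sup>+K. indicator {j<..} (K k - 1) * (\<integral>\<^sup>+Y. green d P (Y (k, j)) z \<partial>pmf_prod \<pi>) \<partial>pmf_prod \<kappa>)"
        by (intro nn_integral_cong nn_integral_cmult meas_Y)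
      also have "\<dots> = (\<integral>\<^sup>+K. indicator {j<..} (K k - 1) \<partial>pmf_prod \<kappa>) * (\<integral>\<^sup>+Y. green d P (Y (k, j)) z \<partial>pmf_prod \<pi>)"
        by (rule nn_integral_multc[OF meas_K])
      also have "(\<integral>\<^sup>+K. indicator {j<..} (K k - 1) \<partial>pmf_prod \<kappa>) = (\<integral>\<^sup>+n. indicator {j<..} (n - 1) \<partial>measure_pmf (dsb d v))"
        using nn_integral_pmf_prod_component[where f="\<lambda>n. indicator {j<..} (n - 1)" and i=k and \<mu>=\<kappa>] Some False
        by (simp add: \<kappa>_def)
      also have "(\<integral>\<^sup>+Y. green d P (Y (k, j)) z \<partial>pmf_prod \<pi>) = (\<integral>\<^sup>+y. green d P y z \<partial>measure_pmf (P v))"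
        using nn_integral_pmf_prod_component[where f="\<lambda>y. green d P y z" and i="(k, j)" and \<mu>=\<pi>] Some
        by (simp add: \<pi>_def)
      finally show ?thesis using Some False by simp
    qed
  qed
qed

text \<open>Tail-sum formula for n - 1. At n = 0 natural subtraction and \<open>ennreal\<close> of a
  negative number both give 0, so the two truncations agree.\<close>

lemma barm_eq_sum:
  "(\<integral>\<^sup>+j. (\<integral>\<^sup>+n. indicator {j<..} (n - 1) \<partial>measure_pmf (dsb d v)) \<partial>count_space UNIV) = barm d v"
proof -
  have "(\<integral>\<^sup>+j. (\<integral>\<^sup>+n. indicator {j<..} (n - 1) \<partial>measure_pmf (dsb d v)) \<partial>count_space UNIV)
      = (\<integral>\<^sup>+j. (\<integral>\<^sup>+n. indicator {j<..} n \<partial>measure_pmf (map_pmf (\<lambda>n. n - 1) (dsb d v))) \<partial>count_space UNIV)"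
    unfolding nn_integral_map_pmf ..
  also have "\<dots> = (\<integral>\<^sup>+n. ennreal (real n) \<partial>measure_pmf (map_pmf (\<lambda>n. n - 1) (dsb d v)))"
    by (rule nn_integral_greater_sum)
  also have "\<dots> = (\<integral>\<^sup>+n. ennreal (real (n - 1)) \<partial>measure_pmf (dsb d v))"
    unfolding nn_integral_map_pmf ..
  also have "\<dots> = barm d v"
    unfolding barm_def by (intro nn_integral_cong, rename_tac n, case_tac n) (auto simp: ennreal_neg)
  finally show ?thesis .
qed

lemma measurable_deco_count:
  fixes w :: "int \<Rightarrow> 'a::countable option"
  shows "(\<lambda>\<omega>. deco_count B w \<omega> z) \<in> borel_measurable (deco_meas d P B w)"
  unfolding deco_count_eq
  by (intro borel_measurable_add borel_measurable_const borel_measurable_nn_integral_count_space measurable_deco_term)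

text \<open>By linearity the expected decoration is the sum of a fixed weight along the spine, the
  kind of functional that is controlled for quasi-processes.\<close>

lemma expectation_deco_count:
  fixes w :: "int \<Rightarrow> 'a::countable option"
  shows "(\<integral>\<^sup>+\<omega>. deco_count B w \<omega> z \<partial>deco_meas d P B w) =
    (\<integral>\<^sup>+k. lift0 (\<lambda>v. indicator {z} v + (if v \<in> B then green d P v z
      else barm d v * (\<integral>\<^sup>+y. green d P y z \<partial>measure_pmf (P v)))) (w k) \<partial>count_space UNIV)"
proof -
  let ?M = "deco_meas d P B w"
  have "prob_space ?M"
    unfolding deco_meas_eq by (intro prob_space_pair prob_space_pmf_prod)
  then interpret prob_space ?M .
  have "(\<integral>\<^sup>+\<omega>. deco_count B w \<omega> z \<partial>?M) = (\<integral>\<^sup>+ k. indicator {k. w k = Some z} k \<partial>count_space UNIV)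
     + (\<integral>\<^sup>+ k. (\<integral>\<^sup>+ j. (\<integral>\<^sup>+\<omega>. deco_term B w z k j \<omega> \<partial>?M) \<partial>count_space UNIV) \<partial>count_space UNIV)"
  proof -
    have inner: "(\<lambda>\<omega>. \<integral>\<^sup>+ j. deco_term B w z k j \<omega> \<partial>count_space UNIV) \<in> borel_measurable ?M" for k
      by (intro borel_measurable_nn_integral_count_space measurable_deco_term)
    have "(\<integral>\<^sup>+\<omega>. deco_count B w \<omega> z \<partial>?M) = (\<integral>\<^sup>+\<omega>. (\<integral>\<^sup>+ k. indicator {k. w k = Some z} k \<partial>count_space UNIV) \<partial>?M)
       + (\<integral>\<^sup>+\<omega>. (\<integral>\<^sup>+ k. (\<integral>\<^sup>+ j. deco_term B w z k j \<omega> \<partial>count_space UNIV) \<partial>count_space UNIV) \<partial>?M)"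
      unfolding deco_count_eq
      by (intro nn_integral_add borel_measurable_const borel_measurable_nn_integral_count_space inner)
    also have "(\<integral>\<^sup>+\<omega>. (\<integral>\<^sup>+ k. (\<integral>\<^sup>+ j. deco_term B w z k j \<omega> \<partial>count_space UNIV) \<partial>count_space UNIV) \<partial>?M)
      = (\<integral>\<^sup>+ k. (\<integral>\<^sup>+\<omega>. (\<integral>\<^sup>+ j. deco_term B w z k j \<omega> \<partial>count_space UNIV) \<partial>?M) \<partial>count_space UNIV)"
      by (intro nn_integral_count_space_nn_integral inner countableI_type)
    also have "\<dots> = (\<integral>\<^sup>+ k. (\<integral>\<^sup>+ j. (\<integral>\<^sup>+\<omega>. deco_term B w z k j \<omega> \<partial>?M) \<partial>count_space UNIV) \<partial>count_space UNIV)"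
      by (intro nn_integral_cong nn_integral_count_space_nn_integral measurable_deco_term countableI_type)
    finally show ?thesis
      by (simp add: emeasure_space_1 del: nn_integral_indicator)
  qed
  also have "\<dots> = (\<integral>\<^sup>+ k. indicator {k. w k = Some z} k
      + (\<integral>\<^sup>+ j. (\<integral>\<^sup>+\<omega>. deco_term B w z k j \<omega> \<partial>?M) \<partial>count_space UNIV) \<partial>count_space UNIV)"
    by (rule nn_integral_add[symmetric]) auto
  also have "\<dots> = (\<integral>\<^sup>+k. lift0 (\<lambda>v. indicator {z} v + (if v \<in> B then green d P v z
      else barm d v * (\<integral>\<^sup>+y. green d P y z \<partial>measure_pmf (P v)))) (w k) \<partial>count_space UNIV)"
  proof (rule nn_integral_cong)
    fix k
    show "indicator {k. w k = Some z} k + (\<integral>\<^sup>+ j. (\<integral>\<^sup>+\<omega>. deco_term B w z k j \<omega> \<partial>?M) \<partial>count_space UNIV)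
      = lift0 (\<lambda>v. indicator {z} v + (if v \<in> B then green d P v z
          else barm d v * (\<integral>\<^sup>+y. green d P y z \<partial>measure_pmf (P v)))) (w k)"
    proof (cases "w k")
      case None
      then show ?thesis by (simp add: expectation_deco_term)
    next
      case (Some v)
      have "(\<integral>\<^sup>+j. (if j = (0::nat) then green d P v z else 0) \<partial>count_space UNIV)
          = (\<integral>\<^sup>+j. green d P v z * indicator {0::nat} j \<partial>count_space UNIV)"
        by (intro nn_integral_cong) auto
      also have "\<dots> = green d P v z"
        by (simp add: nn_integral_indicator_singleton')
      finally have root: "(\<integral>\<^sup>+j. (if j = (0::nat) then green d P v z else 0) \<partial>count_space UNIV) = green d P v z" .
      have "indicator {k. w k = Some z} k = (indicator {z} v :: ennreal)"
        by (simp add: Some indicator_def)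
      with root show ?thesis
        by (simp add: Some expectation_deco_term nn_integral_multc barm_eq_sum del: nn_integral_indicator One_nat_def)
    qed
  qed
  finally show ?thesis .
qed

text \<open>A finite expected count forces a finite count almost surely. As the state space is
  countable, the null sets of classes and of decorations can be chosen for all z at once.\<close>

lemma (in quasi_bmc) decorable:
  assumes C: "Cconst d P B < \<top>"
  shows "decorable d P B \<eta>"
proof -
  define \<phi> where "\<phi> = (\<lambda>z v. indicator {z} v + (if v \<in> B then green d P v z
      else barm d v * (\<integral>\<^sup>+y. green d P y z \<partial>measure_pmf (P v))))"
  have "AE c in \<eta>. path_sum (\<phi> z) (rep c) < \<top>" for z
  proof -
    obtain K where "K < \<top>" "\<And>x. (\<Sum>n. chain_mean n (\<phi> z) x) \<le> K"
      using visit_weight_bound[OF C, of z] unfolding \<phi>_def by blast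
    then show ?thesis by (intro AE_path_sum_finite)
  qed
  then have "AE c in \<eta>. \<forall>z. path_sum (\<phi> z) (rep c) < \<top>"
    by (simp add: AE_all_countable)
  then show ?thesis
    unfolding decorable_def
  proof eventually_elim
    case (elim c)
    have "AE \<omega> in deco_meas d P B (rep c). deco_count B (rep c) \<omega> z \<noteq> \<infinity>" for z
    proof (rule nn_integral_PInf_AE[OF measurable_deco_count])
      show "(\<integral>\<^sup>+\<omega>. deco_count B (rep c) \<omega> z \<partial>deco_meas d P B (rep c)) \<noteq> \<infinity>"
        using elim unfolding expectation_deco_count path_sum_def \<phi>_def by (simp add: less_top)
    qed
    then show ?case by (simp add: AE_all_countable less_top)
  qed
qed

theorem mainTheorem13:
  fixes d :: "'a::countable \<Rightarrow> nat pmf" and P :: "'a \<Rightarrow> 'a pmf" and B :: "'a set"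
  assumes green_finite: "\<forall>x y. green d P x y < \<top>"
    and norming: "norming_region d P B"
    and barm_finite: "\<forall>x. barm d x < \<top>"
    and C_finite: "Cconst d P B < \<top>"
  shows "(\<forall>\<eta>. quasi_process d P B \<eta> \<longrightarrow> decorable d P B \<eta>)
    \<and> (\<forall>x. hB d P B x / (4 * Cconst d P B + 2) \<le> prob_hit d P B x
          \<and> prob_hit d P B x \<le> hB d P B x)"
proof -
  interpret norming_bmc d P B
    by unfold_locales (use green_finite norming in auto)
  have "decorable d P B \<eta>" if "quasi_process d P B \<eta>" for \<eta>
  proof -
    interpret quasi_bmc d P B \<eta> by unfold_locales (rule that)
    show ?thesis by (rule decorable[OF C_finite])
  qed
  then show ?thesis
    using prob_hit_lower_bound[OF C_finite] prob_hit_le_hB by blast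
qed

end
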